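(* Let $n\ge 1$, $0<p\le 1$ and $\delta>n/p-(n+1)/2$. Then there exists a constant $C>0$ such that for every $f\in WH^p(\mathbb R^n)$, $$\big\|T^\delta_*(f)\big\|_{WL^p}\le C\,\|f\|_{WH^p},$$ where $C$ is independent of $f$.
   Context: **Bochner-Riesz operators.** For $\delta>0$ and $0<R<\infty$, $T^\delta_R$ is defined initially for Schwartz functions $f$ on $\mathbb R^n$ by $\widehat{T^\delta_R f}(\xi)=\big(1-|\xi|^2/R^2\big)^\delta_+\,\hat f(\xi)$, where $\hat f(\xi)=\int f(x)e^{-2\pi i x\cdot\xi}\,dx$. Equivalently $T^\delta_R f=\phi_{1/R}*f$, where $\phi$ is the Fourier transform of $\xi\mapsto(1-|\xi|^2)^\delta_+$ and $\phi_{1/R}(x)=R^n\phi(Rx)$; explicitly $\phi(x)=\pi^{-\delta}\Gamma(\delta+1)|x|^{-(n/2+\delta)}J_{n/2+\delta}(2\pi|x|)$, with $J_\mu$ the Bessel function. For a tempered distribution $f\in WH^p(\mathbb R^n)$ (defined below), the function $T^\delta_R f=\phi_{1/R}*f$ is understood as the convolution $\phi_{1/R}*(\psi*f)$ of functions, where $\psi\in\mathscr S(\mathbb R^n)$ is any Schwartz function with $\hat\psi=1$ on a neighbourhood of $\{|\xi|\le R\}$. The maximal Bochner-Riesz operator is $T^\delta_* f(x)=\sup_{R>0}|T^\delta_R f(x)|$. **Weak Lebesgue space.** $\|g\|_{WL^p}=\sup_{\lambda>0}\lambda\,|\{x\in\mathbb R^n:|g(x)|>\lambda\}|^{1/p}$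 (Lebesgue measure), and $WL^p(\mathbb R^n)$ is the set of measurable $g$ for which this is finite. **Weak Hardy space.** Let $0<p\le1$ and fix an integer $N\ge[n(1/p-1)]$ ($[\cdot]$ is the integer part). Put $$\mathscr A_{N}=\Big\{\varphi\in\mathscr S(\mathbb R^n):\sup_{x\in\mathbb R^n}\sup_{|\alpha|\le N+1}(1+|x|)^{N+n+1}|D^\alpha\varphi(x)|\le1\Big\},$$ and $\varphi_t(x)=t^{-n}\varphi(x/t)$. For $f\in\mathscr S'(\mathbb R^n)$ let $Gf(x)=\sup_{\varphi\in\mathscr A_{N}}\sup_{|y-x|<t}|(\varphi_t*f)(y)|$. Then $WH^p(\mathbb R^n)=\{f\in\mathscr S'(\mathbb R^n):Gf\in WL^p(\mathbb R^n)\}$ with $\|f\|_{WH^p}=\|Gf\|_{WL^p}$. The same space, with an equivalent quasi-norm, is obtained by replacing $Gf$ by the radial grand maximal function $G^+f(x)=\sup_{\varphi\in\mathscr A_{N}}\sup_{t>0}|(\varphi_t*f)(x)|$. *)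

theory Defs
  imports "HOL-Analysis.Analysis"
begin

section \<open>Schwartz functions and tempered distributions\<close>

definition partial_deriv :: "'n::finite \<Rightarrow> (real ^ 'n \<Rightarrow> complex) \<Rightarrow> real ^ 'n \<Rightarrow> complex" where
  "partial_deriv i f = (\<lambda>x. frechet_derivative f (at x) (axis i 1))"

text \<open>
  A derivative \<open>D\<^sup>\<alpha>\<close> is given by the list of the directions in which one differentiates, so
  that \<open>|\<alpha>|\<close> is \<open>length \<alpha>\<close>. On smooth functions the order of the directions is irrelevant,
  and the lists of length at most \<open>m\<close> give exactly the \<open>D\<^sup>\<alpha>\<close> with \<open>|\<alpha>| \<le> m\<close>.
\<close>

definition iterated_deriv :: "'n::finite list \<Rightarrow> (real ^ 'n \<Rightarrow> complex) \<Rightarrow> real ^ 'n \<Rightarrow> complex" where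
  "iterated_deriv \<alpha> f = foldr partial_deriv \<alpha> f"

definition schwartz :: "(real ^ 'n::finite \<Rightarrow> complex) set" where
  "schwartz = {f.
     (\<forall>\<alpha> x. iterated_deriv \<alpha> f differentiable (at x)) \<and>
     (\<forall>k \<alpha>. bdd_above (range (\<lambda>x. (1 + norm x) ^ k * cmod (iterated_deriv \<alpha> f x))))}"

text \<open>A real supremum, hence meaningful for Schwartz functions only.\<close>

definition schwartz_seminorm :: "nat \<Rightarrow> nat \<Rightarrow> (real ^ 'n::finite \<Rightarrow> complex) \<Rightarrow> real" where
  "schwartz_seminorm k m f =
     (SUP (x, \<alpha>) \<in> UNIV \<times> {\<alpha>. length \<alpha> \<le> m}. (1 + norm x) ^ k * cmod (iterated_deriv \<alpha> f x))"

text \<open>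
  The continuous linear functionals on the Schwartz space. The seminorms are directed, so
  continuity is domination by a multiple of one of them. The values of a functional outside
  the Schwartz space are irrelevant and never used.
\<close>

definition tempered_distributions :: "((real ^ 'n::finite \<Rightarrow> complex) \<Rightarrow> complex) set" where
  "tempered_distributions = {u.
     (\<forall>f\<in>schwartz. \<forall>g\<in>schwartz. u (\<lambda>x. f x + g x) = u f + u g) \<and>
     (\<forall>c. \<forall>f\<in>schwartz. u (\<lambda>x. c * f x) = c * u f) \<and>
     (\<exists>C k m. \<forall>f\<in>schwartz. cmod (u f) \<le> C * schwartz_seminorm k m f)}"

definition dilate :: "real \<Rightarrow> (real ^ 'n::finite \<Rightarrow> complex) \<Rightarrow> real ^ 'n \<Rightarrow> complex" where
  "dilate t f = (\<lambda>x. f (x /\<^sub>R t) /\<^sub>R t ^ CARD('n))"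

definition distr_convolution ::
    "(real ^ 'n::finite \<Rightarrow> complex) \<Rightarrow> ((real ^ 'n \<Rightarrow> complex) \<Rightarrow> complex) \<Rightarrow> real ^ 'n \<Rightarrow> complex" where
  "distr_convolution \<phi> u = (\<lambda>x. u (\<lambda>y. \<phi> (x - y)))"

definition convolution ::
    "(real ^ 'n::finite \<Rightarrow> complex) \<Rightarrow> (real ^ 'n \<Rightarrow> complex) \<Rightarrow> real ^ 'n \<Rightarrow> complex" where
  "convolution f g = (\<lambda>x. LINT y|lebesgue. f (x - y) * g y)"

definition fourier :: "(real ^ 'n::finite \<Rightarrow> complex) \<Rightarrow> real ^ 'n \<Rightarrow> complex" where
  "fourier f = (\<lambda>\<xi>. LINT x|lebesgue. f x * exp (- 2 * of_real pi * \<i> * of_real (x \<bullet> \<xi>)))"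

section \<open>Weak Lebesgue and weak Hardy spaces\<close>

definition ennreal_powr :: "ennreal \<Rightarrow> real \<Rightarrow> ennreal" where
  "ennreal_powr a s = (if a = \<infinity> then \<infinity> else ennreal (enn2real a powr s))" \<comment> \<open>for \<open>s > 0\<close>\<close>

text \<open>
  Maximal functions may be infinite, so the weak \<open>L\<^sup>p\<close> notions are stated for functions with
  values in \<open>[0, \<infinity>]\<close>. The norm alone is only meaningful for measurable functions.
\<close>

definition weak_Lp_norm :: "real \<Rightarrow> (real ^ 'n::finite \<Rightarrow> ennreal) \<Rightarrow> ennreal" where
  "weak_Lp_norm p g =
     (SUP s\<in>{0<..}. ennreal s * ennreal_powr (emeasure lebesgue {x. g x > ennreal s}) (1 / p))"

definition weak_Lp :: "real \<Rightarrow> (real ^ 'n::finite \<Rightarrow> ennreal) set" where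
  "weak_Lp p = {g. g \<in> borel_measurable lebesgue \<and> weak_Lp_norm p g < \<infinity>}"

definition grand_test_functions :: "nat \<Rightarrow> (real ^ 'n::finite \<Rightarrow> complex) set" where
  "grand_test_functions N = {\<phi>\<in>schwartz. schwartz_seminorm (N + CARD('n) + 1) (N + 1) \<phi> \<le> 1}"

definition grand_maximal ::
    "nat \<Rightarrow> ((real ^ 'n::finite \<Rightarrow> complex) \<Rightarrow> complex) \<Rightarrow> real ^ 'n \<Rightarrow> ennreal" where
  "grand_maximal N u x =
     (SUP \<phi>\<in>grand_test_functions N. SUP (y, t)\<in>{(y, t). norm (y - x) < t}.
        ennreal (cmod (distr_convolution (dilate t \<phi>) u y)))"

definition weak_Hardy :: "nat \<Rightarrow> real \<Rightarrow> ((real ^ 'n::finite \<Rightarrow> complex) \<Rightarrow> complex) set" where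
  "weak_Hardy N p = {u\<in>tempered_distributions. grand_maximal N u \<in> weak_Lp p}"

definition weak_Hardy_norm ::
    "nat \<Rightarrow> real \<Rightarrow> ((real ^ 'n::finite \<Rightarrow> complex) \<Rightarrow> complex) \<Rightarrow> ennreal" where
  "weak_Hardy_norm N p u = weak_Lp_norm p (grand_maximal N u)"

section \<open>Bochner-Riesz operators\<close>

definition bochner_riesz_kernel :: "real \<Rightarrow> real ^ 'n::finite \<Rightarrow> complex" where
  "bochner_riesz_kernel \<delta> = fourier (\<lambda>\<xi>. of_real (max 0 (1 - (norm \<xi>)\<^sup>2) powr \<delta>))"

definition frequency_cutoffs :: "real \<Rightarrow> (real ^ 'n::finite \<Rightarrow> complex) set" where
  "frequency_cutoffs R =
     {\<psi>\<in>schwartz. \<exists>U. open U \<and> cball 0 R \<subseteq> U \<and> (\<forall>\<xi>\<in>U. fourier \<psi> \<xi> = 1)}"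

text \<open>
  The Bochner-Riesz mean of a distribution in a weak Hardy space does not depend on the choice
  of \<open>\<psi> \<in> frequency_cutoffs R\<close>; \<open>\<psi>\<close> is therefore kept as an argument. The maximal operator
  takes one cutoff \<open>\<Psi> R\<close> for each \<open>R > 0\<close>.
\<close>

definition bochner_riesz ::
    "real \<Rightarrow> real \<Rightarrow> (real ^ 'n::finite \<Rightarrow> complex) \<Rightarrow>
     ((real ^ 'n \<Rightarrow> complex) \<Rightarrow> complex) \<Rightarrow> real ^ 'n \<Rightarrow> complex" where
  "bochner_riesz \<delta> R \<psi> u =
     convolution (dilate (1 / R) (bochner_riesz_kernel \<delta>)) (distr_convolution \<psi> u)"

definition bochner_riesz_maximal ::
    "real \<Rightarrow> (real \<Rightarrow> real ^ 'n::finite \<Rightarrow> complex) \<Rightarrow>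
     ((real ^ 'n \<Rightarrow> complex) \<Rightarrow> complex) \<Rightarrow> real ^ 'n \<Rightarrow> ennreal" where
  "bochner_riesz_maximal \<delta> \<Psi> u x =
     (SUP R\<in>{0<..}. ennreal (cmod (bochner_riesz \<delta> R (\<Psi> R) u x)))"

end

theory Submission
  imports Defs
begin

text \<open>
  Let \<open>\<phi>\<close> be the kernel and \<open>\<kappa>\<close> a number between \<open>n / p\<close> and the order \<open>\<delta> + (n + 1) / 2\<close> of its decay.
  Being band-limited, \<open>\<phi> = \<phi> * \<psi>\<close> for every cutoff \<open>\<psi>\<close>, so all its derivatives decay like \<open>|x|\<^sup>-\<^sup>\<kappa>\<close>.
  Cut \<open>\<phi>\<close> into pieces near the points \<open>k\<close> of the integer lattice: the piece at \<open>k\<close> is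
  \<open>(1 + |k|)\<^sup>-\<^sup>\<kappa>\<close> times a translate by \<open>k\<close> of an admissible test function, so that, at scale \<open>t = 1 / R\<close>,
  its contribution to \<open>T\<^sub>R f(x)\<close> is at most \<open>(1 + |k|)\<^sup>-\<^sup>\<kappa>\<close> times the infimum of the grand maximal
  function \<open>G f\<close> over a ball of radius comparable to \<open>t\<close> around \<open>x - t k\<close>. Choose \<open>q < p\<close> with \<open>\<kappa> q > n\<close>.
  As \<open>q \<le> 1\<close>, the \<open>q\<close>-th power of the sum over \<open>k\<close> is at most the sum of the \<open>q\<close>-th powers, which is
  dominated by the Hardy-Littlewood maximal function: \<open>T\<^sub>* f \<le> C M((G f)\<^sup>q)\<^sup>1\<^sup>/\<^sup>q\<close>. Finally \<open>M\<close> is bounded on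
  weak \<open>L\<close> of exponent \<open>p / q > 1\<close>.
\<close>

section \<open>Schwartz functions\<close>

text \<open>The obstacle is that the kernel is known to decay only at a fixed polynomial rate, so a
  distribution cannot be applied to it directly. The mean is defined through a cutoff that varies
  with R, and the constant must not depend on that cutoff. The kernel is truncated to a ball of
  radius M and mollified by the rescaled cutoff, which gives a test function. It differs from the
  kernel by the mollified outer part. The constant of this remainder does depend on the cutoff, but
  it carries the factor (1 + M) to the power -(K - \<kappa>), where K is the full order of decay;
  the factor tends to 0, which is why \<kappa> lies strictly below K. The derivatives of the kernel
  itself are bounded with one fixed cutoff. The limit in M needs the convolution of f with the
  cutoff to be bounded, which follows from the weak bound on the grand maximal function. The order
  of decay comes from slicing: integrating the multiplier over hyperplanes raises its exponent by (n
  - 1) / 2, and the Fourier transform in the remaining variable gains one more power.\<close>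

lemma iterated_deriv_Nil [simp]: "iterated_deriv [] f = f"
  by (simp add: iterated_deriv_def)

lemma iterated_deriv_Cons [simp]: "iterated_deriv (i # \<alpha>) f = partial_deriv i (iterated_deriv \<alpha> f)"
  by (simp add: iterated_deriv_def)

lemma iterated_deriv_append: "iterated_deriv (\<alpha> @ \<beta>) f = iterated_deriv \<alpha> (iterated_deriv \<beta> f)"
  by (simp add: iterated_deriv_def)

lemma partial_deriv_eq: "(f has_derivative f') (at x) \<Longrightarrow> partial_deriv i f x = f' (axis i 1)"
  unfolding partial_deriv_def by (metis frechet_derivative_at)

lemma has_derivative_partial_deriv:
  fixes f :: "real ^ 'n::finite \<Rightarrow> complex"
  assumes "f differentiable (at x)"
  shows "(f has_derivative (\<lambda>v. \<Sum>i\<in>UNIV. (v $ i) *\<^sub>R partial_deriv i f x)) (at x)"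
proof -
  let ?D = "frechet_derivative f (at x)"
  have D: "(f has_derivative ?D) (at x)" using assms frechet_derivative_works by blast
  interpret linear ?D using D has_derivative_linear by blast
  have "?D v = (\<Sum>i\<in>UNIV. (v $ i) *\<^sub>R partial_deriv i f x)" for v
  proof -
    have "?D v = ?D (\<Sum>i\<in>UNIV. (v $ i) *\<^sub>R axis i 1)"
      by (metis basis_expansion scalar_mult_eq_scaleR)
    then show ?thesis by (simp add: sum scale partial_deriv_def)
  qed
  then have "?D = (\<lambda>v. \<Sum>i\<in>UNIV. (v $ i) *\<^sub>R partial_deriv i f x)" by (rule ext)
  then show ?thesis using D by simp
qed

lemma sum_axis_scaleR:
  fixes F :: "'n::finite \<Rightarrow> 'b::real_vector"
  shows "(\<Sum>j\<in>UNIV. ((axis i 1 :: real ^ 'n) $ j) *\<^sub>R F j) = F i"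
  by (simp add: axis_def if_distrib[of "\<lambda>d. d *\<^sub>R _"] cong: if_cong)

text \<open>Kept apart from \<open>schwartz\<close> because the Bochner-Riesz kernel and
  convolutions with bounded functions are differentiated too, and these are smooth without being
  known to decay rapidly.\<close>

definition smooth :: "(real ^ 'n::finite \<Rightarrow> complex) \<Rightarrow> bool" where
  "smooth f \<longleftrightarrow> (\<forall>\<alpha> x. iterated_deriv \<alpha> f differentiable (at x))"

lemma smooth_differentiable: "smooth f \<Longrightarrow> iterated_deriv \<alpha> f differentiable (at x)"
  by (simp add: smooth_def)

lemma smooth_continuous_on: "smooth f \<Longrightarrow> continuous_on UNIV (iterated_deriv \<alpha> f)"
  by (intro continuous_at_imp_continuous_on ballI differentiable_imp_continuous_within smooth_differentiable)

lemma smooth_has_derivative: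
  "smooth f \<Longrightarrow> (iterated_deriv \<alpha> f has_derivative
     (\<lambda>v. \<Sum>i\<in>UNIV. (v $ i) *\<^sub>R iterated_deriv (i # \<alpha>) f x)) (at x)"
  using has_derivative_partial_deriv[OF smooth_differentiable] by simp

lemma schwartz_smooth: "f \<in> schwartz \<Longrightarrow> smooth f"
  by (simp add: schwartz_def smooth_def)

text \<open>Over a finite index type there are only finitely many lists of length at most
  \<open>m\<close>, so the individual bounds can be added up to one that serves all of them.\<close>

lemma schwartz_bound:
  fixes f :: "real ^ 'n::finite \<Rightarrow> complex"
  assumes "f \<in> schwartz"
  obtains C where "0 < C"
    "\<And>\<alpha> x. length \<alpha> \<le> m \<Longrightarrow> (1 + norm x) ^ k * cmod (iterated_deriv \<alpha> f x) \<le> C"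
proof -
  let ?L = "{\<alpha> :: 'n list. length \<alpha> \<le> m}"
  have fin: "finite ?L" using finite_lists_length_le[of "UNIV :: 'n set" m] by simp
  have "\<forall>\<alpha>. \<exists>M. \<forall>x. (1 + norm x) ^ k * cmod (iterated_deriv \<alpha> f x) \<le> M"
    using assms unfolding schwartz_def bdd_above_def by auto
  then obtain M where M: "\<And>\<alpha> x. (1 + norm x) ^ k * cmod (iterated_deriv \<alpha> f x) \<le> M \<alpha>"
    by metis
  show thesis
  proof
    show "0 < 1 + (\<Sum>\<alpha>\<in>?L. \<bar>M \<alpha>\<bar>)" by (simp add: add_pos_nonneg sum_nonneg)
    fix \<alpha> :: "'n list" and x :: "real ^ 'n"
    assume "length \<alpha> \<le> m"
    then have "\<bar>M \<alpha>\<bar> \<le> (\<Sum>\<alpha>\<in>?L. \<bar>M \<alpha>\<bar>)" using fin by (intro member_le_sum) auto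
    then show "(1 + norm x) ^ k * cmod (iterated_deriv \<alpha> f x) \<le> 1 + (\<Sum>\<alpha>\<in>?L. \<bar>M \<alpha>\<bar>)"
      using M[where \<alpha>=\<alpha> and x=x] by linarith
  qed
qed

lemma schwartzI:
  assumes "smooth f" "\<And>k \<alpha>. \<exists>C. \<forall>x. (1 + norm x) ^ k * cmod (iterated_deriv \<alpha> f x) \<le> C"
  shows "f \<in> schwartz"
  using assms unfolding schwartz_def smooth_def bdd_above_def by fastforce

lemma schwartz_iterated_deriv: "f \<in> schwartz \<Longrightarrow> iterated_deriv \<alpha> f \<in> schwartz"
  unfolding schwartz_def by (simp add: iterated_deriv_append[symmetric])

section \<open>Sums, multiples and affine substitutions\<close>

lemma iterated_deriv_add:
  assumes "smooth f" "smooth g"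
  shows "iterated_deriv \<alpha> (\<lambda>x. f x + g x) = (\<lambda>x. iterated_deriv \<alpha> f x + iterated_deriv \<alpha> g x)"
proof (induction \<alpha>)
  case (Cons i \<alpha>)
  show ?case
  proof
    fix x
    have "((\<lambda>x. iterated_deriv \<alpha> f x + iterated_deriv \<alpha> g x) has_derivative
      (\<lambda>v. (\<Sum>i\<in>UNIV. (v $ i) *\<^sub>R iterated_deriv (i # \<alpha>) f x) +
           (\<Sum>i\<in>UNIV. (v $ i) *\<^sub>R iterated_deriv (i # \<alpha>) g x))) (at x)"
      by (intro has_derivative_add smooth_has_derivative assms)
    from partial_deriv_eq[OF this, of i]
    show "iterated_deriv (i # \<alpha>) (\<lambda>x. f x + g x) x = iterated_deriv (i # \<alpha>) f x + iterated_deriv (i # \<alpha>) g x"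
      by (simp add: Cons sum_axis_scaleR)
  qed
qed simp

lemma smooth_add:
  assumes "smooth f" "smooth g" shows "smooth (\<lambda>x. f x + g x)"
  using assms unfolding smooth_def[of "\<lambda>x. f x + g x"] iterated_deriv_add[OF assms]
  by (intro allI differentiable_add smooth_differentiable)

lemma iterated_deriv_cmult:
  assumes "smooth f"
  shows "iterated_deriv \<alpha> (\<lambda>x. c * f x) = (\<lambda>x. c * iterated_deriv \<alpha> f x)"
proof (induction \<alpha>)
  case (Cons i \<alpha>)
  show ?case
  proof
    fix x
    have "((\<lambda>x. c * iterated_deriv \<alpha> f x) has_derivative
      (\<lambda>v. c * (\<Sum>i\<in>UNIV. (v $ i) *\<^sub>R iterated_deriv (i # \<alpha>) f x))) (at x)"
      by (intro has_derivative_mult_right smooth_has_derivative assms)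
    from partial_deriv_eq[OF this, of i]
    show "iterated_deriv (i # \<alpha>) (\<lambda>x. c * f x) x = c * iterated_deriv (i # \<alpha>) f x"
      by (simp add: Cons sum_axis_scaleR)
  qed
qed simp

lemma smooth_cmult:
  assumes "smooth f" shows "smooth (\<lambda>x. c * f x)"
  using assms unfolding smooth_def[of "\<lambda>x. c * f x"] iterated_deriv_cmult[OF assms]
  by (intro allI differentiable_mult differentiable_const smooth_differentiable)

lemma schwartz_add:
  assumes "f \<in> schwartz" "g \<in> schwartz" shows "(\<lambda>x. f x + g x) \<in> schwartz"
proof (rule schwartzI)
  note sm = schwartz_smooth[OF assms(1)] schwartz_smooth[OF assms(2)]
  show "smooth (\<lambda>x. f x + g x)" using sm by (rule smooth_add)
  fix k and \<alpha> :: "'a list"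
  obtain A where A: "\<And>\<beta> x. length \<beta> \<le> length \<alpha> \<Longrightarrow> (1 + norm x) ^ k * cmod (iterated_deriv \<beta> f x) \<le> A"
    using schwartz_bound[OF assms(1), of "length \<alpha>" k] by metis
  obtain B where B: "\<And>\<beta> x. length \<beta> \<le> length \<alpha> \<Longrightarrow> (1 + norm x) ^ k * cmod (iterated_deriv \<beta> g x) \<le> B"
    using schwartz_bound[OF assms(2), of "length \<alpha>" k] by metis
  have "(1 + norm x) ^ k * cmod (iterated_deriv \<alpha> (\<lambda>x. f x + g x) x) \<le> A + B" for x
  proof -
    have "(1 + norm x) ^ k * cmod (iterated_deriv \<alpha> (\<lambda>x. f x + g x) x) \<le>
       (1 + norm x) ^ k * (cmod (iterated_deriv \<alpha> f x) + cmod (iterated_deriv \<alpha> g x))"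
      unfolding iterated_deriv_add[OF sm] by (intro mult_left_mono norm_triangle_ineq) auto
    also have "\<dots> \<le> A + B"
      using A[of \<alpha> x] B[of \<alpha> x] by (simp add: distrib_left)
    finally show ?thesis .
  qed
  then show "\<exists>C. \<forall>x. (1 + norm x) ^ k * cmod (iterated_deriv \<alpha> (\<lambda>x. f x + g x) x) \<le> C" by blast
qed

lemma schwartz_cmult:
  assumes "f \<in> schwartz" shows "(\<lambda>x. c * f x) \<in> schwartz"
proof (rule schwartzI)
  note sm = schwartz_smooth[OF assms]
  show "smooth (\<lambda>x. c * f x)" using sm by (rule smooth_cmult)
  fix k and \<alpha> :: "'a list"
  obtain A where A: "\<And>\<beta> x. length \<beta> \<le> length \<alpha> \<Longrightarrow> (1 + norm x) ^ k * cmod (iterated_deriv \<beta> f x) \<le> A"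
    using schwartz_bound[OF assms, of "length \<alpha>" k] by metis
  have "(1 + norm x) ^ k * cmod (iterated_deriv \<alpha> (\<lambda>x. c * f x) x) \<le> cmod c * A" for x
  proof -
    have "(1 + norm x) ^ k * cmod (iterated_deriv \<alpha> (\<lambda>x. c * f x) x) =
       cmod c * ((1 + norm x) ^ k * cmod (iterated_deriv \<alpha> f x))"
      unfolding iterated_deriv_cmult[OF sm] by (simp add: norm_mult)
    also have "\<dots> \<le> cmod c * A" using A[of \<alpha> x] by (intro mult_left_mono) auto
    finally show ?thesis .
  qed
  then show "\<exists>C. \<forall>x. (1 + norm x) ^ k * cmod (iterated_deriv \<alpha> (\<lambda>x. c * f x) x) \<le> C" by blast
qed

lemma schwartz_zero: "(\<lambda>x. 0) \<in> schwartz"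
proof -
  have "iterated_deriv \<alpha> (\<lambda>x. 0) = (\<lambda>x. 0)" for \<alpha> :: "'a list"
    by (induction \<alpha>) (auto simp: partial_deriv_eq[OF has_derivative_const])
  then show ?thesis by (intro schwartzI) (auto simp: smooth_def)
qed

lemma schwartz_sum:
  assumes "\<And>i. i \<in> S \<Longrightarrow> f i \<in> schwartz" shows "(\<lambda>x. \<Sum>i\<in>S. f i x) \<in> schwartz"
  using assms by (induction S rule: infinite_finite_induct) (auto intro: schwartz_add schwartz_zero)

lemma iterated_deriv_affine:
  fixes c :: real
  assumes "smooth f"
  shows "iterated_deriv \<alpha> (\<lambda>x. f (c *\<^sub>R x + a)) = (\<lambda>x. of_real (c ^ length \<alpha>) * iterated_deriv \<alpha> f (c *\<^sub>R x + a))"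
proof (induction \<alpha>)
  case (Cons i \<alpha>)
  show ?case
  proof
    fix x
    have "((\<lambda>x. iterated_deriv \<alpha> f (c *\<^sub>R x + a)) has_derivative
      (\<lambda>v. (\<Sum>i\<in>UNIV. ((c *\<^sub>R v) $ i) *\<^sub>R iterated_deriv (i # \<alpha>) f (c *\<^sub>R x + a)))) (at x)"
      by (rule has_derivative_compose[OF _ smooth_has_derivative[OF assms]])
        (auto intro!: derivative_eq_intros)
    from partial_deriv_eq[OF has_derivative_mult_right[OF this, of "of_real (c ^ length \<alpha>)"], of i]
    show "iterated_deriv (i # \<alpha>) (\<lambda>x. f (c *\<^sub>R x + a)) x =
        of_real (c ^ length (i # \<alpha>)) * iterated_deriv (i # \<alpha>) f (c *\<^sub>R x + a)"
      unfolding iterated_deriv_Cons Cons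
      by (simp add: scaleR_scaleR[symmetric] scaleR_sum_right[symmetric] sum_axis_scaleR
          del: scaleR_scaleR scaleR_conv_of_real) (simp add: scaleR_conv_of_real[where 'a=complex])
  qed
qed simp

lemma smooth_affine:
  fixes c :: real
  assumes "smooth f" shows "smooth (\<lambda>x. f (c *\<^sub>R x + a))"
  unfolding smooth_def iterated_deriv_affine[OF assms]
proof (intro allI differentiable_mult differentiable_const)
  fix \<alpha> x
  have "((\<lambda>x. iterated_deriv \<alpha> f (c *\<^sub>R x + a)) has_derivative
      (\<lambda>v. (\<Sum>i\<in>UNIV. ((c *\<^sub>R v) $ i) *\<^sub>R iterated_deriv (i # \<alpha>) f (c *\<^sub>R x + a)))) (at x)"
      by (rule has_derivative_compose[OF _ smooth_has_derivative[OF assms]])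
        (auto intro!: derivative_eq_intros)
  then show "(\<lambda>x. iterated_deriv \<alpha> f (c *\<^sub>R x + a)) differentiable at x"
    unfolding differentiable_def by blast
qed

lemma affine_weight_bound:
  fixes c :: real and a :: "'a::real_normed_vector"
  assumes "c \<noteq> 0"
  shows "1 + norm x \<le> (2 + norm a) * (1 + 1 / \<bar>c\<bar>) * (1 + norm (c *\<^sub>R x + a))"
proof -
  let ?y = "c *\<^sub>R x + a"
  have "norm x = norm (?y - a) / \<bar>c\<bar>" using assms by simp
  also have "\<dots> \<le> (norm ?y + norm a) / \<bar>c\<bar>"
    by (intro divide_right_mono norm_triangle_ineq4) auto
  finally have *: "norm x \<le> (norm ?y + norm a) * (1 / \<bar>c\<bar>)" by simp
  \<comment> \<open>After expansion every term on the left is dominated by a term on the right, and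
    all terms are nonnegative.\<close>
  have "1 + (v + u) * w \<le> (2 + u) * (1 + w) * (1 + v)" if "0 \<le> u" "0 \<le> v" "0 \<le> w" for u v w :: real
    using that by (simp add: algebra_simps add_increasing)
  from this[of "norm a" "norm ?y" "1 / \<bar>c\<bar>"] * show ?thesis by simp
qed

text \<open>\<open>K\<close> depends on the affine map and on \<open>k\<close> and \<open>m\<close>,
  but not on \<open>f\<close>. This uniformity is what lets a tempered functional be composed with
  an affine substitution.\<close>

lemma iterated_deriv_affine_bound:
  fixes a :: "real ^ 'n::finite"
  assumes "c \<noteq> 0"
  obtains K where "0 < K" "\<And>f B. f \<in> schwartz \<Longrightarrow>
    \<forall>\<alpha> x. length \<alpha> \<le> m \<longrightarrow> (1 + norm x) ^ k * cmod (iterated_deriv \<alpha> f x) \<le> B \<Longrightarrow>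
    \<forall>\<alpha> x. length \<alpha> \<le> m \<longrightarrow>
      (1 + norm x) ^ k * cmod (iterated_deriv \<alpha> (\<lambda>x. f (c *\<^sub>R x + a)) x) \<le> K * B"
proof
  define K where "K = ((2 + norm a) * (1 + 1 / \<bar>c\<bar>)) ^ k * (1 + \<bar>c\<bar>) ^ m"
  show "0 < K" by (auto simp: K_def intro!: mult_pos_pos zero_less_power add_pos_nonneg)
  fix f :: "real ^ 'n \<Rightarrow> complex" and B
  assume f: "f \<in> schwartz"
    and B: "\<forall>\<alpha> x. length \<alpha> \<le> m \<longrightarrow> (1 + norm x) ^ k * cmod (iterated_deriv \<alpha> f x) \<le> B"
  show "\<forall>\<alpha> x. length \<alpha> \<le> m \<longrightarrow>
      (1 + norm x) ^ k * cmod (iterated_deriv \<alpha> (\<lambda>x. f (c *\<^sub>R x + a)) x) \<le> K * B"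
  proof (intro allI impI)
    fix \<alpha> :: "'n list" and x :: "real ^ 'n"
    assume \<alpha>: "length \<alpha> \<le> m"
    let ?y = "c *\<^sub>R x + a"
    have "(1 + norm x) ^ k * cmod (iterated_deriv \<alpha> (\<lambda>x. f (c *\<^sub>R x + a)) x) =
       (1 + norm x) ^ k * \<bar>c\<bar> ^ length \<alpha> * cmod (iterated_deriv \<alpha> f ?y)"
      unfolding iterated_deriv_affine[OF schwartz_smooth[OF f]] by (simp add: norm_mult norm_power)
    also have "\<dots> \<le> ((2 + norm a) * (1 + 1 / \<bar>c\<bar>) * (1 + norm ?y)) ^ k * (1 + \<bar>c\<bar>) ^ m * cmod (iterated_deriv \<alpha> f ?y)"
    proof (intro mult_right_mono mult_mono power_mono affine_weight_bound assms)
      have "\<bar>c\<bar> ^ length \<alpha> \<le> (1 + \<bar>c\<bar>) ^ length \<alpha>" by (intro power_mono) auto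
      also have "\<dots> \<le> (1 + \<bar>c\<bar>) ^ m" using \<alpha> by (intro power_increasing) auto
      finally show "\<bar>c\<bar> ^ length \<alpha> \<le> (1 + \<bar>c\<bar>) ^ m" .
    qed auto
    also have "\<dots> = K * ((1 + norm ?y) ^ k * cmod (iterated_deriv \<alpha> f ?y))"
      unfolding K_def power_mult_distrib by (simp add: ac_simps)
    also have "\<dots> \<le> K * B" using \<open>0 < K\<close> B \<alpha> by (intro mult_left_mono) auto
    finally show "(1 + norm x) ^ k * cmod (iterated_deriv \<alpha> (\<lambda>x. f (c *\<^sub>R x + a)) x) \<le> K * B" .
  qed
qed

lemma schwartz_affine:
  fixes a :: "real ^ 'n::finite"
  assumes f: "f \<in> schwartz" and "c \<noteq> 0" shows "(\<lambda>x. f (c *\<^sub>R x + a)) \<in> schwartz"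
proof (rule schwartzI)
  show "smooth (\<lambda>x. f (c *\<^sub>R x + a))" by (intro smooth_affine schwartz_smooth f)
  fix k and \<alpha> :: "'n list"
  obtain A where A: "\<And>\<beta> x. length \<beta> \<le> length \<alpha> \<Longrightarrow> (1 + norm x) ^ k * cmod (iterated_deriv \<beta> f x) \<le> A"
    using schwartz_bound[OF f, of "length \<alpha>" k] by metis
  obtain K where "\<And>f B. f \<in> schwartz \<Longrightarrow>
    \<forall>\<beta> x. length \<beta> \<le> length \<alpha> \<longrightarrow> (1 + norm x) ^ k * cmod (iterated_deriv \<beta> f x) \<le> B \<Longrightarrow>
    \<forall>\<beta> x. length \<beta> \<le> length \<alpha> \<longrightarrow>
      (1 + norm x) ^ k * cmod (iterated_deriv \<beta> (\<lambda>x. f (c *\<^sub>R x + a)) x) \<le> K * B"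
    by (rule iterated_deriv_affine_bound[OF assms(2), where a=a and m="length \<alpha>" and k=k]) blast
  from this[OF f, of A] A
  show "\<exists>C. \<forall>x. (1 + norm x) ^ k * cmod (iterated_deriv \<alpha> (\<lambda>x. f (c *\<^sub>R x + a)) x) \<le> C" by blast
qed

text \<open>The Leibniz rule, keeping only the number of terms and the orders of the derivatives.\<close>

lemma iterated_deriv_mult:
  assumes "smooth f" "smooth g"
  shows "\<exists>L. length L = 2 ^ length \<alpha> \<and>
    (\<forall>(\<beta>, \<gamma>)\<in>set L. length \<beta> \<le> length \<alpha> \<and> length \<gamma> \<le> length \<alpha>) \<and>
    iterated_deriv \<alpha> (\<lambda>x. f x * g x) = (\<lambda>x. \<Sum>(\<beta>, \<gamma>)\<leftarrow>L. iterated_deriv \<beta> f x * iterated_deriv \<gamma> g x)"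
proof (induction \<alpha>)
  case Nil
  show ?case by (rule exI[of _ "[([], [])]"]) auto
next
  case (Cons i \<alpha>)
  then obtain L where L: "length L = 2 ^ length \<alpha>"
    "\<forall>(\<beta>, \<gamma>)\<in>set L. length \<beta> \<le> length \<alpha> \<and> length \<gamma> \<le> length \<alpha>"
    "iterated_deriv \<alpha> (\<lambda>x. f x * g x) = (\<lambda>x. \<Sum>(\<beta>, \<gamma>)\<leftarrow>L. iterated_deriv \<beta> f x * iterated_deriv \<gamma> g x)"
    by blast
  define L' where "L' = map (\<lambda>(\<beta>, \<gamma>). (i # \<beta>, \<gamma>)) L @ map (\<lambda>(\<beta>, \<gamma>). (\<beta>, i # \<gamma>)) L"
  have der: "((\<lambda>x. \<Sum>(\<beta>, \<gamma>)\<leftarrow>L. iterated_deriv \<beta> f x * iterated_deriv \<gamma> g x) has_derivative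
     (\<lambda>v. \<Sum>(\<beta>, \<gamma>)\<leftarrow>L. iterated_deriv \<beta> f x * (\<Sum>i\<in>UNIV. (v $ i) *\<^sub>R iterated_deriv (i # \<gamma>) g x) +
        (\<Sum>i\<in>UNIV. (v $ i) *\<^sub>R iterated_deriv (i # \<beta>) f x) * iterated_deriv \<gamma> g x)) (at x)" for x
    by (induction L) (auto intro!: has_derivative_add has_derivative_mult
        smooth_has_derivative assms simp del: iterated_deriv_Cons)
  have "iterated_deriv (i # \<alpha>) (\<lambda>x. f x * g x) x =
      (\<Sum>(\<beta>, \<gamma>)\<leftarrow>L'. iterated_deriv \<beta> f x * iterated_deriv \<gamma> g x)" for x
  proof -
    have "iterated_deriv (i # \<alpha>) (\<lambda>x. f x * g x) x = (\<Sum>(\<beta>, \<gamma>)\<leftarrow>L.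
        iterated_deriv \<beta> f x * iterated_deriv (i # \<gamma>) g x + iterated_deriv (i # \<beta>) f x * iterated_deriv \<gamma> g x)"
      unfolding iterated_deriv_Cons[of i \<alpha>] L(3) partial_deriv_eq[OF der] sum_axis_scaleR ..
    also have "\<dots> = (\<Sum>(\<beta>, \<gamma>)\<leftarrow>L'. iterated_deriv \<beta> f x * iterated_deriv \<gamma> g x)"
      unfolding L'_def by (induction L) (auto simp: algebra_simps)
    finally show ?thesis .
  qed
  then show ?case using L(1,2) by (intro exI[of _ L']) (auto simp: L'_def)
qed

lemma smooth_mult:
  assumes "smooth f" "smooth g" shows "smooth (\<lambda>x. f x * g x)"
  unfolding smooth_def
proof (intro allI)
  fix \<alpha> x
  obtain L where L: "iterated_deriv \<alpha> (\<lambda>x. f x * g x) =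
      (\<lambda>x. \<Sum>(\<beta>, \<gamma>)\<leftarrow>L. iterated_deriv \<beta> f x * iterated_deriv \<gamma> g x)"
    using iterated_deriv_mult[OF assms] by blast
  show "iterated_deriv \<alpha> (\<lambda>x. f x * g x) differentiable at x"
    unfolding L by (induction L)
      (auto intro!: differentiable_add differentiable_mult smooth_differentiable assms)
qed

text \<open>The estimate is made at a single point \<open>x\<close>, so \<open>A\<close> and
  \<open>B\<close> may depend on \<open>x\<close> and polynomial weights can be inserted. The
  Leibniz expansion has \<open>2 ^ length \<alpha>\<close> terms, each at most
  \<open>A * B\<close>.\<close>

lemma iterated_deriv_mult_bound:
  assumes "smooth f" "smooth g"
    and A: "\<And>\<beta>. length \<beta> \<le> length \<alpha> \<Longrightarrow> cmod (iterated_deriv \<beta> f x) \<le> A"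
    and B: "\<And>\<beta>. length \<beta> \<le> length \<alpha> \<Longrightarrow> cmod (iterated_deriv \<beta> g x) \<le> B"
  shows "cmod (iterated_deriv \<alpha> (\<lambda>x. f x * g x) x) \<le> 2 ^ length \<alpha> * (A * B)"
proof -
  obtain L where L: "length L = 2 ^ length \<alpha>"
    "\<forall>(\<beta>, \<gamma>)\<in>set L. length \<beta> \<le> length \<alpha> \<and> length \<gamma> \<le> length \<alpha>"
    "iterated_deriv \<alpha> (\<lambda>x. f x * g x) = (\<lambda>x. \<Sum>(\<beta>, \<gamma>)\<leftarrow>L. iterated_deriv \<beta> f x * iterated_deriv \<gamma> g x)"
    using iterated_deriv_mult[OF assms(1,2)] by blast
  have "0 \<le> A" by (rule order_trans[OF norm_ge_zero A[of "[]"]]) simp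
  have "cmod (\<Sum>(\<beta>, \<gamma>)\<leftarrow>L. iterated_deriv \<beta> f x * iterated_deriv \<gamma> g x) \<le> real (length L) * (A * B)"
    using L(2)
  proof (induction L)
    case (Cons a L)
    obtain \<beta> \<gamma> where a: "a = (\<beta>, \<gamma>)" by (cases a)
    have "cmod (iterated_deriv \<beta> f x * iterated_deriv \<gamma> g x) \<le> A * B"
      unfolding norm_mult using Cons(2) \<open>0 \<le> A\<close> by (intro mult_mono A B) (auto simp: a)
    then show ?case using Cons unfolding a
      by (auto simp: distrib_right intro!: norm_triangle_le add_mono)
  qed simp
  then show ?thesis by (simp add: L)
qed

section \<open>The Hardy-Littlewood maximal function\<close>

lemma borel_measurable_lebesgue_times_cball:
  fixes g :: "'a::euclidean_space \<Rightarrow> ennreal"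
  assumes "g \<in> borel_measurable lebesgue"
  shows "(\<lambda>z. g z * indicator (cball x R) z) \<in> borel_measurable lebesgue"
  using assms by (intro borel_measurable_times_ennreal borel_measurable_indicator) simp_all

text \<open>A disjoint family of the given balls is selected whose fivefold enlargements still cover
  \<open>E\<close>. The volume of an enlargement is a fixed multiple of
  \<open>c * r ^ DIM('a)\<close>, hence is controlled by the local integral of \<open>f\<close>, and
  local integrals over disjoint balls add up to at most the whole integral.\<close>

lemma vitali_weak_type:
  fixes f :: "'a::euclidean_space \<Rightarrow> ennreal"
  assumes f [measurable]: "f \<in> borel_measurable lebesgue" and "0 < c" and "E \<in> sets lebesgue"
    and large: "\<And>x. x \<in> E \<Longrightarrow>
      \<exists>r>0. ennreal (c * r ^ DIM('a)) \<le> (\<integral>\<^sup>+y. f y * indicator (cball x r) y \<partial>lebesgue)"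
  shows "emeasure lebesgue E \<le>
    ennreal (unit_ball_vol (real DIM('a)) * 5 ^ DIM('a) / c) * (\<integral>\<^sup>+y. f y \<partial>lebesgue)"
proof (cases "(\<integral>\<^sup>+y. f y \<partial>lebesgue) = \<infinity>")
  case True
  define k where "k = unit_ball_vol (real DIM('a)) * 5 ^ DIM('a) / c"
  have "k > 0" using \<open>0 < c\<close> by (simp add: k_def)
  then show ?thesis using True by (simp add: k_def[symmetric] ennreal_mult_top)
next
  case False
  define n where "n = DIM('a)"
  have [measurable]: "cball x R \<in> sets lebesgue" for x :: 'a and R by simp
  have n: "n \<ge> 1" by (simp add: n_def Suc_leI)
  define w where "w = unit_ball_vol (real n)"
  have w: "w > 0" by (simp add: w_def)
  obtain I where I: "(\<integral>\<^sup>+y. f y \<partial>lebesgue) = ennreal I" "I \<ge> 0"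
    using False by (cases "(\<integral>\<^sup>+y. f y \<partial>lebesgue)") (auto simp: top_unique)
  have "\<exists>r. \<forall>x\<in>E. 0 < r x \<and>
      ennreal (c * r x ^ n) \<le> (\<integral>\<^sup>+y. f y * indicator (cball x (r x)) y \<partial>lebesgue)"
    using large unfolding n_def by (intro bchoice) auto
  then obtain r where r: "\<And>x. x \<in> E \<Longrightarrow> 0 < r x"
    and rI: "\<And>x. x \<in> E \<Longrightarrow>
      ennreal (c * r x ^ n) \<le> (\<integral>\<^sup>+y. f y * indicator (cball x (r x)) y \<partial>lebesgue)"
    by blast
  \<comment> \<open>The covering lemma requires bounded radii. For \<open>r x > 1\<close> this
    follows from \<open>r x \<le> r x ^ n\<close> and the finiteness of the whole integral.\<close>
  have bound: "r x \<le> max 1 (I / c)" if "x \<in> E" for x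
  proof (cases "r x \<le> 1")
    case False
    have "ennreal (c * r x ^ n) \<le> ennreal I"
      using rI[OF that] unfolding I(1)[symmetric]
      by (rule order_trans) (auto intro!: nn_integral_mono simp: indicator_def)
    then have "c * r x ^ n \<le> I" using I(2) by (simp add: ennreal_le_iff)
    moreover have "r x ^ 1 \<le> r x ^ n" using False n by (intro power_increasing) auto
    ultimately have "c * r x \<le> I" using \<open>0 < c\<close>
      by (metis less_imp_le mult_left_mono order_trans power_one_right)
    then have "r x \<le> I / c" using \<open>0 < c\<close> by (simp add: field_simps)
    then show ?thesis by simp
  qed auto
  have cov: "E \<subseteq> (\<Union>i\<in>E. cball i (r i))"
    using order.strict_implies_order[OF r] by force
  obtain C where C: "countable C" "C \<subseteq> E"
    and disj: "pairwise (\<lambda>i j. disjnt (cball i (r i)) (cball j (r j))) C"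
    and cov: "E \<subseteq> (\<Union>i\<in>C. cball i (5 * r i))"
    by (rule Vitali_covering_lemma_cballs[where S=E and K=E and a="\<lambda>x. x" and r=r and B="max 1 (I / c)"])
      (use r bound cov in auto)
  have vol: "emeasure lebesgue (cball i (5 * r i)) = ennreal (w * 5 ^ n / c) * ennreal (c * r i ^ n)"
    if "i \<in> C" for i
  proof -
    have "0 < r i" using r C(2) that by auto
    have "emeasure lebesgue (cball i (5 * r i)) = ennreal (w * (5 * r i) ^ n)"
      using emeasure_cball[of "5 * r i" i] \<open>0 < r i\<close> by (simp add: w_def n_def)
    also have "\<dots> = ennreal (w * 5 ^ n / c) * ennreal (c * r i ^ n)"
      using \<open>0 < c\<close> \<open>0 < r i\<close> w
      by (subst ennreal_mult[symmetric]) (auto simp: power_mult_distrib)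
    finally show ?thesis .
  qed
  have "emeasure lebesgue E = (\<integral>\<^sup>+y. indicator E y \<partial>lebesgue)"
    using assms(3) by simp
  \<comment> \<open>Sums over the countable set \<open>C\<close> are written as integrals over
    \<open>count_space C\<close>, which makes their interchange with the Lebesgue integral a single
    rule.\<close>
  also have "\<dots> \<le> (\<integral>\<^sup>+y. (\<integral>\<^sup>+i. indicator (cball i (5 * r i)) y \<partial>count_space C) \<partial>lebesgue)"
  proof (rule nn_integral_mono)
    fix y
    show "indicator E y \<le> (\<integral>\<^sup>+i. indicator (cball i (5 * r i)) y \<partial>count_space C :: ennreal)"
    proof (cases "y \<in> E")
      case True
      then obtain i where i: "i \<in> C" "y \<in> cball i (5 * r i)" using cov by auto
      have "(1::ennreal) = indicator (cball i (5 * r i)) y" using i by simp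
      also have "\<dots> \<le> (\<integral>\<^sup>+i. indicator (cball i (5 * r i)) y \<partial>count_space C)"
        using i(1) by (rule nn_integral_ge_point)
      finally show ?thesis using True by simp
    qed simp
  qed
  also have "\<dots> = (\<integral>\<^sup>+i. (\<integral>\<^sup>+y. indicator (cball i (5 * r i)) y \<partial>lebesgue) \<partial>count_space C)"
    using C by (intro nn_integral_count_space_nn_integral) auto
  also have "\<dots> = (\<integral>\<^sup>+i. emeasure lebesgue (cball i (5 * r i)) \<partial>count_space C)"
    by (intro nn_integral_cong) auto
  also have "\<dots> = (\<integral>\<^sup>+i. ennreal (w * 5 ^ n / c) * ennreal (c * r i ^ n) \<partial>count_space C)"
    by (intro nn_integral_cong vol) auto
  also have "\<dots> = ennreal (w * 5 ^ n / c) * (\<integral>\<^sup>+i. ennreal (c * r i ^ n) \<partial>count_space C)"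
    by (intro nn_integral_cmult) auto
  finally have E_le: "emeasure lebesgue E \<le>
      ennreal (w * 5 ^ n / c) * (\<integral>\<^sup>+i. ennreal (c * r i ^ n) \<partial>count_space C)" .
  have "(\<integral>\<^sup>+i. ennreal (c * r i ^ n) \<partial>count_space C) \<le>
      (\<integral>\<^sup>+i. (\<integral>\<^sup>+y. f y * indicator (cball i (r i)) y \<partial>lebesgue) \<partial>count_space C)"
    using rI C by (intro nn_integral_mono) auto
  also have "\<dots> = (\<integral>\<^sup>+y. (\<integral>\<^sup>+i. f y * indicator (cball i (r i)) y \<partial>count_space C) \<partial>lebesgue)"
    using C by (intro nn_integral_count_space_nn_integral[symmetric]) auto
  also have "\<dots> \<le> (\<integral>\<^sup>+y. f y \<partial>lebesgue)"
  proof (rule nn_integral_mono)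
    fix y
    show "(\<integral>\<^sup>+i. f y * indicator (cball i (r i)) y \<partial>count_space C) \<le> f y"
    proof (cases "\<exists>i\<in>C. y \<in> cball i (r i)")
      case True
      then obtain i where i: "i \<in> C" "y \<in> cball i (r i)" by auto
      \<comment> \<open>By disjointness only one selected ball contains \<open>y\<close>, so the sum
        reduces to one term.\<close>
      have uniq: "j = i" if "j \<in> C" "y \<in> cball j (r j)" for j
        using pairwiseD[OF disj that(1) i(1)] i(2) that(2) by (auto simp: disjnt_iff)
      have "(\<integral>\<^sup>+i. f y * indicator (cball i (r i)) y \<partial>count_space C) =
          (\<integral>\<^sup>+j. f y * indicator {i} j \<partial>count_space C)"
      proof (rule nn_integral_cong)
        fix j assume "j \<in> space (count_space C)"
        then have "y \<in> cball j (r j) \<longleftrightarrow> j \<in> {i}"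
          using uniq i by (metis insertI1 singletonD space_count_space)
        then show "f y * indicator (cball j (r j)) y = f y * indicator {i} j"
          by (simp only: indicator_def)
      qed
      also have "\<dots> = f y * emeasure (count_space C) {i}"
        using i(1) by (intro nn_integral_cmult_indicator) simp
      also have "\<dots> \<le> f y" using i(1) by (subst emeasure_count_space_finite) simp_all
      finally show ?thesis .
    next
      case False
      then have "(\<integral>\<^sup>+i. f y * indicator (cball i (r i)) y \<partial>count_space C) =
        (\<integral>\<^sup>+i. 0 \<partial>count_space C)"
        by (intro nn_integral_cong) (auto simp: indicator_def)
      then show ?thesis by simp
    qed
  qed
  finally have "ennreal (w * 5 ^ n / c) * (\<integral>\<^sup>+i. ennreal (c * r i ^ n) \<partial>count_space C) \<le>
      ennreal (w * 5 ^ n / c) * (\<integral>\<^sup>+y. f y \<partial>lebesgue)"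
    by (rule mult_left_mono) simp
  then show ?thesis using E_le unfolding w_def n_def by (rule order_trans[rotated])
qed

text \<open>The averages are over centred closed balls and are normalised by
  \<open>r ^ DIM('a)\<close> instead of the volume; the volume of the unit ball goes into the
  constants.\<close>

definition hl_maximal :: "('a::euclidean_space \<Rightarrow> ennreal) \<Rightarrow> 'a \<Rightarrow> ennreal" where
  "hl_maximal g x = (SUP r\<in>{0<..}.
     ennreal (1 / r ^ DIM('a)) * (\<integral>\<^sup>+y. g y * indicator (cball x r) y \<partial>lebesgue))"

lemma integral_cball_le_hl_maximal:
  fixes g :: "'a::euclidean_space \<Rightarrow> ennreal"
  assumes "0 < r"
  shows "(\<integral>\<^sup>+y. g y * indicator (cball x r) y \<partial>lebesgue) \<le> ennreal (r ^ DIM('a)) * hl_maximal g x"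
proof -
  let ?J = "\<integral>\<^sup>+y. g y * indicator (cball x r) y \<partial>lebesgue"
  have "?J = ennreal (r ^ DIM('a)) * (ennreal (1 / r ^ DIM('a)) * ?J)"
    using assms by (simp add: mult.assoc[symmetric] ennreal_mult[symmetric])
  also have "\<dots> \<le> ennreal (r ^ DIM('a)) * hl_maximal g x"
    unfolding hl_maximal_def using assms by (intro mult_left_mono SUP_upper) auto
  finally show ?thesis .
qed

section \<open>Dyadic decompositions of weights and of levels\<close>

lemma powr_le_dyadic_sum:
  assumes "0 \<le> v" "0 \<le> s"
  shows "ennreal ((1 + v) powr -s) \<le> (\<Sum>j. ennreal (2 powr (- s * real j)) * indicator {..2 ^ Suc j} v)"
proof -
  \<comment> \<open>The dyadic shell of \<open>v\<close>: \<open>1 + v\<close> lies between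
    \<open>2 ^ j\<close> and \<open>2 ^ Suc j\<close>, so this one term of the series already
    dominates.\<close>
  define j where "j = nat \<lfloor>log 2 (1 + v)\<rfloor>"
  have l: "0 \<le> log 2 (1 + v)" using assms by (simp add: le_log_iff)
  have "real j \<le> log 2 (1 + v)" using l by (simp add: j_def)
  then have "2 powr real j \<le> 1 + v" using assms by (simp add: le_log_iff)
  then have 1: "(1 + v) powr - s \<le> (2 powr real j) powr -s"
    using assms by (intro powr_mono2') auto
  have "log 2 (1 + v) \<le> real (Suc j)" using l unfolding j_def by linarith
  then have "1 + v \<le> 2 powr real (Suc j)" using assms by (simp add: log_le_iff)
  then have v: "v \<in> {..2 ^ Suc j}" using powr_realpow[of 2 "Suc j"] by simp
  have "ennreal ((1 + v) powr -s) \<le> ennreal (2 powr (- s * real j)) * indicator {..2 ^ Suc j} v"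
    using 1 v by (simp add: powr_powr mult.commute ennreal_leI)
  also have "\<dots> \<le> (\<Sum>j. ennreal (2 powr (- s * real j)) * indicator {..2 ^ Suc j} v)"
    by (rule sum_le_suminf[where I="{j}", simplified]) auto
  finally show ?thesis .
qed

text \<open>The weight is dominated by a sum of multiples of indicators of balls of radius
  \<open>2 ^ Suc j * t\<close>. Bounding each ball by the maximal function leaves a geometric series
  with ratio \<open>2 powr (n - s)\<close>, which converges because \<open>s\<close> exceeds the
  dimension.\<close>

lemma radial_integral_le_hl_maximal:
  fixes s :: real
  assumes "real DIM('a::euclidean_space) < s"
  obtains C where "0 < C" "\<And>(g :: 'a \<Rightarrow> ennreal) x t. g \<in> borel_measurable lebesgue \<Longrightarrow> 0 < t \<Longrightarrow>
    ennreal (1 / t ^ DIM('a)) * (\<integral>\<^sup>+z. ennreal ((1 + norm (z - x) / t) powr -s) * g z \<partial>lebesgue)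
      \<le> ennreal C * hl_maximal g x"
proof
  define n where "n = DIM('a)"
  define \<rho> where "\<rho> = 2 powr (real n - s)"
  have \<rho>: "0 < \<rho>" "\<rho> < 1" using assms by (auto simp: \<rho>_def n_def powr_less_one)
  show "0 < 2 ^ n / (1 - \<rho>)" using \<rho> by simp
  fix g :: "'a \<Rightarrow> ennreal" and x :: 'a and t :: real
  assume g[measurable]: "g \<in> borel_measurable lebesgue" and t: "0 < t"
  have "(\<integral>\<^sup>+z. ennreal ((1 + norm (z - x) / t) powr -s) * g z \<partial>lebesgue) \<le>
     (\<integral>\<^sup>+z. (\<Sum>j. ennreal (2 powr (- s * real j)) * (g z * indicator (cball x (2 ^ Suc j * t)) z)) \<partial>lebesgue)"
  proof (rule nn_integral_mono)
    fix z
    have "ennreal ((1 + norm (z - x) / t) powr -s) * g z \<le>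
      (\<Sum>j. ennreal (2 powr (- s * real j)) * indicator {..2 ^ Suc j} (norm (z - x) / t)) * g z"
      using assms t by (intro mult_right_mono powr_le_dyadic_sum) auto
    also have "\<dots> = (\<Sum>j. ennreal (2 powr (- s * real j)) * indicator {..2 ^ Suc j} (norm (z - x) / t) * g z)"
      by (rule ennreal_suminf_multc[symmetric])
    also have "\<dots> = (\<Sum>j. ennreal (2 powr (- s * real j)) * (g z * indicator (cball x (2 ^ Suc j * t)) z))"
      using t by (intro suminf_cong) (auto simp: indicator_def field_simps dist_norm norm_minus_commute)
    finally show "ennreal ((1 + norm (z - x) / t) powr -s) * g z \<le>
      (\<Sum>j. ennreal (2 powr (- s * real j)) * (g z * indicator (cball x (2 ^ Suc j * t)) z))" .
  qed
  also have "\<dots> = (\<Sum>j. ennreal (2 powr (- s * real j)) * (\<integral>\<^sup>+z. g z * indicator (cball x (2 ^ Suc j * t)) z \<partial>lebesgue))"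
    using borel_measurable_lebesgue_times_cball[OF g]
    by (subst nn_integral_suminf) (simp_all only: nn_integral_cmult borel_measurable_const borel_measurable_times_ennreal)
  also have "\<dots> \<le> (\<Sum>j. ennreal (2 powr (- s * real j)) * (ennreal ((2 ^ Suc j * t) ^ n) * hl_maximal g x))"
    using t by (intro suminf_le mult_left_mono) (auto simp: n_def intro!: integral_cball_le_hl_maximal)
  also have "\<dots> = (\<Sum>j. ennreal (2 ^ n * t ^ n * \<rho> ^ j) * hl_maximal g x)"
  proof (intro suminf_cong)
    fix j
    have "(2 ^ Suc j * t) ^ n = 2 ^ n * t ^ n * (2::real) ^ (j * n)"
      by (simp add: power_mult_distrib power_mult)
    also have "(2::real) ^ (j * n) = 2 powr (real j * real n)"
      by (simp add: powr_realpow[symmetric])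
    moreover have "\<rho> ^ j = 2 powr (- s * real j) * 2 powr (real j * real n)"
      using \<rho> by (subst powr_realpow[symmetric])
        (auto simp: \<rho>_def powr_powr powr_add[symmetric] algebra_simps)
    ultimately have "2 powr (- s * real j) * (2 ^ Suc j * t) ^ n = 2 ^ n * t ^ n * \<rho> ^ j"
      by simp
    then show "ennreal (2 powr (- s * real j)) * (ennreal ((2 ^ Suc j * t) ^ n) * hl_maximal g x) =
       ennreal (2 ^ n * t ^ n * \<rho> ^ j) * hl_maximal g x"
      using t by (simp add: mult.assoc[symmetric] ennreal_mult[symmetric])
  qed
  also have "\<dots> = (\<Sum>j. ennreal (2 ^ n * t ^ n * \<rho> ^ j)) * hl_maximal g x"
    by (rule ennreal_suminf_multc)
  also have "\<dots> = ennreal (2 ^ n * t ^ n * (1 / (1 - \<rho>))) * hl_maximal g x"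
    using \<rho> t by (intro arg_cong2[where f="(*)"] suminf_ennreal_eq sums_mult geometric_sums refl) auto
  finally have "ennreal (1 / t ^ n) * (\<integral>\<^sup>+z. ennreal ((1 + norm (z - x) / t) powr -s) * g z \<partial>lebesgue)
    \<le> ennreal (1 / t ^ n) * (ennreal (2 ^ n * t ^ n * (1 / (1 - \<rho>))) * hl_maximal g x)"
    by (intro mult_left_mono) auto
  also have "\<dots> = ennreal (2 ^ n / (1 - \<rho>)) * hl_maximal g x"
    using t \<rho> by (simp add: mult.assoc[symmetric] ennreal_mult[symmetric])
  finally show "ennreal (1 / t ^ DIM('a)) * (\<integral>\<^sup>+z. ennreal ((1 + norm (z - x) / t) powr -s) * g z \<partial>lebesgue)
      \<le> ennreal (2 ^ n / (1 - \<rho>)) * hl_maximal g x" by (simp add: n_def)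
qed

lemma truncated_powr_le_dyadic_sum:
  assumes "0 \<le> h" "0 < \<sigma>" "0 < q"
  shows "ennreal (h powr q) * indicator {\<sigma><..} h \<le>
    (\<Sum>j. ennreal ((2 ^ Suc j * \<sigma>) powr q) * indicator {2 ^ j * \<sigma><..} h)"
proof (cases "\<sigma> < h")
  case True
  \<comment> \<open>Minimality yields the lower bound \<open>2 ^ j * \<sigma> < h\<close>; for
    \<open>j = 0\<close> that bound is the assumption \<open>\<sigma> < h\<close>.\<close>
  define j where "j = (LEAST j. h \<le> 2 ^ Suc j * \<sigma>)"
  obtain m where "h / \<sigma> < 2 ^ m" using real_arch_pow[of 2 "h / \<sigma>"] by auto
  then have "h \<le> 2 ^ Suc m * \<sigma>" using assms by (simp add: field_simps)
  then have j: "h \<le> 2 ^ Suc j * \<sigma>" unfolding j_def by (rule LeastI)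
  have j2: "2 ^ j * \<sigma> < h"
  proof (cases j)
    case (Suc k)
    then show ?thesis using not_less_Least[of k "\<lambda>j. h \<le> 2 ^ Suc j * \<sigma>"] by (auto simp: j_def)
  qed (use True in simp)
  have "ennreal (h powr q) * indicator {\<sigma><..} h \<le> ennreal ((2 ^ Suc j * \<sigma>) powr q) * indicator {2 ^ j * \<sigma><..} h"
    using True j j2 assms by (auto intro!: ennreal_leI powr_mono2)
  also have "\<dots> \<le> (\<Sum>j. ennreal ((2 ^ Suc j * \<sigma>) powr q) * indicator {2 ^ j * \<sigma><..} h)"
    by (rule sum_le_suminf[where I="{j}", simplified]) auto
  finally show ?thesis .
qed auto

text \<open>The function \<open>H powr q\<close> is cut at height \<open>\<sigma> powr q\<close>.
  The lower part accounts for at most half of an average that exceeds \<open>s powr q\<close>, so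
  \<open>vitali_weak_type\<close> applies to the upper part, whose integral is summed over dyadic
  levels with ratio \<open>2 powr (q - p)\<close>. \<open>E\<close> is any measurable set inside the
  superlevel set, so measurability of \<open>hl_maximal\<close> itself never has to be
  settled.\<close>

lemma hl_maximal_powr_weak_type:
  fixes p q :: real
  assumes "0 < q" "q < p"
  obtains C where "0 < C" "\<And>(H :: 'a::euclidean_space \<Rightarrow> real) A s E. H \<in> borel_measurable lebesgue \<Longrightarrow>
    (\<And>x. 0 \<le> H x) \<Longrightarrow> 0 \<le> A \<Longrightarrow>
    (\<And>s. 0 < s \<Longrightarrow> emeasure lebesgue {x. s < H x} \<le> ennreal ((A / s) powr p)) \<Longrightarrow>
    0 < s \<Longrightarrow> E \<in> sets lebesgue \<Longrightarrow>
    (\<And>x. x \<in> E \<Longrightarrow> ennreal (s powr q) < hl_maximal (\<lambda>z. ennreal (H z powr q)) x) \<Longrightarrow>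
    emeasure lebesgue E \<le> ennreal (C * (A / s) powr p)"
proof
  define n where "n = DIM('a)"
  define w where "w = unit_ball_vol (real n)"
  have w: "w > 0" by (simp add: w_def)
  define \<rho> where "\<rho> = 2 powr (q - p)"
  have \<rho>: "0 < \<rho>" "\<rho> < 1" using assms by (auto simp: \<rho>_def powr_less_one)
  \<comment> \<open>Chosen so that \<open>\<sigma> = s / b\<close> satisfies
    \<open>s powr q = 2 * w * \<sigma> powr q\<close>. On a ball of radius \<open>r\<close> the part
    below \<open>\<sigma>\<close> then contributes at most
    \<open>w * \<sigma> powr q * r ^ n\<close>, which is half of what is required.\<close>
  define b where "b = (2 * w) powr (1 / q)"
  have b: "b > 0" "b powr q = 2 * w" using w assms by (auto simp: b_def powr_powr)
  define C where "C = 5 ^ n * 2 powr q / (1 - \<rho>) * b powr p"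
  show "0 < C" using \<rho> b by (simp add: C_def)
  fix H :: "'a \<Rightarrow> real" and A s E
  assume H[measurable]: "H \<in> borel_measurable lebesgue" and H0: "\<And>x. 0 \<le> H x" and A: "0 \<le> A"
    and HA: "\<And>s. 0 < s \<Longrightarrow> emeasure lebesgue {x. s < H x} \<le> ennreal ((A / s) powr p)"
    and s: "0 < s" and E: "E \<in> sets lebesgue"
    and large: "\<And>x. x \<in> E \<Longrightarrow> ennreal (s powr q) < hl_maximal (\<lambda>z. ennreal (H z powr q)) x"
  define \<sigma> where "\<sigma> = s / b"
  have \<sigma>: "\<sigma> > 0" using s b by (simp add: \<sigma>_def)
  have s\<sigma>: "s powr q = 2 * w * \<sigma> powr q" using s b \<sigma> w by (simp add: \<sigma>_def powr_divide)
  have [measurable]: "{x. a < H x} \<in> sets lebesgue" for a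
    using measurable_sets[OF H, of "{a<..}"] by (simp add: vimage_def)
  define f where "f z = ennreal (H z powr q) * indicator {\<sigma><..} (H z)" for z
  have [measurable]: "f \<in> borel_measurable lebesgue" unfolding f_def by measurable
  have "\<exists>r>0. ennreal (w * \<sigma> powr q * r ^ n) \<le> (\<integral>\<^sup>+y. f y * indicator (cball x r) y \<partial>lebesgue)" if x: "x \<in> E" for x
  proof -
    obtain r where r: "0 < r" and "ennreal (s powr q) <
        ennreal (1 / r ^ n) * (\<integral>\<^sup>+y. ennreal (H y powr q) * indicator (cball x r) y \<partial>lebesgue)"
      using large[OF x] unfolding hl_maximal_def less_SUP_iff n_def by auto
    then have "ennreal (r ^ n) * ennreal (s powr q) \<le> ennreal (r ^ n) * (ennreal (1 / r ^ n) *
        (\<integral>\<^sup>+y. ennreal (H y powr q) * indicator (cball x r) y \<partial>lebesgue))"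
      by (intro mult_left_mono) auto
    also have "\<dots> = (\<integral>\<^sup>+y. ennreal (H y powr q) * indicator (cball x r) y \<partial>lebesgue)"
      using r by (simp add: mult.assoc[symmetric] ennreal_mult[symmetric])
    also have "\<dots> \<le> (\<integral>\<^sup>+y. ennreal (\<sigma> powr q) * indicator (cball x r) y + f y * indicator (cball x r) y \<partial>lebesgue)"
    proof (rule nn_integral_mono)
      fix y
      have "ennreal (H y powr q) \<le> ennreal (\<sigma> powr q) + f y"
        using H0[of y] assms(1) by (cases "\<sigma> < H y") (simp_all add: f_def ennreal_leI powr_mono2)
      then show "ennreal (H y powr q) * indicator (cball x r) y \<le>
          ennreal (\<sigma> powr q) * indicator (cball x r) y + f y * indicator (cball x r) y"
        by (simp add: distrib_right[symmetric] mult_right_mono)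
    qed
    also have "\<dots> = ennreal (\<sigma> powr q) * ennreal (w * r ^ n) + (\<integral>\<^sup>+y. f y * indicator (cball x r) y \<partial>lebesgue)"
    proof (subst nn_integral_add)
      have "(\<integral>\<^sup>+y. ennreal (\<sigma> powr q) * indicator (cball x r) y \<partial>lebesgue) = ennreal (\<sigma> powr q) * ennreal (w * r ^ n)"
        using emeasure_cball[of r x] r by (subst nn_integral_cmult_indicator) (simp_all add: w_def n_def)
      then show "(\<integral>\<^sup>+y. ennreal (\<sigma> powr q) * indicator (cball x r) y \<partial>lebesgue) +
          (\<integral>\<^sup>+y. f y * indicator (cball x r) y \<partial>lebesgue) =
        ennreal (\<sigma> powr q) * ennreal (w * r ^ n) + (\<integral>\<^sup>+y. f y * indicator (cball x r) y \<partial>lebesgue)"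
        by simp
    qed (intro borel_measurable_lebesgue_times_cball, simp_all)+
    finally have le: "ennreal (r ^ n) * ennreal (s powr q) \<le>
      ennreal (\<sigma> powr q) * ennreal (w * r ^ n) + (\<integral>\<^sup>+y. f y * indicator (cball x r) y \<partial>lebesgue)" .
    have 1: "ennreal (\<sigma> powr q) * ennreal (w * r ^ n) = ennreal (w * \<sigma> powr q * r ^ n)"
      using w r by (simp add: ennreal_mult[symmetric] ac_simps)
    \<comment> \<open>Written as a sum of two equal finite terms so that one of them cancels against
      the lower part.\<close>
    have 2: "ennreal (r ^ n) * ennreal (s powr q) = ennreal (w * \<sigma> powr q * r ^ n) + ennreal (w * \<sigma> powr q * r ^ n)"
      using w r by (simp add: ennreal_mult[symmetric] ennreal_plus[symmetric] s\<sigma> algebra_simps del: ennreal_plus)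
    have "ennreal (w * \<sigma> powr q * r ^ n) \<le> (\<integral>\<^sup>+y. f y * indicator (cball x r) y \<partial>lebesgue)"
      using le unfolding 1 2 by (simp add: ennreal_add_left_cancel_le)
    then show ?thesis using r by blast
  qed
  then have "emeasure lebesgue E \<le> ennreal (w * 5 ^ n / (w * \<sigma> powr q)) * (\<integral>\<^sup>+y. f y \<partial>lebesgue)"
    unfolding w_def n_def using \<sigma> E w by (intro vitali_weak_type) (auto simp: w_def n_def)
  also have "w * 5 ^ n / (w * \<sigma> powr q) = 5 ^ n / \<sigma> powr q" using w by simp
  finally have E_le: "emeasure lebesgue E \<le> ennreal (5 ^ n / \<sigma> powr q) * (\<integral>\<^sup>+y. f y \<partial>lebesgue)" .
  have "(\<integral>\<^sup>+y. f y \<partial>lebesgue) \<le>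
      (\<integral>\<^sup>+y. (\<Sum>j. ennreal ((2 ^ Suc j * \<sigma>) powr q) * indicator {x. 2 ^ j * \<sigma> < H x} y) \<partial>lebesgue)"
  proof (rule nn_integral_mono)
    fix y
    show "f y \<le> (\<Sum>j. ennreal ((2 ^ Suc j * \<sigma>) powr q) * indicator {x. 2 ^ j * \<sigma> < H x} y)"
      using truncated_powr_le_dyadic_sum[OF H0[of y] \<sigma> assms(1)] by (simp add: f_def indicator_def)
  qed
  also have "\<dots> = (\<Sum>j. ennreal ((2 ^ Suc j * \<sigma>) powr q) * emeasure lebesgue {x. 2 ^ j * \<sigma> < H x})"
    by (subst nn_integral_suminf) (auto simp: nn_integral_cmult nn_integral_indicator)
  also have "\<dots> \<le> (\<Sum>j. ennreal ((2 ^ Suc j * \<sigma>) powr q) * ennreal ((A / (2 ^ j * \<sigma>)) powr p))"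
    using \<sigma> by (intro suminf_le mult_left_mono HA) auto
  also have "\<dots> = (\<Sum>j. ennreal (2 powr q * \<sigma> powr q * (A / \<sigma>) powr p * \<rho> ^ j))"
  proof (intro suminf_cong)
    fix j
    have 1: "(2 ^ Suc j * \<sigma>) powr q = 2 powr q * \<sigma> powr q * (2 powr q) ^ j"
      using \<sigma> by (simp add: powr_mult powr_realpow[symmetric] powr_powr mult.commute)
    have "(A / (2 ^ j * \<sigma>)) powr p = (A / \<sigma> / 2 ^ j) powr p" by (simp add: field_simps)
    also have "\<dots> = (A / \<sigma>) powr p / (2 ^ j) powr p"
      using \<sigma> A by (subst powr_divide) auto
    also have "((2::real) ^ j) powr p = (2 powr p) ^ j"
      by (simp add: powr_realpow[symmetric] powr_powr mult.commute)
    also have "(A / \<sigma>) powr p / (2 powr p) ^ j = (A / \<sigma>) powr p * (2 powr - p) ^ j"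
      by (simp add: powr_minus power_inverse divide_inverse)
    finally have "(2 ^ Suc j * \<sigma>) powr q * (A / (2 ^ j * \<sigma>)) powr p =
        2 powr q * \<sigma> powr q * (A / \<sigma>) powr p * \<rho> ^ j"
      unfolding 1 \<rho>_def by (simp add: power_mult_distrib[symmetric] powr_diff powr_minus field_simps)
    then show "ennreal ((2 ^ Suc j * \<sigma>) powr q) * ennreal ((A / (2 ^ j * \<sigma>)) powr p) =
        ennreal (2 powr q * \<sigma> powr q * (A / \<sigma>) powr p * \<rho> ^ j)"
      by (simp add: ennreal_mult[symmetric])
  qed
  also have "\<dots> = ennreal (2 powr q * \<sigma> powr q * (A / \<sigma>) powr p * (1 / (1 - \<rho>)))"
    using \<rho> by (intro suminf_ennreal_eq sums_mult geometric_sums) auto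
  finally have "emeasure lebesgue E \<le>
      ennreal (5 ^ n / \<sigma> powr q) * ennreal (2 powr q * \<sigma> powr q * (A / \<sigma>) powr p * (1 / (1 - \<rho>)))"
    using E_le by (meson mult_left_mono order_trans zero_le)
  also have "\<dots> = ennreal (5 ^ n * 2 powr q / (1 - \<rho>) * (A / \<sigma>) powr p)"
    using \<rho> \<sigma> by (subst ennreal_mult[symmetric]) auto
  also have "(A / \<sigma>) powr p = b powr p * (A / s) powr p"
    using s b A by (simp add: \<sigma>_def powr_divide powr_mult)
  finally show "emeasure lebesgue E \<le> ennreal (C * (A / s) powr p)"
    by (simp add: C_def mult.assoc)
qed

section \<open>Convolution with Schwartz functions\<close>

lemma nn_integral_lborel_affine:
  fixes t :: "'a::euclidean_space" and c :: real
  assumes [measurable]: "f \<in> borel_measurable borel" and c: "c \<noteq> 0"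
  shows "(\<integral>\<^sup>+x. f x \<partial>lborel) = ennreal (\<bar>c\<bar> ^ DIM('a)) * (\<integral>\<^sup>+x. f (t + c *\<^sub>R x) \<partial>lborel)"
  by (subst lborel_affine[OF c, of t])
    (simp add: nn_integral_density nn_integral_distr nn_integral_cmult)

lemma integrable_lborel_affine:
  fixes f :: "'a::euclidean_space \<Rightarrow> 'b::{banach, second_countable_topology}" and c :: real
  assumes f: "integrable lborel f" and c: "c \<noteq> 0"
  shows "integrable lborel (\<lambda>x. f (t + c *\<^sub>R x))"
proof -
  have [measurable]: "f \<in> borel_measurable borel" using f by auto
  have "ennreal (\<bar>c\<bar> ^ DIM('a)) * (\<integral>\<^sup>+x. ennreal (norm (f (t + c *\<^sub>R x))) \<partial>lborel) < \<infinity>"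
    using f nn_integral_lborel_affine[of "\<lambda>x. ennreal (norm (f x))" c t] c
    by (simp add: integrable_iff_bounded)
  then have "(\<integral>\<^sup>+x. ennreal (norm (f (t + c *\<^sub>R x))) \<partial>lborel) < \<infinity>"
    using c by (auto simp: ennreal_mult_less_top)
  then show ?thesis by (simp add: integrable_iff_bounded)
qed

lemma integrable_lborel_affine_iff:
  fixes f :: "'a::euclidean_space \<Rightarrow> 'b::{banach, second_countable_topology}" and c :: real
  assumes c: "c \<noteq> 0"
  shows "integrable lborel (\<lambda>x. f (t + c *\<^sub>R x)) \<longleftrightarrow> integrable lborel f"
  using integrable_lborel_affine[of f c t] c
    integrable_lborel_affine[of "\<lambda>x. f (t + c *\<^sub>R x)" "1 / c" "- (1 / c) *\<^sub>R t"]
  by (auto simp: scaleR_add_right scaleR_diff_right)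

lemma integral_lborel_affine:
  fixes f :: "'a::euclidean_space \<Rightarrow> 'b::{banach, second_countable_topology}" and c :: real
  assumes c: "c \<noteq> 0"
  shows "(LINT x|lborel. f x) = (\<bar>c\<bar> ^ DIM('a)) *\<^sub>R (LINT x|lborel. f (t + c *\<^sub>R x))"
proof (cases "integrable lborel f")
  case True
  then have [measurable]: "f \<in> borel_measurable borel" by auto
  have "(LINT x|lborel. f x) =
      (LINT x|density (distr lborel borel (\<lambda>x. t + c *\<^sub>R x)) (\<lambda>_. ennreal (\<bar>c\<bar> ^ DIM('a))). f x)"
    using lborel_affine[OF c, of t] by simp
  also have "\<dots> = (\<bar>c\<bar> ^ DIM('a)) *\<^sub>R (LINT x|lborel. f (t + c *\<^sub>R x))"
    by (simp add: integral_density integral_distr)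
  finally show ?thesis .
next
  case False
  \<comment> \<open>Neither integrand is integrable here, and both integrals have the default value
    0.\<close>
  then show ?thesis
    using integrable_lborel_affine_iff[OF c, of f t] by (simp add: not_integrable_integral_eq)
qed

lemma integral_lborel_reflect:
  fixes f :: "'a::euclidean_space \<Rightarrow> 'b::{banach, second_countable_topology}"
  shows "(LINT y|lborel. f (x - y)) = (LINT y|lborel. f y)"
  using integral_lborel_affine[of "-1" f x] by simp

lemma integrable_lborel_reflect:
  fixes f :: "'a::euclidean_space \<Rightarrow> 'b::{banach, second_countable_topology}"
  shows "integrable lborel (\<lambda>y. f (x - y)) \<longleftrightarrow> integrable lborel f"
  using integrable_lborel_affine_iff[of "-1" f x] by simp

section \<open>Polynomial weights\<close>

lemma integrable_norm_powr:
  assumes "real DIM('a::euclidean_space) < s"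
  shows "integrable lborel (\<lambda>x::'a. (1 + norm x) powr -s)"
proof -
  obtain C where "0 < C" and C: "\<And>(g :: 'a \<Rightarrow> ennreal) x t. g \<in> borel_measurable lebesgue \<Longrightarrow> 0 < t \<Longrightarrow>
    ennreal (1 / t ^ DIM('a)) * (\<integral>\<^sup>+z. ennreal ((1 + norm (z - x) / t) powr -s) * g z \<partial>lebesgue)
      \<le> ennreal C * hl_maximal g x"
    by (rule radial_integral_le_hl_maximal[OF assms]) blast
  \<comment> \<open>The radial estimate is used for the constant function 1: its normalised
    integrals over balls about the origin all equal the volume of the unit ball, so its maximal
    function is finite there.\<close>
  have "hl_maximal (\<lambda>_::'a. 1) 0 \<le> ennreal (unit_ball_vol (real DIM('a)))"
    unfolding hl_maximal_def
  proof (rule SUP_least)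
    fix r :: real assume "r \<in> {0<..}"
    then show "ennreal (1 / r ^ DIM('a)) * (\<integral>\<^sup>+y. 1 * indicator (cball 0 r) (y::'a) \<partial>lebesgue)
        \<le> ennreal (unit_ball_vol (real DIM('a)))"
      using emeasure_cball[of r "0::'a"] by (simp add: ennreal_mult[symmetric])
  qed
  then have "hl_maximal (\<lambda>_::'a. 1) 0 < \<infinity>"
    by (rule le_less_trans) simp
  then have fin: "ennreal C * hl_maximal (\<lambda>_::'a. 1) 0 < \<infinity>"
    by (simp add: ennreal_mult_less_top)
  have "(\<integral>\<^sup>+z. ennreal ((1 + norm (z :: 'a)) powr -s) \<partial>lborel) \<le> ennreal C * hl_maximal (\<lambda>_::'a. 1) 0"
    using C[of "\<lambda>_. 1" 1 0] by (simp add: nn_integral_completion)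
  from le_less_trans[OF this fin] have "(\<integral>\<^sup>+z. ennreal ((1 + norm (z :: 'a)) powr -s) \<partial>lborel) < \<infinity>" .
  then show ?thesis by (simp add: integrable_iff_bounded)
qed

lemma norm_integral_le_integral:
  fixes f :: "'a \<Rightarrow> 'b::{banach, second_countable_topology}"
  assumes "integrable M f" "integrable M g" "\<And>x. norm (f x) \<le> g x"
  shows "norm (integral\<^sup>L M f) \<le> integral\<^sup>L M g"
  using assms by (intro order_trans[OF integral_norm_bound] integral_mono) auto

lemma one_plus_norm_le_mult:
  "1 + norm (x :: 'a::real_normed_vector) \<le> (1 + norm w) * (1 + norm (x - w))"
proof -
  have "norm x \<le> norm w + norm (x - w)" by norm
  also have "1 + \<dots> \<le> (1 + norm w) * (1 + norm (x - w))" by (simp add: algebra_simps)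
  finally show ?thesis by simp
qed

text \<open>Peetre's inequality for an exponent of either sign: moving the base point of a weight
  costs a power of the distance moved.\<close>

lemma one_plus_norm_powr_le:
  "(1 + norm (w :: 'a::real_normed_vector)) powr -s \<le> (1 + norm x) powr -s * (1 + norm (x - w)) powr \<bar>s\<bar>"
proof (cases "0 \<le> s")
  case True
  have "(1 + norm x) powr s \<le> (1 + norm w) powr s * (1 + norm (x - w)) powr s"
    using one_plus_norm_le_mult[of x w] True
    by (subst powr_mult[symmetric]) (auto intro!: powr_mono2)
  moreover have "0 < (1 + norm x) powr s" "0 < (1 + norm w) powr s"
    by (simp_all add: add_nonneg_eq_0_iff)
  ultimately show ?thesis using True by (simp add: powr_minus field_simps)
next
  case False
  have "(1 + norm w) powr -s \<le> ((1 + norm x) * (1 + norm (x - w))) powr -s"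
    using one_plus_norm_le_mult[of w x] False by (intro powr_mono2) (auto simp: norm_minus_commute)
  then show ?thesis using False by (simp add: powr_mult)
qed

text \<open>Real exponents are needed because the order \<kappa> of decay is real. The bound for the
  natural power \<open>nat \<lceil>s\<rceil>\<close> suffices, as the base is at least 1.\<close>

lemma schwartz_decay:
  fixes f :: "real ^ 'n::finite \<Rightarrow> complex"
  assumes "f \<in> schwartz"
  obtains C where "0 < C"
    "\<And>\<alpha> x. length \<alpha> \<le> m \<Longrightarrow> cmod (iterated_deriv \<alpha> f x) \<le> C * (1 + norm x) powr -s"
proof -
  obtain C where C: "0 < C" "\<And>\<alpha> x. length \<alpha> \<le> m \<Longrightarrow> (1 + norm x) ^ nat \<lceil>s\<rceil> * cmod (iterated_deriv \<alpha> f x) \<le> C"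
    using schwartz_bound[OF assms] by blast
  have "cmod (iterated_deriv \<alpha> f x) \<le> C * (1 + norm x) powr -s" if "length \<alpha> \<le> m" for \<alpha> x
  proof -
    have pos: "0 < 1 + norm x" by (simp add: add_pos_nonneg)
    have "(1 + norm x) powr s \<le> (1 + norm x) powr real (nat \<lceil>s\<rceil>)"
      by (intro powr_mono) (auto intro: real_nat_ceiling_ge)
    also have "\<dots> = (1 + norm x) ^ nat \<lceil>s\<rceil>" using pos by (rule powr_realpow)
    finally have "(1 + norm x) powr s * cmod (iterated_deriv \<alpha> f x) \<le> C"
      using C(2)[OF that, of x] by (meson mult_right_mono norm_ge_zero order_trans)
    then show ?thesis using pos by (simp add: powr_minus field_simps)
  qed
  then show thesis using C(1) that by blast
qed

section \<open>Increments and Taylor remainders of Schwartz functions\<close>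

lemma cmod_partial_sum_le:
  fixes v :: "real ^ 'n::finite"
  assumes "\<And>i. cmod (F i) \<le> B"
  shows "cmod (\<Sum>i\<in>UNIV. (v $ i) *\<^sub>R F i) \<le> real CARD('n) * B * norm v"
proof -
  have "cmod (\<Sum>i\<in>UNIV. (v $ i) *\<^sub>R F i) \<le> (\<Sum>i\<in>(UNIV :: 'n set). norm v * B)"
    using assms component_le_norm_cart[of v]
    by (intro sum_norm_le) (auto intro!: mult_mono simp: order_trans[OF norm_ge_zero assms])
  then show ?thesis by (simp add: ac_simps)
qed

lemma segment_weight:
  fixes x :: "'a::real_normed_vector"
  assumes "norm v \<le> 1" "y \<in> closed_segment x (x + v)" "0 \<le> s"
  shows "norm (y - x) \<le> norm v" "(1 + norm y) powr -s \<le> 2 powr s * (1 + norm x) powr -s"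
proof -
  show le: "norm (y - x) \<le> norm v"
    using segment_bound(1)[OF assms(2)] by (simp add: norm_minus_commute)
  have "(1 + norm y) powr -s \<le> (1 + norm x) powr -s * (1 + norm (x - y)) powr s"
    using one_plus_norm_powr_le[of y s x] assms(3) by simp
  also have "\<dots> \<le> (1 + norm x) powr -s * 2 powr s"
    using le assms by (intro mult_left_mono powr_mono2) (auto simp: norm_minus_commute)
  finally show "(1 + norm y) powr -s \<le> 2 powr s * (1 + norm x) powr -s" by (simp add: mult.commute)
qed

text \<open>The mean value inequality on the segment, where the decay of the derivatives of the next
  order is transferred to the endpoint \<open>x\<close> by \<open>segment_weight\<close>. It makes
  translation continuous in the Schwartz space.\<close>

lemma schwartz_increment:
  fixes f :: "real ^ 'n::finite \<Rightarrow> complex"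
  assumes f: "f \<in> schwartz" and s: "0 \<le> s"
  obtains C where "0 < C" "\<And>\<alpha> x v. length \<alpha> \<le> m \<Longrightarrow> norm v \<le> 1 \<Longrightarrow>
    cmod (iterated_deriv \<alpha> f (x + v) - iterated_deriv \<alpha> f x) \<le> C * norm v * (1 + norm x) powr -s"
proof -
  obtain M where M: "0 < M"
    "\<And>\<alpha> x. length \<alpha> \<le> Suc m \<Longrightarrow> cmod (iterated_deriv \<alpha> f x) \<le> M * (1 + norm x) powr -s"
    using schwartz_decay[OF f] by blast
  define C where "C = real CARD('n) * (M * 2 powr s)"
  have "cmod (iterated_deriv \<alpha> f (x + v) - iterated_deriv \<alpha> f x) \<le> C * norm v * (1 + norm x) powr -s"
    if \<alpha>: "length \<alpha> \<le> m" and v: "norm v \<le> 1" for \<alpha> x v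
  proof -
    have "norm (iterated_deriv \<alpha> f (x + v) - iterated_deriv \<alpha> f x) \<le>
       (C * (1 + norm x) powr -s) * norm (x + v - x)"
    proof (rule differentiable_bound[where S = "closed_segment x (x + v)"])
      fix y assume y: "y \<in> closed_segment x (x + v)"
      show "(iterated_deriv \<alpha> f has_derivative (\<lambda>u. \<Sum>i\<in>UNIV. (u $ i) *\<^sub>R iterated_deriv (i # \<alpha>) f y))
          (at y within closed_segment x (x + v))"
        by (rule has_derivative_at_withinI[OF smooth_has_derivative[OF schwartz_smooth[OF f]]])
      have "cmod (iterated_deriv (i # \<alpha>) f y) \<le> M * (2 powr s * (1 + norm x) powr -s)" for i
      proof (rule order_trans)
        show "cmod (iterated_deriv (i # \<alpha>) f y) \<le> M * (1 + norm y) powr -s" using \<alpha> by (intro M(2)) simp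
        show "M * (1 + norm y) powr -s \<le> M * (2 powr s * (1 + norm x) powr -s)"
          using segment_weight(2)[OF v y s] M(1) by (intro mult_left_mono) auto
      qed
      from cmod_partial_sum_le[OF this]
      show "onorm (\<lambda>u. \<Sum>i\<in>UNIV. (u $ i) *\<^sub>R iterated_deriv (i # \<alpha>) f y) \<le> C * (1 + norm x) powr -s"
        by (intro onorm_le) (simp add: C_def mult.assoc)
    qed auto
    then show ?thesis by (simp add: ac_simps)
  qed
  moreover have "0 < C" using M(1) by (simp add: C_def)
  ultimately show thesis using that by blast
qed

text \<open>The remainder is quadratic in \<open>v\<close> and keeps an arbitrary weight in
  \<open>x\<close>; with an integrable weight, differentiation under the integral sign becomes a
  direct estimate.\<close>

lemma schwartz_taylor:
  fixes f :: "real ^ 'n::finite \<Rightarrow> complex"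
  assumes f: "f \<in> schwartz" and s: "0 \<le> s"
  obtains C where "0 < C" "\<And>x v. norm v \<le> 1 \<Longrightarrow>
    cmod (f (x + v) - f x - (\<Sum>i\<in>UNIV. (v $ i) *\<^sub>R partial_deriv i f x)) \<le> C * (norm v)\<^sup>2 * (1 + norm x) powr -s"
proof -
  obtain M where M: "0 < M" "\<And>\<alpha> x v. length \<alpha> \<le> 1 \<Longrightarrow> norm v \<le> 1 \<Longrightarrow>
    cmod (iterated_deriv \<alpha> f (x + v) - iterated_deriv \<alpha> f x) \<le> M * norm v * (1 + norm x) powr -s"
    using schwartz_increment[OF f s] by blast
  define C where "C = real CARD('n) * M"
  have "cmod (f (x + v) - f x - (\<Sum>i\<in>UNIV. (v $ i) *\<^sub>R partial_deriv i f x)) \<le> C * (norm v)\<^sup>2 * (1 + norm x) powr -s"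
    if v: "norm v \<le> 1" for x v
  proof -
    define D where "D y u = (\<Sum>i\<in>UNIV. (u $ i) *\<^sub>R partial_deriv i f y)" for y u
    have "norm (f (x + v) - f x - D x (x + v - x)) \<le> norm (x + v - x) * (C * norm v * (1 + norm x) powr -s)"
    proof (rule differentiable_bound_linearization[where S = "closed_segment x (x + v)"])
      fix t :: real assume "t \<in> {0..1}"
      then show "x + t *\<^sub>R (x + v - x) \<in> closed_segment x (x + v)"
        by (auto simp: closed_segment_def algebra_simps intro!: exI[of _ t])
    next
      fix y assume y: "y \<in> closed_segment x (x + v)"
      show "(f has_derivative D y) (at y within closed_segment x (x + v))"
        using has_derivative_at_withinI[OF smooth_has_derivative[OF schwartz_smooth[OF f], where \<alpha> = "[]"]]
        by (simp add: D_def[abs_def])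
      note yx = segment_weight(1)[OF v y s]
      have "cmod (partial_deriv i f y - partial_deriv i f x) \<le> M * norm v * (1 + norm x) powr -s" for i
      proof -
        have "cmod (partial_deriv i f y - partial_deriv i f x) \<le> M * norm (y - x) * (1 + norm x) powr -s"
          using M(2)[of "[i]" "y - x" x] yx v by simp
        also have "\<dots> \<le> M * norm v * (1 + norm x) powr -s"
          using yx M(1) by (intro mult_right_mono mult_left_mono) auto
        finally show ?thesis .
      qed
      from cmod_partial_sum_le[OF this]
      show "onorm (D y - D x) \<le> C * norm v * (1 + norm x) powr -s"
        unfolding fun_diff_def D_def
        by (intro onorm_le) (simp add: C_def mult.assoc sum_subtractf[symmetric] scaleR_diff_right[symmetric])
    qed auto
    then show ?thesis by (simp add: D_def power2_eq_square ac_simps)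
  qed
  moreover have "0 < C" using M(1) by (simp add: C_def)
  ultimately show thesis using that by blast
qed

section \<open>Convolution of a bounded function with a Schwartz function\<close>

lemma schwartz_measurable:
  assumes "f \<in> schwartz" shows "f \<in> borel_measurable borel"
  using smooth_continuous_on[OF schwartz_smooth[OF assms], of "[]"] by (simp add: borel_measurable_continuous_onI)

text \<open>The rough factor \<open>h\<close> stays untranslated, so that all derivatives fall on
  the Schwartz factor; \<open>convolution\<close> translates its first argument instead.\<close>

definition conv :: "(real ^ 'n::finite \<Rightarrow> complex) \<Rightarrow> (real ^ 'n \<Rightarrow> complex) \<Rightarrow> real ^ 'n \<Rightarrow> complex" where
  "conv h f = (\<lambda>x. LINT w|lborel. h w * f (x - w))"

lemma integrable_reflect_norm_powr:
  assumes "real CARD('n::finite) < s"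
  shows "integrable lborel (\<lambda>w. (1 + norm (x - w :: real ^ 'n)) powr -s)"
  using integrable_norm_powr[where 'a="real ^ 'n" and s=s] assms integrable_lborel_reflect[of "\<lambda>w. (1 + norm w) powr -s" x] by simp

lemma integrable_conv:
  fixes f :: "real ^ 'n::finite \<Rightarrow> complex"
  assumes f: "f \<in> schwartz" and [measurable]: "h \<in> borel_measurable borel" and h: "\<And>w. cmod (h w) \<le> A"
  shows "integrable lborel (\<lambda>w. h w * f (x - w))"
proof -
  note [measurable] = schwartz_measurable[OF f]
  let ?s = "real CARD('n) + 1"
  obtain C where C: "0 < C"
    "\<And>\<alpha> x. length \<alpha> \<le> 0 \<Longrightarrow> cmod (iterated_deriv \<alpha> f x) \<le> C * (1 + norm x) powr -?s"
    using schwartz_decay[OF f] by blast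
  show ?thesis
  proof (rule Bochner_Integration.integrable_bound)
    show "integrable lborel (\<lambda>w. A * C * (1 + norm (x - w)) powr -?s)"
      by (intro integrable_mult_right integrable_reflect_norm_powr) simp
    have "norm (h w * f (x - w)) \<le> norm (A * C * (1 + norm (x - w)) powr - ?s)" for w
    proof -
      have "norm (h w * f (x - w)) \<le> A * (C * (1 + norm (x - w)) powr - ?s)"
        unfolding norm_mult using C(2)[of "[]" "x - w"] order_trans[OF norm_ge_zero h]
        by (intro mult_mono h) auto
      also have "\<dots> \<le> norm (A * C * (1 + norm (x - w)) powr - ?s)" by (simp add: mult.assoc)
      finally show ?thesis .
    qed
    then show "AE w in lborel. norm (h w * f (x - w)) \<le> norm (A * C * (1 + norm (x - w)) powr - ?s)" by simp
  qed measurable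
qed

text \<open>Integrated against the bounded \<open>h\<close>, the Taylor remainder of
  \<open>f\<close> gives an error of the order of the square of \<open>norm v\<close>, and division
  by \<open>norm v\<close> still leaves a null function.\<close>

lemma conv_has_derivative:
  fixes f :: "real ^ 'n::finite \<Rightarrow> complex"
  assumes f: "f \<in> schwartz" and h [measurable]: "h \<in> borel_measurable borel" and hA: "\<And>w. cmod (h w) \<le> A"
  shows "(conv h f has_derivative (\<lambda>v. \<Sum>i\<in>UNIV. (v $ i) *\<^sub>R conv h (partial_deriv i f) x)) (at x)"
proof -
  note [measurable] = schwartz_measurable[OF f]
  let ?s = "real CARD('n) + 1"
  let ?D = "\<lambda>v::real ^ 'n. \<Sum>i\<in>UNIV. (v $ i) *\<^sub>R conv h (partial_deriv i f) x"
  obtain C where C: "0 < C" "\<And>x v. norm v \<le> 1 \<Longrightarrow>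
    cmod (f (x + v) - f x - (\<Sum>i\<in>UNIV. (v $ i) *\<^sub>R partial_deriv i f x)) \<le> C * (norm v)\<^sup>2 * (1 + norm x) powr -?s"
    using schwartz_taylor[OF f, of ?s] by auto
  define I where "I = (LINT w|lborel. (1 + norm (x - w :: real ^ 'n)) powr -?s)"
  have pd: "partial_deriv i f \<in> schwartz" for i
    using schwartz_iterated_deriv[OF f, of "[i]"] by simp
  note int = integrable_conv[OF _ h hA]
  have I0: "I \<ge> 0" unfolding I_def by (intro Bochner_Integration.integral_nonneg) auto
  have A0: "0 \<le> A" using hA[of 0] norm_ge_zero order_trans by blast
  have est: "cmod (conv h f (x + v) - conv h f x - ?D v) \<le> (A * C * I) * (norm v)\<^sup>2" if v: "norm v \<le> 1" for v
  proof -
    have "conv h f (x + v) - conv h f x - ?D v =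
       (LINT w|lborel. h w * f (x + v - w) - h w * f (x - w) - (\<Sum>i\<in>UNIV. (v $ i) *\<^sub>R (h w * partial_deriv i f (x - w))))"
      unfolding conv_def using int[OF f] int[OF pd]
      by (simp add: Bochner_Integration.integral_diff Bochner_Integration.integral_sum Bochner_Integration.integrable_diff Bochner_Integration.integrable_sum integrable_scaleR_right)
    also have "cmod \<dots> \<le> (LINT w|lborel. A * C * (norm v)\<^sup>2 * (1 + norm (x - w)) powr -?s)"
    proof (rule norm_integral_le_integral)
      show "integrable lborel (\<lambda>w. h w * f (x + v - w) - h w * f (x - w) -
          (\<Sum>i\<in>UNIV. (v $ i) *\<^sub>R (h w * partial_deriv i f (x - w))))"
        using int[OF f] int[OF pd] by (intro Bochner_Integration.integrable_diff Bochner_Integration.integrable_sum integrable_scaleR_right)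
      show "integrable lborel (\<lambda>w. A * C * (norm v)\<^sup>2 * (1 + norm (x - w)) powr -?s)"
        by (intro integrable_mult_right integrable_reflect_norm_powr) simp
      fix w
      have "h w * f (x + v - w) - h w * f (x - w) - (\<Sum>i\<in>UNIV. (v $ i) *\<^sub>R (h w * partial_deriv i f (x - w))) =
        h w * (f (x - w + v) - f (x - w) - (\<Sum>i\<in>UNIV. (v $ i) *\<^sub>R partial_deriv i f (x - w)))"
        by (simp add: right_diff_distrib sum_distrib_left algebra_simps)
      also have "cmod \<dots> \<le> A * (C * (norm v)\<^sup>2 * (1 + norm (x - w)) powr -?s)"
        unfolding norm_mult using C(2)[OF v, of "x - w"] A0 by (intro mult_mono hA) auto
      finally show "cmod (h w * f (x + v - w) - h w * f (x - w) -
          (\<Sum>i\<in>UNIV. (v $ i) *\<^sub>R (h w * partial_deriv i f (x - w)))) \<le> A * C * (norm v)\<^sup>2 * (1 + norm (x - w)) powr -?s"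
        by (simp add: mult.assoc)
    qed
    also have "\<dots> = (A * C * I) * (norm v)\<^sup>2" by (simp add: I_def)
    finally show ?thesis .
  qed
  have "((\<lambda>v. norm (conv h f (x + v) - conv h f x - ?D v) / norm v) \<longlongrightarrow> 0) (at 0)"
  proof (rule real_tendsto_sandwich)
    show "\<forall>\<^sub>F v in at 0. 0 \<le> norm (conv h f (x + v) - conv h f x - ?D v) / norm v" by simp
    have "\<forall>\<^sub>F v in at (0 :: real ^ 'n). norm v < 1 \<and> v \<noteq> 0"
      unfolding eventually_at by (intro exI[of _ 1]) auto
    then show "\<forall>\<^sub>F v in at 0. norm (conv h f (x + v) - conv h f x - ?D v) / norm v \<le> (A * C * I) * norm v"
    proof eventually_elim
      case (elim v)
      then have "norm (conv h f (x + v) - conv h f x - ?D v) \<le> (A * C * I) * (norm v)\<^sup>2" by (intro est) simp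
      then show ?case using elim by (simp add: divide_le_eq power2_eq_square mult.assoc)
    qed
    show "((\<lambda>v::real ^ 'n. (A * C * I) * norm v) \<longlongrightarrow> 0) (at 0)"
      by (rule tendsto_eq_intros | simp)+
  qed simp
  moreover have "bounded_linear ?D"
    by (intro bounded_linear_sum bounded_linear_scaleR_left[THEN bounded_linear_compose] bounded_linear_vec_nth)
  ultimately show ?thesis unfolding has_derivative_at by blast
qed

lemma iterated_deriv_conv:
  assumes "f \<in> schwartz" "h \<in> borel_measurable borel" "\<And>w. cmod (h w) \<le> A"
  shows "iterated_deriv \<alpha> (conv h f) = conv h (iterated_deriv \<alpha> f)"
proof (induction \<alpha>)
  case (Cons i \<alpha>)
  show ?case
  proof
    fix x
    show "iterated_deriv (i # \<alpha>) (conv h f) x = conv h (iterated_deriv (i # \<alpha>) f) x"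
      unfolding iterated_deriv_Cons Cons
        partial_deriv_eq[OF conv_has_derivative[OF schwartz_iterated_deriv[OF assms(1)] assms(2,3)]] sum_axis_scaleR ..
  qed
qed simp

lemma smooth_conv:
  assumes "f \<in> schwartz" "h \<in> borel_measurable borel" "\<And>w. cmod (h w) \<le> A"
  shows "smooth (conv h f)"
  unfolding smooth_def iterated_deriv_conv[OF assms]
  using conv_has_derivative[OF schwartz_iterated_deriv[OF assms(1)] assms(2,3)] unfolding differentiable_def by blast

text \<open>Peetre's inequality moves the weight from \<open>w\<close> to \<open>x\<close>, and
  decay of \<open>f\<close> at order \<open>?r + \<bar>s\<bar>\<close> leaves an integrable power.
  The constant \<open>C\<close> is independent of \<open>h\<close>, \<open>A\<close>,
  \<open>D\<close> and the centre \<open>a\<close>. The bound \<open>D\<close> secures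
  integrability: \<open>s\<close> may be negative, and then the weighted bound alone would allow
  \<open>h\<close> to grow.\<close>

lemma conv_decay:
  fixes f :: "real ^ 'n::finite \<Rightarrow> complex"
  assumes f: "f \<in> schwartz"
  obtains C where "0 < C" "\<And>h A D a \<alpha> x. h \<in> borel_measurable borel \<Longrightarrow>
    (\<And>w. cmod (h w) \<le> D) \<Longrightarrow> (\<And>w. cmod (h w) \<le> A * (1 + norm (w - a)) powr -s) \<Longrightarrow> length \<alpha> \<le> m \<Longrightarrow>
    cmod (iterated_deriv \<alpha> (conv h f) x) \<le> A * C * (1 + norm (x - a)) powr -s"
proof -
  let ?r = "real CARD('n) + 1"
  obtain M where M: "0 < M"
    "\<And>\<alpha> x. length \<alpha> \<le> m \<Longrightarrow> cmod (iterated_deriv \<alpha> f x) \<le> M * (1 + norm x) powr -(?r + \<bar>s\<bar>)"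
    using schwartz_decay[OF f] by blast
  define I where "I = (LINT w|lborel. (1 + norm (w :: real ^ 'n)) powr -?r)"
  have I0: "I \<ge> 0" unfolding I_def by (intro Bochner_Integration.integral_nonneg) auto
  have "cmod (iterated_deriv \<alpha> (conv h f) x) \<le> A * (M * I + 1) * (1 + norm (x - a)) powr -s"
    if h[measurable]: "h \<in> borel_measurable borel" and hb: "\<And>w. cmod (h w) \<le> D" and hA: "\<And>w. cmod (h w) \<le> A * (1 + norm (w - a)) powr -s"
      and \<alpha>: "length \<alpha> \<le> m" for h A D a \<alpha> x
  proof -
    have A0: "0 \<le> A" using order_trans[OF norm_ge_zero hA[of a]] by simp
    have "cmod (iterated_deriv \<alpha> (conv h f) x) = cmod (LINT w|lborel. h w * iterated_deriv \<alpha> f (x - w))"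
      unfolding iterated_deriv_conv[OF f h hb] by (simp add: conv_def)
    also have "\<dots> \<le> (LINT w|lborel. A * M * (1 + norm (x - a)) powr -s * (1 + norm (x - w)) powr -?r)"
    proof (rule norm_integral_le_integral)
      show "integrable lborel (\<lambda>w. h w * iterated_deriv \<alpha> f (x - w))"
        by (rule integrable_conv[OF schwartz_iterated_deriv[OF f] h hb])
      show "integrable lborel (\<lambda>w. A * M * (1 + norm (x - a)) powr -s * (1 + norm (x - w)) powr -?r)"
        by (intro integrable_mult_right integrable_reflect_norm_powr) simp
      fix w
      have "cmod (h w * iterated_deriv \<alpha> f (x - w)) \<le>
          (A * (1 + norm (w - a)) powr -s) * (M * (1 + norm (x - w)) powr -(?r + \<bar>s\<bar>))"
        unfolding norm_mult using A0 by (intro mult_mono hA M(2) \<alpha>) auto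
      also have "\<dots> \<le> (A * ((1 + norm (x - a)) powr -s * (1 + norm (x - w)) powr \<bar>s\<bar>)) * (M * (1 + norm (x - w)) powr -(?r + \<bar>s\<bar>))"
        using one_plus_norm_powr_le[of "w - a" s "x - a"] A0 M(1) by (intro mult_right_mono mult_left_mono) auto
      also have "\<dots> = A * M * (1 + norm (x - a)) powr -s * ((1 + norm (x - w)) powr \<bar>s\<bar> * (1 + norm (x - w)) powr -(?r + \<bar>s\<bar>))"
        by (simp add: ac_simps)
      also have "(1 + norm (x - w)) powr \<bar>s\<bar> * (1 + norm (x - w)) powr -(?r + \<bar>s\<bar>) = (1 + norm (x - w)) powr -?r"
        by (simp add: powr_add[symmetric])
      finally show "cmod (h w * iterated_deriv \<alpha> f (x - w)) \<le> A * M * (1 + norm (x - a)) powr -s * (1 + norm (x - w)) powr -?r" .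
    qed
    also have "\<dots> = A * M * (1 + norm (x - a)) powr -s * I"
      using integral_lborel_reflect[of "\<lambda>w::real ^ 'n. (1 + norm w) powr -?r" x] by (simp add: I_def)
    also have "\<dots> = A * (M * I) * (1 + norm (x - a)) powr -s" by simp
    also have "\<dots> \<le> A * (M * I + 1) * (1 + norm (x - a)) powr -s"
      using A0 by (intro mult_right_mono mult_left_mono) auto
    finally show ?thesis .
  qed
  moreover have "0 < M * I + 1" using M(1) I0 by (intro add_nonneg_pos) auto
  ultimately show thesis using that by blast
qed

text \<open>Bounded support turns a bound for \<open>h\<close> into decay of every order
  \<open>k\<close>, which \<open>conv_decay\<close> passes on to the convolution.\<close>

lemma schwartz_conv:
  fixes f :: "real ^ 'n::finite \<Rightarrow> complex"
  assumes f: "f \<in> schwartz" and h: "h \<in> borel_measurable borel" and hA: "\<And>w. cmod (h w) \<le> A"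
    and supp: "\<And>w. R < norm w \<Longrightarrow> h w = 0"
  shows "conv h f \<in> schwartz"
proof (rule schwartzI)
  show "smooth (conv h f)" by (rule smooth_conv[OF f h hA])
  fix k and \<alpha> :: "'n list"
  have A0: "0 \<le> A" by (rule order_trans[OF norm_ge_zero hA[of 0]])
  have dec: "cmod (h w) \<le> (A * (1 + \<bar>R\<bar>) powr real k) * (1 + norm w) powr - real k" for w
  proof (cases "R < norm w")
    case False
    then have "(1 + norm w) powr real k \<le> (1 + \<bar>R\<bar>) powr real k" by (intro powr_mono2) auto
    moreover have "(1 + norm w) powr real k * (1 + norm w) powr - real k = 1"
      by (auto simp: powr_add[symmetric] add_nonneg_eq_0_iff)
    ultimately have "1 \<le> (1 + \<bar>R\<bar>) powr real k * (1 + norm w) powr - real k"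
      by (metis mult_right_mono powr_ge_zero)
    then have "A * 1 \<le> A * ((1 + \<bar>R\<bar>) powr real k * (1 + norm w) powr - real k)"
      using A0 by (rule mult_left_mono)
    then show ?thesis using hA[of w] by (simp add: mult.assoc)
  qed (use A0 supp in auto)
  obtain C where C: "0 < C" "\<And>h A D a \<beta> x. h \<in> borel_measurable borel \<Longrightarrow>
    (\<And>w. cmod (h w) \<le> D) \<Longrightarrow> (\<And>w. cmod (h w) \<le> A * (1 + norm (w - a)) powr -real k) \<Longrightarrow>
    length \<beta> \<le> length \<alpha> \<Longrightarrow>
    cmod (iterated_deriv \<beta> (conv h f) x) \<le> A * C * (1 + norm (x - a)) powr -real k"
    by (rule conv_decay[OF f, where m="length \<alpha>" and s="real k"]) blast
  have "(1 + norm x) ^ k * cmod (iterated_deriv \<alpha> (conv h f) x) \<le> A * (1 + \<bar>R\<bar>) powr real k * C" for x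
  proof -
    have pos: "0 < 1 + norm x" by (simp add: add_pos_nonneg)
    have "(1 + norm x) ^ k * cmod (iterated_deriv \<alpha> (conv h f) x) \<le>
       (1 + norm x) ^ k * ((A * (1 + \<bar>R\<bar>) powr real k) * C * (1 + norm x) powr -real k)"
      using C(2)[where h=h and a=0, OF h hA] dec by (intro mult_left_mono) auto
    also have "\<dots> = A * (1 + \<bar>R\<bar>) powr real k * C"
      using pos by (simp add: powr_minus powr_realpow[OF pos])
    finally show ?thesis .
  qed
  then show "\<exists>C. \<forall>x. (1 + norm x) ^ k * cmod (iterated_deriv \<alpha> (conv h f) x) \<le> C" by blast
qed

section \<open>Tempered functionals\<close>

text \<open>Continuity is phrased with an arbitrary pointwise bound \<open>B\<close> in place of the
  supremum \<open>schwartz_seminorm\<close>, so that estimates can be fed in without handling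
  suprema.\<close>

definition tempered_functional :: "((real ^ 'n::finite \<Rightarrow> complex) \<Rightarrow> complex) \<Rightarrow> bool" where
  "tempered_functional u \<longleftrightarrow>
     (\<forall>f\<in>schwartz. \<forall>g\<in>schwartz. u (\<lambda>x. f x + g x) = u f + u g) \<and>
     (\<forall>c. \<forall>f\<in>schwartz. u (\<lambda>x. c * f x) = c * u f) \<and>
     (\<exists>C k m. 0 \<le> C \<and> (\<forall>f\<in>schwartz. \<forall>B.
        (\<forall>\<alpha> x. length \<alpha> \<le> m \<longrightarrow> (1 + norm x) ^ k * cmod (iterated_deriv \<alpha> f x) \<le> B) \<longrightarrow>
        cmod (u f) \<le> C * B))"

lemma tempered_functionalE:
  assumes "tempered_functional u"
  obtains C k m where "0 \<le> C" "\<And>f B. f \<in> schwartz \<Longrightarrow>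
    (\<And>\<alpha> x. length \<alpha> \<le> m \<Longrightarrow> (1 + norm x) ^ k * cmod (iterated_deriv \<alpha> f x) \<le> B) \<Longrightarrow> cmod (u f) \<le> C * B"
proof -
  obtain C k m where "0 \<le> C" and *: "\<forall>f\<in>schwartz. \<forall>B.
        (\<forall>\<alpha> x. length \<alpha> \<le> m \<longrightarrow> (1 + norm x) ^ k * cmod (iterated_deriv \<alpha> f x) \<le> B) \<longrightarrow>
        cmod (u f) \<le> C * B"
    using assms unfolding tempered_functional_def by blast
  then show thesis by (intro that[of C m k]) auto
qed

lemma tempered_functional_add:
  "tempered_functional u \<Longrightarrow> f \<in> schwartz \<Longrightarrow> g \<in> schwartz \<Longrightarrow> u (\<lambda>x. f x + g x) = u f + u g"
  by (simp add: tempered_functional_def)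

lemma tempered_functional_cmult:
  "tempered_functional u \<Longrightarrow> f \<in> schwartz \<Longrightarrow> u (\<lambda>x. c * f x) = c * u f"
  by (simp add: tempered_functional_def)

lemma tempered_functional_diff:
  assumes "tempered_functional u" "f \<in> schwartz" "g \<in> schwartz"
  shows "u (\<lambda>x. f x - g x) = u f - u g"
  using tempered_functional_add[OF assms(1,2) schwartz_cmult[OF assms(3), of "-1"]]
    tempered_functional_cmult[OF assms(1,3), of "-1"] by simp

lemma schwartz_diff:
  assumes "f \<in> schwartz" "g \<in> schwartz" shows "(\<lambda>x. f x - g x) \<in> schwartz"
  using schwartz_add[OF assms(1) schwartz_cmult[OF assms(2), of "-1"]] by simp

lemma tempered_functional_sum:
  assumes u: "tempered_functional u" and f: "\<And>i. i \<in> S \<Longrightarrow> f i \<in> schwartz"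
  shows "u (\<lambda>x. \<Sum>i\<in>S. f i x) = (\<Sum>i\<in>S. u (f i))"
proof -
  have z: "u (\<lambda>x. 0) = 0" using tempered_functional_cmult[OF u schwartz_zero, of 0] by simp
  show ?thesis
    using f by (induction S rule: infinite_finite_induct)
      (auto simp: z tempered_functional_add[OF u] schwartz_sum)
qed

lemma iterated_deriv_diff:
  assumes "smooth f" "smooth g"
  shows "iterated_deriv \<alpha> (\<lambda>x. f x - g x) = (\<lambda>x. iterated_deriv \<alpha> f x - iterated_deriv \<alpha> g x)"
  using iterated_deriv_add[OF assms(1) smooth_cmult[OF assms(2), of "-1"], of \<alpha>]
    iterated_deriv_cmult[OF assms(2), of \<alpha> "-1"] by simp

lemma iterated_deriv_zero: "iterated_deriv \<alpha> (\<lambda>x. 0) = (\<lambda>x. 0)"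
  using iterated_deriv_cmult[OF schwartz_smooth[OF schwartz_zero], of \<alpha> 0] by simp

lemma iterated_deriv_sum:
  assumes "\<And>i. i \<in> S \<Longrightarrow> f i \<in> schwartz"
  shows "iterated_deriv \<alpha> (\<lambda>x. \<Sum>i\<in>S. f i x) = (\<lambda>x. \<Sum>i\<in>S. iterated_deriv \<alpha> (f i) x)"
  using assms by (induction S rule: infinite_finite_induct)
    (auto simp: iterated_deriv_zero iterated_deriv_add schwartz_smooth schwartz_sum)

lemma schwartz_seminorm_nonneg:
  fixes f :: "real ^ 'n::finite \<Rightarrow> complex"
  assumes "f \<in> schwartz" shows "0 \<le> schwartz_seminorm k m f"
proof -
  obtain C where C: "0 < C"
    "\<And>\<alpha> x. length \<alpha> \<le> m \<Longrightarrow> (1 + norm x) ^ k * cmod (iterated_deriv \<alpha> f x) \<le> C"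
    by (rule schwartz_bound[OF assms, of m k]) blast
  have "bdd_above ((\<lambda>(x, \<alpha>). (1 + norm x) ^ k * cmod (iterated_deriv \<alpha> f x)) ` (UNIV \<times> {\<alpha>. length \<alpha> \<le> m}))"
    using C(2) by (auto simp: bdd_above_def)
  then have "(case (0, []) of (x, \<alpha>) \<Rightarrow> (1 + norm x) ^ k * cmod (iterated_deriv \<alpha> f x)) \<le> schwartz_seminorm k m f"
    unfolding schwartz_seminorm_def by (intro cSUP_upper) auto
  then show ?thesis by (simp add: order_trans[OF norm_ge_zero])
qed

lemma schwartz_seminorm_le:
  fixes f :: "real ^ 'n::finite \<Rightarrow> complex"
  assumes "\<And>\<alpha> x. length \<alpha> \<le> m \<Longrightarrow> (1 + norm x) ^ k * cmod (iterated_deriv \<alpha> f x) \<le> B"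
  shows "schwartz_seminorm k m f \<le> B"
proof -
  have "{\<alpha> :: 'n list. length \<alpha> \<le> m} \<noteq> {}" by (auto intro: exI[of _ "[]"])
  then show ?thesis unfolding schwartz_seminorm_def
    using assms by (intro cSUP_least) auto
qed

lemma tempered_distribution_functional:
  assumes "u \<in> tempered_distributions" shows "tempered_functional u"
proof -
  obtain C k m where C: "\<forall>f\<in>schwartz. cmod (u f) \<le> C * schwartz_seminorm k m f"
    using assms unfolding tempered_distributions_def by auto
  have "cmod (u f) \<le> \<bar>C\<bar> * B" if f: "f \<in> schwartz" and
    B: "\<forall>\<alpha> x. length \<alpha> \<le> m \<longrightarrow> (1 + norm x) ^ k * cmod (iterated_deriv \<alpha> f x) \<le> B" for f B
  proof -
    have "cmod (u f) \<le> C * schwartz_seminorm k m f" using C f by blast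
    also have "\<dots> \<le> \<bar>C\<bar> * schwartz_seminorm k m f"
      by (intro mult_right_mono schwartz_seminorm_nonneg f) simp
    also have "\<dots> \<le> \<bar>C\<bar> * B" using B by (intro mult_left_mono schwartz_seminorm_le) auto
    finally show ?thesis .
  qed
  then have "\<exists>C k m. 0 \<le> C \<and> (\<forall>f\<in>schwartz. \<forall>B.
        (\<forall>\<alpha> x. length \<alpha> \<le> m \<longrightarrow> (1 + norm x) ^ k * cmod (iterated_deriv \<alpha> f x) \<le> B) \<longrightarrow>
        cmod (u f) \<le> C * B)"
    by (intro exI[of _ "\<bar>C\<bar>"] exI[of _ k] exI[of _ m]) auto
  then show ?thesis using assms unfolding tempered_functional_def tempered_distributions_def by blast
qed

text \<open>Translations, reflections and dilations of the argument are moved into the functional in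
  this way, which reduces an arbitrary point and scale to the origin and the unit scale.\<close>

lemma tempered_functional_affine:
  fixes a :: "real ^ 'n::finite"
  assumes u: "tempered_functional u" and c: "c \<noteq> 0"
  shows "tempered_functional (\<lambda>f. b * u (\<lambda>z. f (c *\<^sub>R z + a)))"
proof -
  obtain C k m where C: "0 \<le> C" "\<And>f B. f \<in> schwartz \<Longrightarrow>
    (\<And>\<alpha> x. length \<alpha> \<le> m \<Longrightarrow> (1 + norm x) ^ k * cmod (iterated_deriv \<alpha> f x) \<le> B) \<Longrightarrow> cmod (u f) \<le> C * B"
    by (rule tempered_functionalE[OF u]) blast
  obtain K where K: "0 < K" "\<And>f B. f \<in> schwartz \<Longrightarrow>
    \<forall>\<alpha> x. length \<alpha> \<le> m \<longrightarrow> (1 + norm x) ^ k * cmod (iterated_deriv \<alpha> f x) \<le> B \<Longrightarrow>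
    \<forall>\<alpha> x. length \<alpha> \<le> m \<longrightarrow>
      (1 + norm x) ^ k * cmod (iterated_deriv \<alpha> (\<lambda>x. f (c *\<^sub>R x + a)) x) \<le> K * B"
    by (rule iterated_deriv_affine_bound[OF c, where a=a and m=m and k=k]) blast
  have "cmod (b * u (\<lambda>z. f (c *\<^sub>R z + a))) \<le> (cmod b * C * K) * B" if f: "f \<in> schwartz" and
    B: "\<forall>\<alpha> x. length \<alpha> \<le> m \<longrightarrow> (1 + norm x) ^ k * cmod (iterated_deriv \<alpha> f x) \<le> B" for f B
  proof -
    have "cmod (u (\<lambda>z. f (c *\<^sub>R z + a))) \<le> C * (K * B)"
      using K(2)[OF f B] by (intro C(2)[OF schwartz_affine[OF f c]]) blast
    then have "cmod b * cmod (u (\<lambda>z. f (c *\<^sub>R z + a))) \<le> cmod b * (C * (K * B))"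
      by (rule mult_left_mono) simp
    then show ?thesis by (simp add: norm_mult mult.assoc)
  qed
  then have "\<exists>C k m. 0 \<le> C \<and> (\<forall>f\<in>schwartz. \<forall>B.
        (\<forall>\<alpha> x. length \<alpha> \<le> m \<longrightarrow> (1 + norm x) ^ k * cmod (iterated_deriv \<alpha> f x) \<le> B) \<longrightarrow>
        cmod (b * u (\<lambda>z. f (c *\<^sub>R z + a))) \<le> C * B)"
    using C(1) K(1) by (intro exI[of _ "cmod b * C * K"] exI[of _ k] exI[of _ m]) auto
  then show ?thesis unfolding tempered_functional_def
    using tempered_functional_add[OF u schwartz_affine[OF _ c] schwartz_affine[OF _ c]]
      tempered_functional_cmult[OF u schwartz_affine[OF _ c]]
    by (auto simp: algebra_simps)
qed

text \<open>Every coordinate is rounded down to a multiple of \<open>\<epsilon>\<close>. Small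
  \<open>\<epsilon>\<close> gives the meshes of Riemann sums, and \<open>\<epsilon> = 1\<close> the
  integer lattice that indexes the pieces of the kernel.\<close>

definition grid :: "real \<Rightarrow> real ^ 'n::finite \<Rightarrow> real ^ 'n" where
  "grid \<epsilon> w = (\<chi> i. \<epsilon> * of_int \<lfloor>w $ i / \<epsilon>\<rfloor>)"

lemma norm_diff_grid_le:
  fixes w :: "real ^ 'n::finite"
  assumes "0 < \<epsilon>" shows "norm (w - grid \<epsilon> w) \<le> real CARD('n) * \<epsilon>"
proof -
  have "\<bar>(w - grid \<epsilon> w) $ i\<bar> \<le> \<epsilon>" for i
  proof -
    have "0 \<le> w $ i / \<epsilon> - of_int \<lfloor>w $ i / \<epsilon>\<rfloor>" "w $ i / \<epsilon> - of_int \<lfloor>w $ i / \<epsilon>\<rfloor> \<le> 1" by linarith+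
    then have "0 \<le> \<epsilon> * (w $ i / \<epsilon> - of_int \<lfloor>w $ i / \<epsilon>\<rfloor>)" "\<epsilon> * (w $ i / \<epsilon> - of_int \<lfloor>w $ i / \<epsilon>\<rfloor>) \<le> \<epsilon> * 1"
      using assms by (auto intro!: mult_left_mono simp del: mult_1_right)
    then show ?thesis using assms by (simp add: grid_def right_diff_distrib)
  qed
  then have "(\<Sum>i\<in>UNIV. \<bar>(w - grid \<epsilon> w) $ i\<bar>) \<le> (\<Sum>i\<in>(UNIV :: 'n set). \<epsilon>)" by (rule sum_mono)
  then show ?thesis using norm_le_l1_cart[of "w - grid \<epsilon> w"] by simp
qed

lemma finite_grid_image:
  fixes R :: real
  assumes "0 < \<epsilon>" shows "finite (grid \<epsilon> ` cball (0 :: real ^ 'n::finite) R)"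
proof (rule finite_subset)
  define M where "M = \<lceil>R / \<epsilon>\<rceil> + 1"
  show "grid \<epsilon> ` cball 0 R \<subseteq> (\<lambda>f. \<chi> i. \<epsilon> * of_int (f i)) ` (UNIV \<rightarrow>\<^sub>E {-M..M} :: ('n \<Rightarrow> int) set)"
  proof
    fix a assume "a \<in> grid \<epsilon> ` cball (0 :: real ^ 'n) R"
    then obtain w :: "real ^ 'n" where w: "norm w \<le> R" "a = grid \<epsilon> w" by auto
    have "\<lfloor>w $ i / \<epsilon>\<rfloor> \<in> {-M..M}" for i
    proof -
      have "\<bar>w $ i / \<epsilon>\<bar> \<le> R / \<epsilon>"
        using component_le_norm_cart[of w i] w(1) assms by (simp add: divide_right_mono)
      then have "w $ i / \<epsilon> \<le> R / \<epsilon>" "- (R / \<epsilon>) \<le> w $ i / \<epsilon>" by linarith+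
      then show ?thesis unfolding M_def atLeastAtMost_iff by linarith
    qed
    then show "a \<in> (\<lambda>f. \<chi> i. \<epsilon> * of_int (f i)) ` (UNIV \<rightarrow>\<^sub>E {-M..M})"
      by (intro image_eqI[of _ _ "\<lambda>i. \<lfloor>w $ i / \<epsilon>\<rfloor>"]) (auto simp: w(2) grid_def)
  qed
  show "finite ((\<lambda>f. \<chi> i. \<epsilon> * of_int (f i) :: real ^ 'n) ` (UNIV \<rightarrow>\<^sub>E {-M..M} :: ('n \<Rightarrow> int) set))"
    by (intro finite_imageI finite_PiE) auto
qed

lemma grid_cell_measurable [measurable]: "{w :: real ^ 'n::finite. grid \<epsilon> w = a} \<in> sets borel"
proof -
  have "{w :: real ^ 'n. grid \<epsilon> w = a} = (\<Inter>i. {w. \<epsilon> * of_int \<lfloor>w $ i / \<epsilon>\<rfloor> = a $ i})"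
    by (auto simp: grid_def vec_eq_iff)
  also have "\<dots> \<in> sets borel"
  proof (intro sets.finite_INT)
    fix i :: 'n
    have [measurable]: "(\<lambda>w :: real ^ 'n. w $ i) \<in> borel_measurable borel"
      by (intro borel_measurable_continuous_onI continuous_intros)
    show "{w :: real ^ 'n. \<epsilon> * of_int \<lfloor>w $ i / \<epsilon>\<rfloor> = a $ i} \<in> sets borel" by measurable
  qed auto
  finally show ?thesis .
qed

text \<open>A functional commutes with the integral because the translates of a Schwartz function depend
  continuously on the translation, so that Riemann sums converge in the Schwartz space.\<close>

lemma tempered_functional_translate_lipschitz:
  fixes f :: "real ^ 'n::finite \<Rightarrow> complex"
  assumes u: "tempered_functional u" and f: "f \<in> schwartz"
  obtains K where "0 \<le> K" "\<And>w w'. norm w' \<le> R \<Longrightarrow> norm (w - w') \<le> 1 \<Longrightarrow>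
    cmod (u (\<lambda>z. f (z - w)) - u (\<lambda>z. f (z - w'))) \<le> K * norm (w - w')"
proof -
  obtain C k m where C: "0 \<le> C" "\<And>f B. f \<in> schwartz \<Longrightarrow>
    (\<And>\<alpha> x. length \<alpha> \<le> m \<Longrightarrow> (1 + norm x) ^ k * cmod (iterated_deriv \<alpha> f x) \<le> B) \<Longrightarrow> cmod (u f) \<le> C * B"
    by (rule tempered_functionalE[OF u]) blast
  obtain M where M: "0 < M" "\<And>\<alpha> x v. length \<alpha> \<le> m \<Longrightarrow> norm v \<le> 1 \<Longrightarrow>
    cmod (iterated_deriv \<alpha> f (x + v) - iterated_deriv \<alpha> f x) \<le> M * norm v * (1 + norm x) powr -real k"
    by (rule schwartz_increment[OF f, of "real k" m]) (simp, blast)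
  have tr: "(\<lambda>z. f (z - w)) \<in> schwartz" for w using schwartz_affine[OF f, of 1 "-w"] by simp
  have dtr: "iterated_deriv \<alpha> (\<lambda>z. f (z - w)) = (\<lambda>z. iterated_deriv \<alpha> f (z - w))" for \<alpha> w
    using iterated_deriv_affine[OF schwartz_smooth[OF f], of \<alpha> 1 "-w"] by simp
  have "cmod (u (\<lambda>z. f (z - w)) - u (\<lambda>z. f (z - w'))) \<le> (C * ((1 + \<bar>R\<bar>) ^ k * M)) * norm (w - w')"
    if w': "norm w' \<le> R" and ww: "norm (w - w') \<le> 1" for w w'
  proof -
    have "cmod (u (\<lambda>z. f (z - w) - f (z - w'))) \<le> C * ((1 + \<bar>R\<bar>) ^ k * M * norm (w - w'))"
    proof (rule C(2))
      show "(\<lambda>z. f (z - w) - f (z - w')) \<in> schwartz" by (intro schwartz_diff tr)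
      fix \<alpha> :: "'n list" and z :: "real ^ 'n" assume \<alpha>: "length \<alpha> \<le> m"
      have "cmod (iterated_deriv \<alpha> (\<lambda>z. f (z - w) - f (z - w')) z) =
          cmod (iterated_deriv \<alpha> f ((z - w') + (w' - w)) - iterated_deriv \<alpha> f (z - w'))"
        unfolding iterated_deriv_diff[OF schwartz_smooth[OF tr] schwartz_smooth[OF tr]] dtr by simp
      also have "\<dots> \<le> M * norm (w - w') * (1 + norm (z - w')) powr -real k"
        using M(2)[OF \<alpha>, of "w' - w" "z - w'"] ww by (simp add: norm_minus_commute)
      finally have 1: "cmod (iterated_deriv \<alpha> (\<lambda>z. f (z - w) - f (z - w')) z) \<le>
        M * norm (w - w') * (1 + norm (z - w')) powr -real k" .
      have "1 + norm z \<le> (1 + norm w') * (1 + norm (z - w'))" by (rule one_plus_norm_le_mult)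
      also have "\<dots> \<le> (1 + \<bar>R\<bar>) * (1 + norm (z - w'))" using w' by (intro mult_right_mono) auto
      finally have "(1 + norm z) ^ k \<le> ((1 + \<bar>R\<bar>) * (1 + norm (z - w'))) ^ k" by (intro power_mono) auto
      then have "(1 + norm z) ^ k * cmod (iterated_deriv \<alpha> (\<lambda>z. f (z - w) - f (z - w')) z) \<le>
         ((1 + \<bar>R\<bar>) * (1 + norm (z - w'))) ^ k * (M * norm (w - w') * (1 + norm (z - w')) powr -real k)"
        using 1 by (intro mult_mono) auto
      also have "\<dots> = (1 + \<bar>R\<bar>) ^ k * M * norm (w - w')"
      proof -
        have pos: "0 < 1 + norm (z - w')" by (simp add: add_pos_nonneg)
        then show ?thesis by (simp add: powr_minus powr_realpow[OF pos] power_mult_distrib)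
      qed
      finally show "(1 + norm z) ^ k * cmod (iterated_deriv \<alpha> (\<lambda>z. f (z - w) - f (z - w')) z) \<le>
        (1 + \<bar>R\<bar>) ^ k * M * norm (w - w')" .
    qed
    then show ?thesis by (simp add: tempered_functional_diff[OF u tr tr] mult.assoc)
  qed
  moreover have "0 \<le> C * ((1 + \<bar>R\<bar>) ^ k * M)" using C(1) M(1) by simp
  ultimately show thesis using that by blast
qed

lemma continuous_tempered_functional_translate:
  fixes f :: "real ^ 'n::finite \<Rightarrow> complex"
  assumes u: "tempered_functional u" and f: "f \<in> schwartz"
  shows "continuous_on UNIV (\<lambda>w. u (\<lambda>z. f (z - w)))"
proof (intro continuous_at_imp_continuous_on ballI)
  fix w' :: "real ^ 'n"
  obtain K where K: "0 \<le> K" "\<And>v w. norm w \<le> norm w' \<Longrightarrow> norm (v - w) \<le> 1 \<Longrightarrow>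
    cmod (u (\<lambda>z. f (z - v)) - u (\<lambda>z. f (z - w))) \<le> K * norm (v - w)"
    by (rule tempered_functional_translate_lipschitz[OF u f, of "norm w'"]) blast
  have "((\<lambda>w. u (\<lambda>z. f (z - w)) - u (\<lambda>z. f (z - w'))) \<longlongrightarrow> 0) (at w')"
  proof (rule Lim_null_comparison)
    have "\<forall>\<^sub>F w in at w'. norm (w - w') < 1"
      unfolding eventually_at by (intro exI[of _ 1]) (auto simp: dist_norm)
    then show "\<forall>\<^sub>F w in at w'. cmod (u (\<lambda>z. f (z - w)) - u (\<lambda>z. f (z - w'))) \<le> K * norm (w - w')"
      by eventually_elim (intro K(2), auto)
    show "((\<lambda>w. K * norm (w - w')) \<longlongrightarrow> 0) (at w')"
      by (rule tendsto_eq_intros | simp)+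
  qed
  then show "isCont (\<lambda>w. u (\<lambda>z. f (z - w))) w'" unfolding isCont_def by (simp add: Lim_null[symmetric])
qed

text \<open>In the Riemann sum \<open>P\<close> the variable \<open>w\<close> is replaced by its
  grid point \<open>s w\<close>. Two errors arise, one between the integral and \<open>u P\<close>
  and one in the seminorms of \<open>P\<close> against \<open>conv h f\<close>. Both are at most a
  multiple of the mesh size, which then tends to 0.\<close>

lemma tempered_functional_conv:
  fixes f :: "real ^ 'n::finite \<Rightarrow> complex"
  assumes u: "tempered_functional u" and f: "f \<in> schwartz" and h [measurable]: "h \<in> borel_measurable borel"
    and hA: "\<And>w. cmod (h w) \<le> A" and supp: "\<And>w. R < norm w \<Longrightarrow> h w = 0"
  shows "(LINT w|lborel. h w * u (\<lambda>z. f (z - w))) = u (conv h f)"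
proof -
  define F where "F w = u (\<lambda>z. f (z - w))" for w
  have contF: "continuous_on UNIV F"
    unfolding F_def by (rule continuous_tempered_functional_translate[OF u f])
  then have [measurable]: "F \<in> borel_measurable borel" by (rule borel_measurable_continuous_onI)
  have A0: "0 \<le> A" by (rule order_trans[OF norm_ge_zero hA[of 0]])
  have tr: "(\<lambda>z. f (z - w)) \<in> schwartz" for w using schwartz_affine[OF f, of 1 "-w"] by simp
  have dtr: "iterated_deriv \<alpha> (\<lambda>z. f (z - w)) = (\<lambda>z. iterated_deriv \<alpha> f (z - w))" for \<alpha> w
    using iterated_deriv_affine[OF schwartz_smooth[OF f], of \<alpha> 1 "-w"] by simp
  have conv_s: "conv h f \<in> schwartz" by (rule schwartz_conv[OF f h hA supp])
  have int_ind: "integrable lborel (\<lambda>w :: real ^ 'n. A * indicator (cball 0 R) w)"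
    using emeasure_lborel_cball_finite[of "0 :: real ^ 'n" R]
    by (intro integrable_mult_right integrable_real_indicator) auto
  have h_ind: "cmod (h w) \<le> A * indicator (cball 0 R) w" for w
    using hA[of w] supp[of w] by (cases "norm w \<le> R") (auto simp: indicator_def)
  have int_h: "integrable lborel h"
    by (rule Bochner_Integration.integrable_bound[OF int_ind]) (use h_ind A0 in auto)
  obtain K where K: "0 \<le> K" "\<And>w w'. norm w' \<le> R \<Longrightarrow> norm (w - w') \<le> 1 \<Longrightarrow>
    cmod (F w - F w') \<le> K * norm (w - w')"
    unfolding F_def by (rule tempered_functional_translate_lipschitz[OF u f, of R]) blast
  obtain C k m where C: "0 \<le> C" "\<And>f B. f \<in> schwartz \<Longrightarrow>
    (\<And>\<alpha> x. length \<alpha> \<le> m \<Longrightarrow> (1 + norm x) ^ k * cmod (iterated_deriv \<alpha> f x) \<le> B) \<Longrightarrow> cmod (u f) \<le> C * B"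
    by (rule tempered_functionalE[OF u]) blast
  obtain M where M: "0 < M" "\<And>\<alpha> x v. length \<alpha> \<le> m \<Longrightarrow> norm v \<le> 1 \<Longrightarrow>
    cmod (iterated_deriv \<alpha> f (x + v) - iterated_deriv \<alpha> f x) \<le> M * norm v * (1 + norm x) powr -real k"
    by (rule schwartz_increment[OF f, of "real k" m]) (simp, blast)
  have bddF: "bounded (F ` cball 0 R)"
    by (intro compact_imp_bounded compact_continuous_image continuous_on_subset[OF contF]) auto
  then obtain BF where BF: "\<forall>w\<in>cball 0 R. cmod (F w) \<le> BF"
    by (auto simp: bounded_iff)
  have int_hF: "integrable lborel (\<lambda>w. h w * F w)"
  proof (rule Bochner_Integration.integrable_bound)
    show "integrable lborel (\<lambda>w. BF * norm (h w))" using int_h by simp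
    have "norm (h w * F w) \<le> norm (BF * norm (h w))" for w
    proof (cases "norm w \<le> R")
      case True
      then have "cmod (F w) \<le> \<bar>BF\<bar>" using BF by (simp add: order_trans[OF _ abs_ge_self])
      then have "cmod (h w) * cmod (F w) \<le> cmod (h w) * \<bar>BF\<bar>" by (intro mult_left_mono) auto
      then show ?thesis by (simp add: norm_mult mult.commute)
    qed (simp add: supp)
    then show "AE w in lborel. norm (h w * F w) \<le> norm (BF * norm (h w))" by simp
  qed measurable
  define I where "I = (LINT w|lborel. cmod (h w))"
  have I0: "0 \<le> I" unfolding I_def by (intro Bochner_Integration.integral_nonneg) auto
  let ?N = "real CARD('n)"
  have N: "0 < ?N" by simp
  have est: "cmod ((LINT w|lborel. h w * F w) - u (conv h f)) \<le> \<epsilon> * (K * I + C * ((1 + \<bar>R\<bar>) ^ k * M * I))"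
    if \<epsilon>: "0 < \<epsilon>" "\<epsilon> \<le> 1" for \<epsilon>
  proof -
    define s :: "real ^ 'n \<Rightarrow> real ^ 'n" where "s = grid (\<epsilon> / ?N)"
    define S where "S = s ` cball 0 R"
    have finS: "finite S" unfolding S_def s_def using \<epsilon> N by (intro finite_grid_image) simp
    have sw: "norm (w - s w) \<le> \<epsilon>" for w
      unfolding s_def using norm_diff_grid_le[of "\<epsilon> / ?N" w] \<epsilon> N by simp
    \<comment> \<open>The weight of a grid point is the integral of \<open>h\<close> over its cell
      and not a sampled value, since \<open>h\<close> is only measurable.\<close>
    define c where "c a = (LINT w|lborel. h w * indicator {w. s w = a} w)" for a
    have [measurable]: "{w. s w = a} \<in> sets borel" for a by (simp add: s_def)
    have int_c: "integrable lborel (\<lambda>w. h w * indicator {w. s w = a} w)" for a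
    proof -
      have "(\<lambda>w. h w * indicator {w. s w = a} w) = (\<lambda>w. indicator {w. s w = a} w *\<^sub>R h w)"
        by (auto simp: indicator_def fun_eq_iff)
      then show ?thesis using integrable_mult_indicator[OF _ int_h, of "{w. s w = a}"] by simp
    qed
    \<comment> \<open>An integrand that sees \<open>w\<close> only through \<open>s w\<close> is a
      finite combination of cell indicators times \<open>h\<close>. With \<open>G\<close> left free,
      this one identity yields both \<open>u P\<close> and all derivatives of
      \<open>P\<close>.\<close>
    have step: "h w * G (s w) = (\<Sum>a\<in>S. G a * (h w * indicator {w. s w = a} w))" for w and G :: "_ \<Rightarrow> complex"
    proof (cases "norm w \<le> R")
      case True
      then have "s w \<in> S" by (auto simp: S_def)
      have "(\<Sum>a\<in>S. G a * (h w * indicator {w. s w = a} w)) = (\<Sum>a\<in>S. if s w = a then G a * h w else 0)"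
        by (intro sum.cong) (auto simp: indicator_def)
      also have "\<dots> = G (s w) * h w" using finS \<open>s w \<in> S\<close> by simp
      finally show ?thesis by simp
    qed (simp add: supp)
    have int_step: "integrable lborel (\<lambda>w. h w * G (s w))" for G :: "_ \<Rightarrow> complex"
      unfolding step by (intro Bochner_Integration.integrable_sum integrable_mult_right int_c)
    have lint_step: "(LINT w|lborel. h w * G (s w)) = (\<Sum>a\<in>S. c a * G a)" for G :: "_ \<Rightarrow> complex"
      unfolding step c_def
      by (subst Bochner_Integration.integral_sum) (auto intro!: sum.cong int_c simp: mult.commute)
    define P where "P z = (\<Sum>a\<in>S. c a * f (z - a))" for z
    have Ps: "P \<in> schwartz" unfolding P_def by (intro schwartz_sum schwartz_cmult tr)
    have uP: "u P = (LINT w|lborel. h w * F (s w))"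
      unfolding P_def lint_step
      by (subst tempered_functional_sum[OF u]) (auto intro!: schwartz_cmult tr simp: tempered_functional_cmult[OF u tr] F_def)
    have dP: "iterated_deriv \<alpha> P z = (LINT w|lborel. h w * iterated_deriv \<alpha> f (z - s w))" for \<alpha> z
      unfolding P_def lint_step[of "\<lambda>a. iterated_deriv \<alpha> f (z - a)"]
      by (subst iterated_deriv_sum) (auto intro!: schwartz_cmult tr simp: iterated_deriv_cmult[OF schwartz_smooth[OF tr]] dtr)
    have "cmod ((LINT w|lborel. h w * F w) - u P) = cmod (LINT w|lborel. h w * F w - h w * F (s w))"
      unfolding uP using int_hF int_step[of F] by (simp add: Bochner_Integration.integral_diff)
    also have "\<dots> \<le> (LINT w|lborel. (K * \<epsilon>) * cmod (h w))"
    proof (rule norm_integral_le_integral)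
      show "integrable lborel (\<lambda>w. h w * F w - h w * F (s w))"
        by (intro Bochner_Integration.integrable_diff int_hF int_step)
      show "integrable lborel (\<lambda>w. (K * \<epsilon>) * cmod (h w))" using int_h by simp
      fix w
      show "cmod (h w * F w - h w * F (s w)) \<le> (K * \<epsilon>) * cmod (h w)"
      proof (cases "norm w \<le> R")
        case True
        have "cmod (F (s w) - F w) \<le> K * norm (s w - w)"
          using True sw[of w] \<epsilon> by (intro K(2)) (auto simp: norm_minus_commute)
        also have "\<dots> \<le> K * \<epsilon>" using sw[of w] K(1) by (intro mult_left_mono) (auto simp: norm_minus_commute)
        finally have "cmod (h w) * cmod (F w - F (s w)) \<le> cmod (h w) * (K * \<epsilon>)"
          by (intro mult_left_mono) (auto simp: norm_minus_commute)
        then show ?thesis by (simp add: norm_mult[symmetric] right_diff_distrib mult.commute)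
      qed (simp add: supp)
    qed
    also have "\<dots> = K * \<epsilon> * I" by (simp add: I_def)
    finally have 1: "cmod ((LINT w|lborel. h w * F w) - u P) \<le> K * \<epsilon> * I" .
    have "cmod (u (\<lambda>z. P z - conv h f z)) \<le> C * ((1 + \<bar>R\<bar>) ^ k * (M * \<epsilon> * I))"
    proof (rule C(2))
      show "(\<lambda>z. P z - conv h f z) \<in> schwartz" by (intro schwartz_diff Ps conv_s)
      fix \<alpha> :: "'n list" and z :: "real ^ 'n" assume \<alpha>: "length \<alpha> \<le> m"
      let ?W = "(1 + \<bar>R\<bar>) ^ k"
      have int1: "integrable lborel (\<lambda>w. h w * iterated_deriv \<alpha> f (z - w))"
        by (rule integrable_conv[OF schwartz_iterated_deriv[OF f] h hA])
      have "iterated_deriv \<alpha> (\<lambda>z. P z - conv h f z) z =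
         (LINT w|lborel. h w * iterated_deriv \<alpha> f (z - s w)) - (LINT w|lborel. h w * iterated_deriv \<alpha> f (z - w))"
        unfolding iterated_deriv_diff[OF schwartz_smooth[OF Ps] schwartz_smooth[OF conv_s]] dP
          iterated_deriv_conv[OF f h hA] by (simp add: conv_def)
      also have "\<dots> = (LINT w|lborel. h w * iterated_deriv \<alpha> f (z - s w) - h w * iterated_deriv \<alpha> f (z - w))"
        using int_step[of "\<lambda>a. iterated_deriv \<alpha> f (z - a)"] int1 by (simp add: Bochner_Integration.integral_diff)
      \<comment> \<open>The weight at \<open>z\<close> is brought under the integral, where for
        \<open>norm w \<le> R\<close> it can be compared with the weight at
        \<open>z - w\<close>.\<close>
      moreover have "cmod (of_real ((1 + norm z) ^ k)) = (1 + norm z) ^ k"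
        unfolding norm_of_real by simp
      ultimately have eq: "(1 + norm z) ^ k * cmod (iterated_deriv \<alpha> (\<lambda>z. P z - conv h f z) z) =
        cmod (LINT w|lborel. of_real ((1 + norm z) ^ k) * (h w * iterated_deriv \<alpha> f (z - s w) - h w * iterated_deriv \<alpha> f (z - w)))"
        by (simp only: integral_mult_right_zero norm_mult)
      also have "\<dots> \<le> (LINT w|lborel. (?W * (M * \<epsilon>)) * cmod (h w))"
      proof (rule norm_integral_le_integral)
        show "integrable lborel (\<lambda>w. of_real ((1 + norm z) ^ k) * (h w * iterated_deriv \<alpha> f (z - s w) - h w * iterated_deriv \<alpha> f (z - w)))"
          by (intro integrable_mult_right Bochner_Integration.integrable_diff int1 int_step[of "\<lambda>a. iterated_deriv \<alpha> f (z - a)"])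
        show "integrable lborel (\<lambda>w. (?W * (M * \<epsilon>)) * cmod (h w))" using int_h by simp
        fix w
        show "cmod (of_real ((1 + norm z) ^ k) * (h w * iterated_deriv \<alpha> f (z - s w) - h w * iterated_deriv \<alpha> f (z - w)))
          \<le> (?W * (M * \<epsilon>)) * cmod (h w)"
        proof (cases "norm w \<le> R")
          case True
          have pos: "0 < 1 + norm (z - w)" by (simp add: add_pos_nonneg)
          have "cmod (iterated_deriv \<alpha> f ((z - w) + (w - s w)) - iterated_deriv \<alpha> f (z - w)) \<le>
              M * norm (w - s w) * (1 + norm (z - w)) powr -real k"
            using sw[of w] \<epsilon> by (intro M(2) \<alpha>) auto
          also have "\<dots> \<le> M * \<epsilon> * (1 + norm (z - w)) powr -real k"
            using sw[of w] M(1) by (intro mult_right_mono mult_left_mono) auto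
          finally have d: "cmod (iterated_deriv \<alpha> f (z - s w) - iterated_deriv \<alpha> f (z - w)) \<le>
            M * \<epsilon> * (1 + norm (z - w)) powr -real k" by simp
          have "1 + norm z \<le> (1 + norm w) * (1 + norm (z - w))" by (rule one_plus_norm_le_mult)
          also have "\<dots> \<le> (1 + \<bar>R\<bar>) * (1 + norm (z - w))" using True by (intro mult_right_mono) auto
          finally have "(1 + norm z) ^ k \<le> ((1 + \<bar>R\<bar>) * (1 + norm (z - w))) ^ k" by (intro power_mono) auto
          then have "(1 + norm z) ^ k * cmod (iterated_deriv \<alpha> f (z - s w) - iterated_deriv \<alpha> f (z - w)) \<le>
            ((1 + \<bar>R\<bar>) * (1 + norm (z - w))) ^ k * (M * \<epsilon> * (1 + norm (z - w)) powr -real k)"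
            using d by (intro mult_mono) auto
          also have "\<dots> = ?W * (M * \<epsilon>)"
            using pos by (simp add: powr_minus powr_realpow[OF pos] power_mult_distrib)
          finally have "cmod (h w) * ((1 + norm z) ^ k * cmod (iterated_deriv \<alpha> f (z - s w) - iterated_deriv \<alpha> f (z - w)))
            \<le> cmod (h w) * (?W * (M * \<epsilon>))" by (intro mult_left_mono) auto
          moreover have "cmod (of_real ((1 + norm z) ^ k) * (h w * iterated_deriv \<alpha> f (z - s w) - h w * iterated_deriv \<alpha> f (z - w))) =
            cmod (h w) * ((1 + norm z) ^ k * cmod (iterated_deriv \<alpha> f (z - s w) - iterated_deriv \<alpha> f (z - w)))"
            unfolding right_diff_distrib[symmetric] norm_mult norm_of_real by simp
          ultimately show ?thesis by (simp only: mult.commute)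
        qed (simp add: supp)
      qed
      also have "\<dots> = ?W * (M * \<epsilon> * I)" by (simp add: I_def)
      finally show "(1 + norm z) ^ k * cmod (iterated_deriv \<alpha> (\<lambda>z. P z - conv h f z) z) \<le> ?W * (M * \<epsilon> * I)" .
    qed
    then have 2: "cmod (u P - u (conv h f)) \<le> C * ((1 + \<bar>R\<bar>) ^ k * (M * \<epsilon> * I))"
      by (simp add: tempered_functional_diff[OF u Ps conv_s])
    have "cmod ((LINT w|lborel. h w * F w) - u (conv h f)) \<le>
        cmod ((LINT w|lborel. h w * F w) - u P) + cmod (u P - u (conv h f))"
      using norm_triangle_ineq[of "(LINT w|lborel. h w * F w) - u P" "u P - u (conv h f)"] by simp
    then show ?thesis using 1 2 by (simp add: algebra_simps)
  qed
  define Q where "Q = K * I + C * ((1 + \<bar>R\<bar>) ^ k * M * I)"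
  have Q0: "0 \<le> Q" using K(1) C(1) M(1) I0 by (simp add: Q_def)
  have "cmod ((LINT w|lborel. h w * F w) - u (conv h f)) \<le> 0"
  proof (rule field_le_epsilon)
    fix e :: real assume e: "0 < e"
    \<comment> \<open>The summand 1 avoids a division by zero, as \<open>Q\<close> may
      vanish.\<close>
    define \<epsilon> where "\<epsilon> = min 1 (e / (Q + 1))"
    have "0 < \<epsilon>" "\<epsilon> \<le> 1" "\<epsilon> \<le> e / (Q + 1)" using e Q0 by (auto simp: \<epsilon>_def)
    then have "cmod ((LINT w|lborel. h w * F w) - u (conv h f)) \<le> \<epsilon> * Q" unfolding Q_def by (intro est)
    also have "\<dots> \<le> e / (Q + 1) * Q" using \<open>\<epsilon> \<le> e / (Q + 1)\<close> Q0 by (rule mult_right_mono)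
    also have "\<dots> \<le> e" using e Q0 by (simp add: field_simps)
    finally show "cmod ((LINT w|lborel. h w * F w) - u (conv h f)) \<le> 0 + e" by simp
  qed
  then show ?thesis by (simp add: F_def)
qed

section \<open>Localisation to unit cells\<close>

text \<open>After division by the sum, both terms lie in the unit interval, where
  \<open>z \<le> z powr q\<close> because \<open>q \<le> 1\<close>.\<close>

lemma sum_powr_le:
  fixes a :: "'b \<Rightarrow> real"
  assumes "\<And>i. i \<in> S \<Longrightarrow> 0 \<le> a i" "0 < q" "q \<le> 1"
  shows "(\<Sum>i\<in>S. a i) powr q \<le> (\<Sum>i\<in>S. a i powr q)"
proof -
  have two: "(x + y) powr q \<le> x powr q + y powr q" if "0 \<le> x" "0 \<le> y" for x y :: real
  proof (cases "x + y = 0")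
    case False
    then have s: "0 < x + y" using that by simp
    have le: "z / (x + y) \<le> (z / (x + y)) powr q" if "0 \<le> z" "z \<le> x + y" for z
      using that s assms powr_mono'[of q 1 "z / (x + y)"] by (cases "z = 0") auto
    have "1 = x / (x + y) + y / (x + y)" using s by (simp add: add_divide_distrib[symmetric])
    also have "\<dots> \<le> (x / (x + y)) powr q + (y / (x + y)) powr q"
      using that by (intro add_mono le) auto
    also have "\<dots> = (x powr q + y powr q) / (x + y) powr q"
      using that s by (simp add: powr_divide add_divide_distrib)
    finally show ?thesis using s by (simp add: field_simps)
  qed (use that in simp)
  show ?thesis using assms(1)
  proof (induction S rule: infinite_finite_induct)
    case (insert i S)
    then show ?case
      using two[of "a i" "sum a S"] by (auto simp: sum_nonneg intro: order_trans)
  qed auto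
qed

lemma schwartz_mult:
  fixes f g :: "real ^ 'n::finite \<Rightarrow> complex"
  assumes f: "f \<in> schwartz" and g: "g \<in> schwartz"
  shows "(\<lambda>x. f x * g x) \<in> schwartz"
proof (rule schwartzI)
  note sm = schwartz_smooth[OF f] schwartz_smooth[OF g]
  show "smooth (\<lambda>x. f x * g x)" by (rule smooth_mult[OF sm])
  fix k and \<alpha> :: "'n list"
  obtain A where A: "0 < A" "\<And>\<beta> x. length \<beta> \<le> length \<alpha> \<Longrightarrow> cmod (iterated_deriv \<beta> f x) \<le> A * (1 + norm x) powr -real k"
    by (rule schwartz_decay[OF f]) blast
  obtain B where B: "0 < B" "\<And>\<beta> x. length \<beta> \<le> length \<alpha> \<Longrightarrow> cmod (iterated_deriv \<beta> g x) \<le> B * (1 + norm x) powr -0"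
    by (rule schwartz_decay[OF g]) blast
  have "(1 + norm x) ^ k * cmod (iterated_deriv \<alpha> (\<lambda>x. f x * g x) x) \<le> 2 ^ length \<alpha> * (A * B)" for x
  proof -
    have pos: "0 < 1 + norm x" by (simp add: add_pos_nonneg)
    have "cmod (iterated_deriv \<alpha> (\<lambda>x. f x * g x) x) \<le> 2 ^ length \<alpha> * ((A * (1 + norm x) powr -real k) * (B * (1 + norm x) powr -0))"
      by (rule iterated_deriv_mult_bound[OF sm A(2) B(2)])
    then have "(1 + norm x) ^ k * cmod (iterated_deriv \<alpha> (\<lambda>x. f x * g x) x) \<le>
       (1 + norm x) ^ k * (2 ^ length \<alpha> * ((A * (1 + norm x) powr -real k) * (B * (1 + norm x) powr -0)))"
      by (rule mult_left_mono) simp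
    also have "\<dots> = 2 ^ length \<alpha> * (A * B)"
      using pos by (simp add: powr_minus powr_realpow[OF pos])
    finally show ?thesis .
  qed
  then show "\<exists>C. \<forall>x. (1 + norm x) ^ k * cmod (iterated_deriv \<alpha> (\<lambda>x. f x * g x) x) \<le> C" by blast
qed

text \<open>A smooth partition of unity: indicators of unit cubes mollified by
  \<open>\<beta>\<close>, adding up to 1 if \<open>\<beta>\<close> has integral 1. The cells are
  rapidly decreasing away from \<open>k\<close>, which replaces compact support, so a frequency
  cutoff can serve as \<open>\<beta>\<close>.\<close>

definition cell :: "(real ^ 'n::finite \<Rightarrow> complex) \<Rightarrow> real ^ 'n \<Rightarrow> real ^ 'n \<Rightarrow> complex" where
  "cell \<beta> k = conv (indicator {w. grid 1 w = k}) \<beta>"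

lemma norm_indicator_le_one: "cmod (indicator S w) \<le> 1"
  by (simp add: indicator_def)

lemma cell_schwartz:
  fixes \<beta> :: "real ^ 'n::finite \<Rightarrow> complex"
  assumes \<beta>: "\<beta> \<in> schwartz" shows "cell \<beta> k \<in> schwartz"
  unfolding cell_def
proof (rule schwartz_conv[OF \<beta>, where R = "norm k + real CARD('n)"])
  fix w :: "real ^ 'n" assume w: "norm k + real CARD('n) < norm w"
  have "norm (w - grid 1 w) \<le> real CARD('n)" using norm_diff_grid_le[of 1 w] by simp
  moreover have "norm w \<le> norm (grid 1 w) + norm (w - grid 1 w)"
    using norm_triangle_ineq[of "grid 1 w" "w - grid 1 w"] by simp
  ultimately show "indicator {w. grid 1 w = k} w = (0 :: complex)" using w by (auto simp: indicator_def)
qed (auto intro: norm_indicator_le_one)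

text \<open>The cell decays at order \<open>L + \<kappa>\<close>. The share \<kappa> pays, by
  Peetre's inequality, for replacing the weight at \<open>x\<close> by the weight at
  \<open>k\<close>, and the share \<open>L\<close> remains as localisation. The constant depends on
  neither \<open>g\<close> nor \<open>k\<close>.\<close>

lemma cell_localization:
  fixes \<beta> :: "real ^ 'n::finite \<Rightarrow> complex"
  assumes \<beta>: "\<beta> \<in> schwartz" and \<kappa>: "0 \<le> \<kappa>" and L: "0 \<le> L"
  obtains C where "0 < C" "\<And>g B k. g \<in> schwartz \<Longrightarrow>
    \<forall>\<alpha> x. length \<alpha> \<le> m \<longrightarrow> cmod (iterated_deriv \<alpha> g x) \<le> B * (1 + norm x) powr -\<kappa> \<Longrightarrow>
    \<forall>\<alpha> x. length \<alpha> \<le> m \<longrightarrow> cmod (iterated_deriv \<alpha> (\<lambda>x. g x * cell \<beta> k x) x) \<le>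
      C * B * (1 + norm k) powr -\<kappa> * (1 + norm (x - k)) powr -L"
proof -
  let ?s = "L + \<kappa>"
  obtain C1 where C1: "0 < C1" "\<And>h A D a \<alpha> x. h \<in> borel_measurable borel \<Longrightarrow>
    (\<And>w. cmod (h w) \<le> D) \<Longrightarrow> (\<And>w. cmod (h w) \<le> A * (1 + norm (w - a)) powr -?s) \<Longrightarrow> length \<alpha> \<le> m \<Longrightarrow>
    cmod (iterated_deriv \<alpha> (conv h \<beta>) x) \<le> A * C1 * (1 + norm (x - a)) powr -?s"
    by (rule conv_decay[OF \<beta>, where m=m and s="?s"]) blast
  define A where "A = (1 + real CARD('n)) powr ?s"
  have main: "\<forall>\<alpha> x. length \<alpha> \<le> m \<longrightarrow> cmod (iterated_deriv \<alpha> (\<lambda>x. g x * cell \<beta> k x) x) \<le>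
      2 ^ m * (A * C1) * B * (1 + norm k) powr -\<kappa> * (1 + norm (x - k)) powr -L"
    if g: "g \<in> schwartz"
    and B: "\<forall>\<alpha> x. length \<alpha> \<le> m \<longrightarrow> cmod (iterated_deriv \<alpha> g x) \<le> B * (1 + norm x) powr -\<kappa>" for g B k
  proof -
    have B0: "0 \<le> B" using order_trans[OF norm_ge_zero B[rule_format, of "[]" 0]] by simp
    have cell_bd: "cmod (iterated_deriv \<alpha> (cell \<beta> k) x) \<le> A * C1 * (1 + norm (x - k)) powr -?s"
      if "length \<alpha> \<le> m" for \<alpha> x
      unfolding cell_def
    proof (rule C1(2)[OF _ norm_indicator_le_one _ that])
      fix w :: "real ^ 'n"
      have "1 \<le> A * (1 + norm (w - k)) powr -?s" if "grid 1 w = k"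
      proof -
        have "norm (w - k) \<le> real CARD('n)" using norm_diff_grid_le[of 1 w] that by simp
        then have "(1 + norm (w - k)) powr ?s \<le> A" unfolding A_def using \<kappa> L by (intro powr_mono2) auto
        moreover have "0 < (1 + norm (w - k)) powr ?s" by (simp add: add_nonneg_eq_0_iff)
        ultimately show ?thesis unfolding powr_minus by (simp add: field_simps)
      qed
      then show "cmod (indicator {w. grid 1 w = k} w) \<le> A * (1 + norm (w - k)) powr -?s"
        by (auto simp: indicator_def A_def)
    qed auto
    show ?thesis
    proof (intro allI impI)
      fix \<alpha> :: "'n list" and x :: "real ^ 'n"
      assume \<alpha>: "length \<alpha> \<le> m"
      have "cmod (iterated_deriv \<alpha> (\<lambda>x. g x * cell \<beta> k x) x) \<le>
          2 ^ length \<alpha> * ((B * (1 + norm x) powr -\<kappa>) * (A * C1 * (1 + norm (x - k)) powr -?s))"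
        using \<alpha> B by (intro iterated_deriv_mult_bound schwartz_smooth g cell_schwartz \<beta> cell_bd) auto
      also have "\<dots> \<le> 2 ^ m * ((B * ((1 + norm k) powr -\<kappa> * (1 + norm (x - k)) powr \<kappa>)) * (A * C1 * (1 + norm (x - k)) powr -?s))"
        using one_plus_norm_powr_le[of x \<kappa> k] \<alpha> B0 \<kappa> C1(1)
        by (intro mult_mono) (auto simp: A_def norm_minus_commute)
      also have "\<dots> = 2 ^ m * (A * C1) * B * (1 + norm k) powr -\<kappa> * ((1 + norm (x - k)) powr \<kappa> * (1 + norm (x - k)) powr -?s)"
        by (simp add: ac_simps)
      also have "(1 + norm (x - k)) powr \<kappa> * (1 + norm (x - k)) powr -?s = (1 + norm (x - k)) powr -L"
        by (simp add: powr_add[symmetric])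
      finally show "cmod (iterated_deriv \<alpha> (\<lambda>x. g x * cell \<beta> k x) x) \<le>
        2 ^ m * (A * C1) * B * (1 + norm k) powr -\<kappa> * (1 + norm (x - k)) powr -L" .
    qed
  qed
  have "0 < 2 ^ m * (A * C1)" using C1(1) by (simp add: A_def)
  from that[OF this main] show thesis .
qed

text \<open>The remainder is \<open>g x * conv h \<beta> x\<close>, where \<open>h\<close> is
  bounded by 1 and vanishes on the ball of radius \<open>M\<close>. Hence \<open>h w\<close> is at
  most \<open>(1 + norm w) / (1 + M)\<close>: linear growth is accepted in exchange for a small
  factor, and one extra power of decay of \<open>g\<close> absorbs the growth.\<close>

lemma tempered_functional_cell_tail:
  fixes \<beta> :: "real ^ 'n::finite \<Rightarrow> complex"
  assumes u: "tempered_functional u" and \<beta>: "\<beta> \<in> schwartz" and one: "(LINT w|lborel. \<beta> w) = 1" and g: "g \<in> schwartz"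
  obtains C where "0 \<le> C" "\<And>M. 0 \<le> M \<Longrightarrow>
    cmod (u g - (\<Sum>k\<in>grid 1 ` cball 0 M. u (\<lambda>x. g x * cell \<beta> k x))) \<le> C / (1 + M)"
proof -
  obtain Cu j m where Cu: "0 \<le> Cu" "\<And>f B. f \<in> schwartz \<Longrightarrow>
    (\<And>\<alpha> x. length \<alpha> \<le> m \<Longrightarrow> (1 + norm x) ^ j * cmod (iterated_deriv \<alpha> f x) \<le> B) \<Longrightarrow> cmod (u f) \<le> Cu * B"
    by (rule tempered_functionalE[OF u]) blast
  \<comment> \<open>The exponent \<open>-(-1)\<close> fits a linearly growing weight into the
    pattern of \<open>conv_decay\<close>.\<close>
  obtain C1 where C1: "0 < C1" "\<And>h A D a \<alpha> x. h \<in> borel_measurable borel \<Longrightarrow>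
    (\<And>w. cmod (h w) \<le> D) \<Longrightarrow> (\<And>w. cmod (h w) \<le> A * (1 + norm (w - a)) powr -(-1)) \<Longrightarrow> length \<alpha> \<le> m \<Longrightarrow>
    cmod (iterated_deriv \<alpha> (conv h \<beta>) x) \<le> A * C1 * (1 + norm (x - a)) powr -(-1)"
    by (rule conv_decay[OF \<beta>, where m=m and s="-1"]) blast
  obtain Cg where Cg: "0 < Cg" "\<And>\<alpha> x. length \<alpha> \<le> m \<Longrightarrow> cmod (iterated_deriv \<alpha> g x) \<le> Cg * (1 + norm x) powr -real (Suc j)"
    by (rule schwartz_decay[OF g]) blast
  have "cmod (u g - (\<Sum>k\<in>grid 1 ` cball 0 M. u (\<lambda>x. g x * cell \<beta> k x))) \<le> (Cu * (2 ^ m * (Cg * C1))) / (1 + M)"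
    if M: "0 \<le> M" for M
  proof -
    define S where "S = grid 1 ` cball (0 :: real ^ 'n) M"
    have fin: "finite S" unfolding S_def by (rule finite_grid_image) simp
    define h :: "real ^ 'n \<Rightarrow> complex" where "h w = 1 - (\<Sum>k\<in>S. indicator {w. grid 1 w = k} w)" for w
    have [measurable]: "h \<in> borel_measurable borel" unfolding h_def by measurable
    have sum_ind: "(\<Sum>k\<in>S. indicator {w. grid 1 w = k} w) = (indicator S (grid 1 w) :: complex)" for w
    proof -
      have "(\<Sum>k\<in>S. indicator {w. grid 1 w = k} w) = (\<Sum>k\<in>S. if grid 1 w = k then 1 else 0 :: complex)"
        by (intro sum.cong) (auto simp: indicator_def)
      then show ?thesis using fin by (simp add: indicator_def)
    qed
    have h1: "cmod (h w) \<le> 1" for w unfolding h_def sum_ind by (simp add: indicator_def)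
    have hM: "cmod (h w) \<le> (1 / (1 + M)) * (1 + norm (w - 0)) powr -(-1)" for w
    proof (cases "norm w \<le> M")
      case True
      then have "grid 1 w \<in> S" by (auto simp: S_def)
      then have "h w = 0" unfolding h_def sum_ind by simp
      then show ?thesis using M by simp
    next
      case False
      then have "1 \<le> (1 / (1 + M)) * (1 + norm w)" using M by (simp add: field_simps)
      then show ?thesis using h1[of w] by simp
    qed
    have int1: "integrable lborel (\<lambda>w. 1 * \<beta> (x - w))" for x
      by (rule integrable_conv[OF \<beta>, where A=1]) auto
    have int2: "integrable lborel (\<lambda>w. indicator {w. grid 1 w = k} w * \<beta> (x - w))" for x k
      by (rule integrable_conv[OF \<beta> _ norm_indicator_le_one]) measurable
    have conv_h: "conv h \<beta> x = 1 - (\<Sum>k\<in>S. cell \<beta> k x)" for x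
    proof -
      have "conv h \<beta> x = (LINT w|lborel. 1 * \<beta> (x - w) - (\<Sum>k\<in>S. indicator {w. grid 1 w = k} w * \<beta> (x - w)))"
        unfolding conv_def h_def by (simp add: left_diff_distrib sum_distrib_right)
      also have "\<dots> = (LINT w|lborel. 1 * \<beta> (x - w)) - (\<Sum>k\<in>S. cell \<beta> k x)"
        unfolding cell_def conv_def
        using int1 int2 by (subst Bochner_Integration.integral_diff)
          (auto intro!: Bochner_Integration.integrable_sum Bochner_Integration.integral_sum)
      also have "(LINT w|lborel. 1 * \<beta> (x - w)) = 1"
        using integral_lborel_reflect[of \<beta> x] one by simp
      finally show ?thesis .
    qed
    have gs: "(\<lambda>x. g x * cell \<beta> k x) \<in> schwartz" for k by (intro schwartz_mult g cell_schwartz \<beta>)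
    have rest: "(\<lambda>x. g x - (\<Sum>k\<in>S. g x * cell \<beta> k x)) \<in> schwartz"
      by (intro schwartz_diff g schwartz_sum gs)
    have rest_eq: "(\<lambda>x. g x - (\<Sum>k\<in>S. g x * cell \<beta> k x)) = (\<lambda>x. g x * conv h \<beta> x)"
      by (simp add: conv_h right_diff_distrib sum_distrib_left)
    have "cmod (u (\<lambda>x. g x - (\<Sum>k\<in>S. g x * cell \<beta> k x))) \<le> Cu * (2 ^ m * (Cg * ((1 / (1 + M)) * C1)))"
    proof (rule Cu(2)[OF rest])
      fix \<alpha> :: "'n list" and x :: "real ^ 'n" assume \<alpha>: "length \<alpha> \<le> m"
      have pos: "0 < 1 + norm x" by (simp add: add_pos_nonneg)
      have cv: "cmod (iterated_deriv \<beta>' (conv h \<beta>) x) \<le> (1 / (1 + M)) * C1 * (1 + norm x)" if "length \<beta>' \<le> m" for \<beta>'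
        using C1(2)[OF _ h1 hM that, of x] by simp
      have "cmod (iterated_deriv \<alpha> (\<lambda>x. g x * conv h \<beta> x) x) \<le>
         2 ^ length \<alpha> * ((Cg * (1 + norm x) powr -real (Suc j)) * ((1 / (1 + M)) * C1 * (1 + norm x)))"
        using \<alpha> by (intro iterated_deriv_mult_bound schwartz_smooth g smooth_conv[OF \<beta> _ h1] Cg(2) cv) auto
      also have "\<dots> \<le> 2 ^ m * ((Cg * (1 + norm x) powr -real (Suc j)) * ((1 / (1 + M)) * C1 * (1 + norm x)))"
        using \<alpha> Cg(1) C1(1) M by (intro mult_right_mono) auto
      finally have "(1 + norm x) ^ j * cmod (iterated_deriv \<alpha> (\<lambda>x. g x * conv h \<beta> x) x) \<le>
        (1 + norm x) ^ j * (2 ^ m * ((Cg * (1 + norm x) powr -real (Suc j)) * ((1 / (1 + M)) * C1 * (1 + norm x))))"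
        by (rule mult_left_mono) simp
      also have "\<dots> = 2 ^ m * (Cg * ((1 / (1 + M)) * C1)) * ((1 + norm x) ^ Suc j * (1 + norm x) powr -real (Suc j))"
        by (simp add: ac_simps)
      also have "(1 + norm x) ^ Suc j * (1 + norm x) powr -real (Suc j) = 1"
        using pos by (subst powr_minus, subst powr_realpow[OF pos]) (simp del: power_Suc)
      finally show "(1 + norm x) ^ j * cmod (iterated_deriv \<alpha> (\<lambda>x. g x - (\<Sum>k\<in>S. g x * cell \<beta> k x)) x) \<le>
        2 ^ m * (Cg * ((1 / (1 + M)) * C1))" unfolding rest_eq by simp
    qed
    then show ?thesis
      by (simp add: tempered_functional_diff[OF u g schwartz_sum[OF gs]] tempered_functional_sum[OF u gs] S_def field_simps)
  qed
  moreover have "0 \<le> Cu * (2 ^ m * (Cg * C1))" using Cu(1) Cg(1) C1(1) by simp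
  ultimately show thesis using that by blast
qed

section \<open>Localised functions and the grand maximal function\<close>

lemma dilate_reflect_eq:
  fixes f :: "real ^ 'n::finite \<Rightarrow> complex"
  shows "(\<lambda>y. dilate t f (x - y)) = (\<lambda>y. of_real (1 / t ^ CARD('n)) * f ((- 1 / t) *\<^sub>R y + x /\<^sub>R t))"
  by (auto simp: dilate_def fun_eq_iff scaleR_conv_of_real divide_inverse algebra_simps)

lemma tempered_functional_dilate_reflect:
  fixes u :: "(real ^ 'n::finite \<Rightarrow> complex) \<Rightarrow> complex"
  assumes u: "tempered_functional u" and t: "0 < t"
  obtains v where "tempered_functional v" "\<And>f. f \<in> schwartz \<Longrightarrow> u (\<lambda>y. dilate t f (x - y)) = v f"
proof
  show "tempered_functional (\<lambda>f. of_real (1 / t ^ CARD('n)) * u (\<lambda>z. f ((- 1 / t) *\<^sub>R z + x /\<^sub>R t)))"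
    using t by (intro tempered_functional_affine u) auto
  fix f :: "real ^ 'n \<Rightarrow> complex" assume "f \<in> schwartz"
  then have "(\<lambda>z. f ((- 1 / t) *\<^sub>R z + x /\<^sub>R t)) \<in> schwartz" using t by (intro schwartz_affine) auto
  then show "u (\<lambda>y. dilate t f (x - y)) = of_real (1 / t ^ CARD('n)) * u (\<lambda>z. f ((- 1 / t) *\<^sub>R z + x /\<^sub>R t))"
    unfolding dilate_reflect_eq by (rule tempered_functional_cmult[OF u])
qed

text \<open>After translation by \<open>k\<close> and division by \<open>B\<close> the function is
  admissible, and the base point becomes \<open>x - t *\<^sub>R k\<close>. Every \<open>z\<close>
  within distance \<open>t\<close> of that point reaches the value through the nontangential
  supremum.\<close>

lemma localized_le_grand_maximal:
  fixes f :: "real ^ 'n::finite \<Rightarrow> complex"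
  assumes u: "tempered_functional u" and f: "f \<in> schwartz" and B: "0 < B" and t: "0 < t"
    and fB: "\<And>\<alpha> x. length \<alpha> \<le> N + 1 \<Longrightarrow>
      cmod (iterated_deriv \<alpha> f x) \<le> B * (1 + norm (x - k)) powr -real (N + CARD('n) + 1)"
    and z: "norm (x - t *\<^sub>R k - z) < t"
  shows "ennreal (cmod (u (\<lambda>y. dilate t f (x - y)))) \<le> ennreal B * grand_maximal N u z"
proof -
  define \<phi> where "\<phi> v = of_real (1 / B) * f (v + k)" for v
  have fk: "(\<lambda>v. f (v + k)) \<in> schwartz" using schwartz_affine[OF f, of 1 k] by simp
  have \<phi>s: "\<phi> \<in> schwartz" unfolding \<phi>_def by (intro schwartz_cmult fk)
  have d\<phi>: "iterated_deriv \<alpha> \<phi> v = of_real (1 / B) * iterated_deriv \<alpha> f (v + k)" for \<alpha> v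
    unfolding \<phi>_def iterated_deriv_cmult[OF schwartz_smooth[OF fk]]
    using iterated_deriv_affine[OF schwartz_smooth[OF f], of \<alpha> 1 k] by simp
  have "schwartz_seminorm (N + CARD('n) + 1) (N + 1) \<phi> \<le> 1"
  proof (rule schwartz_seminorm_le)
    fix \<alpha> :: "'n list" and v :: "real ^ 'n" assume \<alpha>: "length \<alpha> \<le> N + 1"
    have pos: "0 < 1 + norm v" by (simp add: add_pos_nonneg)
    have "(1 + norm v) ^ (N + CARD('n) + 1) * cmod (iterated_deriv \<alpha> \<phi> v) =
        (1 + norm v) ^ (N + CARD('n) + 1) * (1 / B * cmod (iterated_deriv \<alpha> f (v + k)))"
      using B by (simp add: d\<phi> norm_mult norm_divide)
    also have "\<dots> \<le> (1 + norm v) ^ (N + CARD('n) + 1) * (1 / B * (B * (1 + norm v) powr -real (N + CARD('n) + 1)))"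
      using fB[OF \<alpha>, of "v + k"] B by (intro mult_left_mono) auto
    also have "\<dots> = (1 + norm v) ^ (N + CARD('n) + 1) * (1 + norm v) powr -real (N + CARD('n) + 1)"
      using B by simp
    also have "\<dots> = 1"
      unfolding powr_minus powr_realpow[OF pos] using pos by (intro right_inverse) simp
    finally show "(1 + norm v) ^ (N + CARD('n) + 1) * cmod (iterated_deriv \<alpha> \<phi> v) \<le> 1" .
  qed
  then have \<phi>g: "\<phi> \<in> grand_test_functions N" using \<phi>s by (simp add: grand_test_functions_def)
  have fs: "(\<lambda>y. dilate t f (x - y)) \<in> schwartz"
    unfolding dilate_reflect_eq using t by (intro schwartz_cmult schwartz_affine f) auto
  have "dilate t \<phi> (x - t *\<^sub>R k - y) = of_real (1 / B) * dilate t f (x - y)" for y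
  proof -
    have "(x - t *\<^sub>R k - y) /\<^sub>R t + k = (x - y) /\<^sub>R t" using t by (simp add: algebra_simps)
    then show ?thesis by (simp add: dilate_def \<phi>_def)
  qed
  then have dc: "distr_convolution (dilate t \<phi>) u (x - t *\<^sub>R k) = of_real (1 / B) * u (\<lambda>y. dilate t f (x - y))"
    unfolding distr_convolution_def by (simp only: tempered_functional_cmult[OF u fs])
  have "ennreal (cmod (distr_convolution (dilate t \<phi>) u (x - t *\<^sub>R k))) \<le> grand_maximal N u z"
    unfolding grand_maximal_def using z
    by (intro SUP_upper2[OF \<phi>g] SUP_upper2[of "(x - t *\<^sub>R k, t)"]) auto
  then have "ennreal B * ennreal (1 / B * cmod (u (\<lambda>y. dilate t f (x - y)))) \<le> ennreal B * grand_maximal N u z"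
    unfolding dc using B by (intro mult_left_mono) (auto simp: norm_mult norm_divide)
  moreover have "ennreal B * ennreal (1 / B * cmod (u (\<lambda>y. dilate t f (x - y)))) = ennreal (cmod (u (\<lambda>y. dilate t f (x - y))))"
    using B by (subst ennreal_mult[symmetric]) auto
  ultimately show ?thesis by simp
qed

lemma grid_separated:
  fixes k k' :: "real ^ 'n::finite"
  assumes "k \<in> range (grid 1)" "k' \<in> range (grid 1)" "k \<noteq> k'"
  shows "1 \<le> norm (k - k')"
proof -
  obtain w w' where w: "k = grid 1 w" "k' = grid 1 w'" using assms by auto
  obtain i where i: "k $ i \<noteq> k' $ i" using assms(3) by (auto simp: vec_eq_iff)
  have "(k - k') $ i = of_int (\<lfloor>w $ i\<rfloor> - \<lfloor>w' $ i\<rfloor>)" by (simp add: w grid_def)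
  moreover have "\<lfloor>w $ i\<rfloor> - \<lfloor>w' $ i\<rfloor> \<noteq> 0" using i by (simp add: w grid_def)
  ultimately have "1 \<le> \<bar>(k - k') $ i\<bar>" by linarith
  then show ?thesis using component_le_norm_cart[of "k - k'" i] by simp
qed

lemma measurable_lebesgue_ball: "ball x r \<in> sets (lebesgue :: 'a::euclidean_space measure)"
  by simp

text \<open>By \<open>grid_separated\<close> distinct centres are at distance at least
  \<open>t\<close>, so the balls are disjoint and at most one term is nonzero.\<close>

lemma separated_balls_sum_le:
  fixes x :: "real ^ 'n::finite"
  assumes "0 < t" "finite S" "S \<subseteq> range (grid 1)" "0 \<le> E"
    and le: "\<And>k. k \<in> S \<Longrightarrow> z \<in> ball (x - t *\<^sub>R k) (t / 2) \<Longrightarrow> a k \<le> E"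
  shows "(\<Sum>k\<in>S. a k * indicator (ball (x - t *\<^sub>R k) (t / 2)) z) \<le> (E :: real)"
proof (cases "\<exists>k\<in>S. z \<in> ball (x - t *\<^sub>R k) (t / 2)")
  case True
  then obtain k where k: "k \<in> S" "z \<in> ball (x - t *\<^sub>R k) (t / 2)" by auto
  have out: "z \<notin> ball (x - t *\<^sub>R j) (t / 2)" if j: "j \<in> S" "j \<noteq> k" for j
  proof
    assume "z \<in> ball (x - t *\<^sub>R j) (t / 2)"
    then have "dist (x - t *\<^sub>R k) (x - t *\<^sub>R j) < t / 2 + t / 2"
      using k(2) dist_triangle2[of "x - t *\<^sub>R k" "x - t *\<^sub>R j" z] by (simp add: dist_commute)
    moreover have "dist (x - t *\<^sub>R k) (x - t *\<^sub>R j) = t * norm (j - k)"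
    proof -
      have "(x - t *\<^sub>R k) - (x - t *\<^sub>R j) = t *\<^sub>R (j - k)" by (simp add: algebra_simps)
      then show ?thesis using assms(1) by (simp add: dist_norm)
    qed
    moreover have "t * 1 \<le> t * norm (j - k)"
      using grid_separated[of j k] j k(1) assms(1,3) by (intro mult_left_mono) auto
    ultimately show False by simp
  qed
  have "(\<Sum>k\<in>S. a k * indicator (ball (x - t *\<^sub>R k) (t / 2)) z) =
      (\<Sum>j\<in>S. if j = k then a k else 0)"
    using out k(2) by (intro sum.cong refl) (auto simp: indicator_def)
  also have "\<dots> = a k" using assms(2) k(1) by simp
  also have "\<dots> \<le> E" by (rule le[OF k])
  finally show ?thesis .
next
  case False
  then have "(\<Sum>k\<in>S. a k * indicator (ball (x - t *\<^sub>R k) (t / 2)) z) = 0"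
    by (intro sum.neutral) (auto simp: indicator_def)
  then show ?thesis using assms(4) by simp
qed

text \<open>The bound for the piece at \<open>k\<close> holds at almost every \<open>z\<close> of
  the ball of radius \<open>t / 2\<close> about \<open>x - t *\<^sub>R k\<close>. Averaging over
  these disjoint balls turns the sum over \<open>k\<close> into a single integral of
  \<open>H powr q\<close> against a radial weight of order \<open>\<kappa> * q\<close>.
  \<open>H\<close> is a finite representative of the grand maximal function, which may be infinite
  on a null set.\<close>

lemma tempered_functional_le_hl_maximal:
  fixes \<beta> :: "real ^ 'n::finite \<Rightarrow> complex"
  assumes \<beta>: "\<beta> \<in> schwartz" and one: "(LINT w|lborel. \<beta> w) = 1"
    and q: "0 < q" "q \<le> 1" and \<kappa>q: "real CARD('n) < \<kappa> * q"
  obtains C where "0 < C" "\<And>(u :: (real ^ 'n \<Rightarrow> complex) \<Rightarrow> complex) H g B x t. tempered_functional u \<Longrightarrow>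
    H \<in> borel_measurable lebesgue \<Longrightarrow> \<forall>z. 0 \<le> H z \<Longrightarrow>
    AE z in lebesgue. grand_maximal N u z = ennreal (H z) \<Longrightarrow> g \<in> schwartz \<Longrightarrow> 0 < B \<Longrightarrow>
    \<forall>\<alpha> x. length \<alpha> \<le> N + 1 \<longrightarrow> cmod (iterated_deriv \<alpha> g x) \<le> B * (1 + norm x) powr -\<kappa> \<Longrightarrow> 0 < t \<Longrightarrow>
    ennreal (cmod (u (\<lambda>y. dilate t g (x - y))) powr q) \<le>
      ennreal (C * B powr q) * hl_maximal (\<lambda>z. ennreal (H z powr q)) x"
proof -
  define n where "n = CARD('n)"
  have "0 < \<kappa> * q" using \<kappa>q by (rule order.strict_trans1[rotated]) simp
  then have \<kappa>: "0 < \<kappa>" using q(1) by (simp add: zero_less_mult_iff)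
  obtain C1 where C1: "0 < C1" "\<And>g B k. g \<in> schwartz \<Longrightarrow>
    \<forall>\<alpha> x. length \<alpha> \<le> N + 1 \<longrightarrow> cmod (iterated_deriv \<alpha> g x) \<le> B * (1 + norm x) powr -\<kappa> \<Longrightarrow>
    \<forall>\<alpha> x. length \<alpha> \<le> N + 1 \<longrightarrow> cmod (iterated_deriv \<alpha> (\<lambda>x. g x * cell \<beta> k x) x) \<le>
      C1 * B * (1 + norm k) powr -\<kappa> * (1 + norm (x - k)) powr -real (N + CARD('n) + 1)"
    by (rule cell_localization[OF \<beta>, where \<kappa>=\<kappa> and m="N + 1" and L="real (N + CARD('n) + 1)"])
      (use \<kappa> in simp, simp, blast)
  obtain C3 where C3: "0 < C3" "\<And>(g :: real ^ 'n \<Rightarrow> ennreal) x t. g \<in> borel_measurable lebesgue \<Longrightarrow> 0 < t \<Longrightarrow>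
    ennreal (1 / t ^ DIM(real ^ 'n)) * (\<integral>\<^sup>+z. ennreal ((1 + norm (z - x) / t) powr -(\<kappa> * q)) * g z \<partial>lebesgue)
      \<le> ennreal C3 * hl_maximal g x"
    by (rule radial_integral_le_hl_maximal[where 'a="real ^ 'n" and s="\<kappa> * q"]) (use \<kappa>q in simp, blast)
  define w where "w = unit_ball_vol (real n)"
  have w: "0 < w" by (simp add: w_def)
  define D where "D = C1 powr q * 2 powr (\<kappa> * q)"
  have D: "0 < D" using C1(1) by (simp add: D_def)
  \<comment> \<open>The factor \<open>2 ^ n / w\<close> is the inverse volume of a ball of radius
    1/2, \<open>D\<close> holds the localisation constant and the change of weight, and
    \<open>C3\<close> comes from the radial integral.\<close>
  define C where "C = 2 ^ n / w * D * C3"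
  have "0 < C" using w D C3(1) by (simp add: C_def)
  moreover have "ennreal (cmod (u (\<lambda>y. dilate t g (x - y))) powr q) \<le>
      ennreal (C * B powr q) * hl_maximal (\<lambda>z. ennreal (H z powr q)) x"
    if u: "tempered_functional u" and H[measurable]: "H \<in> borel_measurable lebesgue" and H0: "\<forall>z. 0 \<le> H z"
    and GH: "AE z in lebesgue. grand_maximal N u z = ennreal (H z)" and g: "g \<in> schwartz" and B: "0 < B"
    and gB: "\<forall>\<alpha> x. length \<alpha> \<le> N + 1 \<longrightarrow> cmod (iterated_deriv \<alpha> g x) \<le> B * (1 + norm x) powr -\<kappa>" and t: "0 < t"
    for u :: "(real ^ 'n \<Rightarrow> complex) \<Rightarrow> complex" and H g B x t
  proof (cases "hl_maximal (\<lambda>z. ennreal (H z powr q)) x = \<infinity>")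
    case True
    then show ?thesis using \<open>0 < C\<close> B by (simp add: ennreal_mult_top)
  next
    case False
    then obtain X where X: "hl_maximal (\<lambda>z. ennreal (H z powr q)) x = ennreal X" "0 \<le> X"
      by (cases "hl_maximal (\<lambda>z. ennreal (H z powr q)) x") auto
    have gs: "(\<lambda>x. g x * cell \<beta> k x) \<in> schwartz" for k by (intro schwartz_mult g cell_schwartz \<beta>)
    define a where "a k = cmod (u (\<lambda>y. dilate t (\<lambda>x. g x * cell \<beta> k x) (x - y)))" for k
    define E where "E z = D * B powr q * ((1 + norm (z - x) / t) powr -(\<kappa> * q) * H z powr q)" for z
    have a_le: "AE z in lebesgue. z \<in> ball (x - t *\<^sub>R k) (t / 2) \<longrightarrow> a k powr q \<le> E z" for k
      using GH
    proof eventually_elim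
      case (elim z)
      show ?case
      proof
        assume z: "z \<in> ball (x - t *\<^sub>R k) (t / 2)"
        then have zt: "norm (x - t *\<^sub>R k - z) < t / 2" by (simp add: dist_norm)
        let ?b = "C1 * B * (1 + norm k) powr -\<kappa>"
        have k0: "0 < 1 + norm k" by (simp add: add_pos_nonneg)
        have b: "0 < ?b" using C1(1) B k0 by simp
        have "ennreal (a k) \<le> ennreal ?b * grand_maximal N u z"
          unfolding a_def
        proof (rule localized_le_grand_maximal[OF u gs b t])
          show "norm (x - t *\<^sub>R k - z) < t" using zt t by simp
        qed (use C1(2)[OF g gB, of k] in blast)
        also have "\<dots> = ennreal (?b * H z)" using elim b H0 by (simp add: ennreal_mult)
        finally have ab: "a k \<le> ?b * H z" using b H0 by (simp add: ennreal_le_iff)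
        \<comment> \<open>On this ball \<open>1 + norm (z - x) / t\<close> is at most
          \<open>2 * (1 + norm k)\<close>, so the weight at \<open>k\<close> passes to a weight in
          \<open>z\<close> at the cost of \<open>2 powr \<kappa>\<close>.\<close>
        have "norm (z - x) \<le> norm (t *\<^sub>R k) + norm (x - t *\<^sub>R k - z)"
          using norm_triangle_ineq4[of "- (t *\<^sub>R k)" "x - t *\<^sub>R k - z"] by (simp add: algebra_simps)
        also have "\<dots> \<le> t * norm k + t" using zt t by simp
        finally have "norm (z - x) / t \<le> norm k + 1"
          using t by (simp add: field_simps)
        moreover have "1 + r \<le> 2 * (1 + norm k)" if "r \<le> norm k + 1" for r
        proof -
          have "1 + r \<le> 1 + (norm k + 1)" using that by (rule add_left_mono)
          also have "\<dots> \<le> 2 * (1 + norm k)" by simp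
          finally show ?thesis .
        qed
        ultimately have "1 + norm (z - x) / t \<le> 2 * (1 + norm k)" by blast
        moreover have p1: "0 < 1 + norm (z - x) / t" using t by (intro add_pos_nonneg) auto
        ultimately have "(2 * (1 + norm k)) powr -\<kappa> \<le> (1 + norm (z - x) / t) powr -\<kappa>"
          using \<kappa> by (intro powr_mono2') auto
        then have le: "2 powr \<kappa> * (2 * (1 + norm k)) powr -\<kappa> \<le> 2 powr \<kappa> * (1 + norm (z - x) / t) powr -\<kappa>"
          by (rule mult_left_mono) simp
        have eq: "2 powr \<kappa> * (2 * (1 + norm k)) powr -\<kappa> = (1 + norm k) powr -\<kappa>"
        proof -
          have "(2 * (1 + norm k)) powr -\<kappa> = 2 powr -\<kappa> * (1 + norm k) powr -\<kappa>"
            using k0 by (subst powr_mult) auto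
          moreover have "2 powr \<kappa> * 2 powr -\<kappa> = (1 :: real)" by (simp add: powr_minus)
          ultimately show ?thesis by (simp only: mult.assoc[symmetric] mult_1)
        qed
        note wt = le[unfolded eq]
        have "a k \<le> C1 * B * (2 powr \<kappa> * (1 + norm (z - x) / t) powr -\<kappa>) * H z"
          using ab wt C1(1) B H0 by (meson less_imp_le mult_left_mono mult_right_mono mult_pos_pos order_trans)
        then have "a k powr q \<le> (C1 * B * (2 powr \<kappa> * (1 + norm (z - x) / t) powr -\<kappa>) * H z) powr q"
          using q by (intro powr_mono2) (auto simp: a_def)
        also have "\<dots> = E z"
          unfolding E_def D_def using C1(1) B H0 p1
          by (simp add: powr_mult powr_powr)
        finally show "a k powr q \<le> E z" .
      qed
    qed
    have E0: "0 \<le> E z" for z using D by (simp add: E_def)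
    \<comment> \<open>The bound is uniform in the finite set \<open>S\<close>, which permits the
      limit of growing partial sums below.\<close>
    have sum_le: "(\<Sum>k\<in>S. a k powr q) \<le> C * B powr q * X" if S: "finite S" "S \<subseteq> range (grid 1)" for S
    proof -
      have vol: "emeasure lebesgue (ball (x - t *\<^sub>R k) (t / 2)) = ennreal (w * (t / 2) ^ n)" for k
        using emeasure_ball[of "t / 2" "x - t *\<^sub>R k"] t by (simp add: w_def n_def)
      have "ennreal (\<Sum>k\<in>S. a k powr q) * ennreal (w * (t / 2) ^ n) =
          (\<Sum>k\<in>S. ennreal (a k powr q) * emeasure lebesgue (ball (x - t *\<^sub>R k) (t / 2)))"
        unfolding vol by (subst sum_ennreal[symmetric], simp, rule sum_distrib_right)
      also have "\<dots> = (\<Sum>k\<in>S. (\<integral>\<^sup>+z. ennreal (a k powr q) * indicator (ball (x - t *\<^sub>R k) (t / 2)) z \<partial>lebesgue))"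
        by (intro sum.cong refl nn_integral_cmult_indicator[symmetric] measurable_lebesgue_ball)
      also have "\<dots> = (\<integral>\<^sup>+z. (\<Sum>k\<in>S. ennreal (a k powr q) * indicator (ball (x - t *\<^sub>R k) (t / 2)) z) \<partial>lebesgue)"
        by (intro nn_integral_sum[symmetric] borel_measurable_times_ennreal borel_measurable_const
            borel_measurable_indicator measurable_lebesgue_ball)
      also have "\<dots> \<le> (\<integral>\<^sup>+z. ennreal (E z) \<partial>lebesgue)"
      proof (rule nn_integral_mono_AE)
        have "AE z in lebesgue. \<forall>k\<in>S. z \<in> ball (x - t *\<^sub>R k) (t / 2) \<longrightarrow> a k powr q \<le> E z"
          using S(1) a_le by (intro AE_finite_allI) auto
        then show "AE z in lebesgue. (\<Sum>k\<in>S. ennreal (a k powr q) * indicator (ball (x - t *\<^sub>R k) (t / 2)) z) \<le> ennreal (E z)"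
        proof eventually_elim
          case (elim z)
          have "(\<Sum>k\<in>S. ennreal (a k powr q) * indicator (ball (x - t *\<^sub>R k) (t / 2)) z) =
              (\<Sum>k\<in>S. ennreal (a k powr q * indicator (ball (x - t *\<^sub>R k) (t / 2)) z))"
            by (intro sum.cong refl) (auto simp: indicator_def)
          also have "\<dots> = ennreal (\<Sum>k\<in>S. a k powr q * indicator (ball (x - t *\<^sub>R k) (t / 2)) z)"
            by (rule sum_ennreal) simp
          also have "\<dots> \<le> ennreal (E z)"
            using elim by (intro ennreal_leI separated_balls_sum_le[OF t S E0]) auto
          finally show ?case .
        qed
      qed
      also have "\<dots> = (\<integral>\<^sup>+z. ennreal (D * B powr q) *
          (ennreal ((1 + norm (z - x) / t) powr -(\<kappa> * q)) * ennreal (H z powr q)) \<partial>lebesgue)"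
        using D by (intro nn_integral_cong) (simp add: E_def ennreal_mult)
      also have "\<dots> = ennreal (D * B powr q) * (\<integral>\<^sup>+z. ennreal ((1 + norm (z - x) / t) powr -(\<kappa> * q)) * ennreal (H z powr q) \<partial>lebesgue)"
      proof (intro nn_integral_cmult borel_measurable_times_ennreal)
        show "(\<lambda>z. ennreal ((1 + norm (z - x) / t) powr -(\<kappa> * q))) \<in> borel_measurable lebesgue"
          by (intro measurable_completion) measurable
      qed measurable
      finally have 1: "ennreal (\<Sum>k\<in>S. a k powr q) * ennreal (w * (t / 2) ^ n) \<le> ennreal (D * B powr q) *
        (\<integral>\<^sup>+z. ennreal ((1 + norm (z - x) / t) powr -(\<kappa> * q)) * ennreal (H z powr q) \<partial>lebesgue)" .
      have 2: "ennreal (1 / t ^ n) * (\<integral>\<^sup>+z. ennreal ((1 + norm (z - x) / t) powr -(\<kappa> * q)) * ennreal (H z powr q) \<partial>lebesgue)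
        \<le> ennreal C3 * ennreal X"
        using C3(2)[of "\<lambda>z. ennreal (H z powr q)" t x] t unfolding X(1) n_def by simp
      have "ennreal (1 / t ^ n) * (ennreal (\<Sum>k\<in>S. a k powr q) * ennreal (w * (t / 2) ^ n)) \<le>
        ennreal (1 / t ^ n) * (ennreal (D * B powr q) *
        (\<integral>\<^sup>+z. ennreal ((1 + norm (z - x) / t) powr -(\<kappa> * q)) * ennreal (H z powr q) \<partial>lebesgue))"
        by (rule mult_left_mono[OF 1]) simp
      also have "\<dots> = ennreal (D * B powr q) * (ennreal (1 / t ^ n) *
        (\<integral>\<^sup>+z. ennreal ((1 + norm (z - x) / t) powr -(\<kappa> * q)) * ennreal (H z powr q) \<partial>lebesgue))"
        by (rule mult.left_commute)
      also have "\<dots> \<le> ennreal (D * B powr q) * (ennreal C3 * ennreal X)"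
        by (rule mult_left_mono[OF 2]) simp
      finally have "ennreal (1 / t ^ n * ((\<Sum>k\<in>S. a k powr q) * (w * (t / 2) ^ n))) \<le> ennreal (D * B powr q * (C3 * X))"
        using w t D C3(1) X(2) by (simp add: ennreal_mult[symmetric] sum_nonneg)
      then have "1 / t ^ n * ((\<Sum>k\<in>S. a k powr q) * (w * (t / 2) ^ n)) \<le> D * B powr q * (C3 * X)"
        using D C3(1) X(2) by (subst (asm) ennreal_le_iff) auto
      moreover have "1 / t ^ n * ((\<Sum>k\<in>S. a k powr q) * (w * (t / 2) ^ n)) = (\<Sum>k\<in>S. a k powr q) * (w / 2 ^ n)"
        using t by (simp add: power_divide)
      ultimately have "(\<Sum>k\<in>S. a k powr q) * (w / 2 ^ n) \<le> D * B powr q * (C3 * X)" by simp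
      then show ?thesis using w by (simp add: C_def field_simps)
    qed
    obtain v where v: "tempered_functional v" "\<And>f. f \<in> schwartz \<Longrightarrow> u (\<lambda>y. dilate t f (x - y)) = v f"
      by (rule tempered_functional_dilate_reflect[OF u t, of x]) blast
    obtain C4 where C4: "0 \<le> C4" "\<And>M. 0 \<le> M \<Longrightarrow>
      cmod (v g - (\<Sum>k\<in>grid 1 ` cball 0 M. v (\<lambda>x. g x * cell \<beta> k x))) \<le> C4 / (1 + M)"
      by (rule tempered_functional_cell_tail[OF v(1) \<beta> one g]) blast
    define Y where "Y = (C * B powr q * X) powr (1 / q)"
    have CX: "0 \<le> C * B powr q * X" using \<open>0 < C\<close> X(2) by simp
    \<comment> \<open>The pieces inside the ball sum to at most \<open>Y\<close>. The tail constant
      \<open>C4\<close> may depend on \<open>g\<close>, \<open>x\<close> and \<open>t\<close>, which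
      is harmless because the tail disappears as \<open>M\<close> grows.\<close>
    have vM: "cmod (v g) \<le> Y + C4 / (1 + real M)" for M :: nat
    proof -
      let ?S = "grid 1 ` cball (0 :: real ^ 'n) (real M)"
      have fin: "finite ?S" by (rule finite_grid_image) simp
      have av: "cmod (v (\<lambda>x. g x * cell \<beta> k x)) = a k" for k unfolding a_def v(2)[OF gs] ..
      have "(\<Sum>k\<in>?S. a k) = ((\<Sum>k\<in>?S. a k) powr q) powr (1 / q)"
        using q by (simp add: powr_powr a_def sum_nonneg)
      also have "\<dots> \<le> (\<Sum>k\<in>?S. a k powr q) powr (1 / q)"
        using q by (intro powr_mono2 sum_powr_le) (auto simp: a_def)
      also have "\<dots> \<le> Y"
        unfolding Y_def using q sum_le[OF fin] by (intro powr_mono2) (auto simp: sum_nonneg)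
      finally have s: "(\<Sum>k\<in>?S. a k) \<le> Y" .
      have "cmod (v g) \<le> cmod (\<Sum>k\<in>?S. v (\<lambda>x. g x * cell \<beta> k x)) + cmod (v g - (\<Sum>k\<in>?S. v (\<lambda>x. g x * cell \<beta> k x)))"
        using norm_triangle_ineq[of "\<Sum>k\<in>?S. v (\<lambda>x. g x * cell \<beta> k x)" "v g - (\<Sum>k\<in>?S. v (\<lambda>x. g x * cell \<beta> k x))"]
        by simp
      also have "\<dots> \<le> Y + C4 / (1 + real M)"
        using norm_sum[of "\<lambda>k. v (\<lambda>x. g x * cell \<beta> k x)" ?S] s C4(2)[of "real M"]
        unfolding av by (intro add_mono) auto
      finally show ?thesis .
    qed
    have "(\<lambda>M. Y + C4 / (1 + real M)) \<longlonglongrightarrow> Y + 0"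
      by (intro tendsto_add tendsto_const tendsto_divide_0[OF tendsto_const]
          filterlim_at_top_imp_at_infinity filterlim_tendsto_add_at_top[OF tendsto_const filterlim_real_sequentially])
    then have "cmod (v g) \<le> Y + 0" by (rule LIMSEQ_le_const) (use vM in blast)
    then have "cmod (v g) powr q \<le> Y powr q" using q by (intro powr_mono2) auto
    also have "Y powr q = C * B powr q * X" using q CX by (simp add: Y_def powr_powr)
    finally have "ennreal (cmod (v g) powr q) \<le> ennreal (C * B powr q * X)" by (rule ennreal_leI)
    then show ?thesis using \<open>0 < C\<close> X v(2)[OF g] by (simp add: ennreal_mult)
  qed
  ultimately show thesis using that by blast
qed

section \<open>Fourier decay in one dimension\<close>

definition fdiff :: "real \<Rightarrow> (real \<Rightarrow> real) \<Rightarrow> real \<Rightarrow> real" where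
  "fdiff h f = (\<lambda>s. f (s + h) - f s)"

lemma fdiff_funpow_Suc: "(fdiff h ^^ Suc m) f = (fdiff h ^^ m) (fdiff h f)"
  by (simp only: funpow_Suc_right o_apply)

lemma integrable_fdiff: "integrable lborel f \<Longrightarrow> integrable lborel (fdiff h f)"
  using lborel_integrable_real_affine[of f 1 h]
  by (simp add: fdiff_def add.commute Bochner_Integration.integrable_diff)

lemma integrable_fdiff_funpow: "integrable lborel f \<Longrightarrow> integrable lborel ((fdiff h ^^ m) f)"
  by (induction m) (auto simp: integrable_fdiff)

lemma fdiff_funpow_bound:
  assumes "0 \<le> h" "\<And>x. x \<in> {s..s + real m * h} \<Longrightarrow> \<bar>f x\<bar> \<le> A"
  shows "\<bar>(fdiff h ^^ m) f s\<bar> \<le> 2 ^ m * A"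
  using assms(2)
proof (induction m arbitrary: f A)
  case (Suc m)
  have "\<bar>(fdiff h ^^ m) (fdiff h f) s\<bar> \<le> 2 ^ m * (2 * A)"
  proof (rule Suc.IH)
    fix x assume x: "x \<in> {s..s + real m * h}"
    have "\<bar>f (x + h)\<bar> \<le> A" "\<bar>f x\<bar> \<le> A"
      using x assms(1) by (auto intro!: Suc.prems simp: algebra_simps)
    then show "\<bar>fdiff h f x\<bar> \<le> 2 * A" by (simp add: fdiff_def)
  qed
  then show ?case unfolding fdiff_funpow_Suc by simp
qed simp

text \<open>\<open>F\<close> is a chain of successive derivatives of \<open>F 0\<close>. The
  induction hypothesis is applied to the chain of first differences, and the mean value inequality
  at the top order supplies the additional factor \<open>h\<close>.\<close>

lemma fdiff_funpow_derivative_bound: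
  assumes "0 \<le> h"
    and "\<And>j x. j < m \<Longrightarrow> x \<in> {s..s + real m * h} \<Longrightarrow> (F j has_real_derivative F (Suc j) x) (at x)"
    and "\<And>x. x \<in> {s..s + real m * h} \<Longrightarrow> \<bar>F m x\<bar> \<le> A"
  shows "\<bar>(fdiff h ^^ m) (F 0) s\<bar> \<le> h ^ m * A"
  using assms(2,3)
proof (induction m arbitrary: F A)
  case (Suc m)
  have "\<bar>(fdiff h ^^ m) ((\<lambda>j x. F j (x + h) - F j x) 0) s\<bar> \<le> h ^ m * (h * A)"
  proof (rule Suc.IH)
    fix j x assume j: "j < m" and x: "x \<in> {s..s + real m * h}"
    have "(F j has_real_derivative F (Suc j) (x + h)) (at (x + h))" "(F j has_real_derivative F (Suc j) x) (at x)"
      using j x assms(1) by (auto intro!: Suc.prems(1) simp: algebra_simps)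
    then show "((\<lambda>x. F j (x + h) - F j x) has_real_derivative F (Suc j) (x + h) - F (Suc j) x) (at x)"
      by (auto intro!: derivative_eq_intros DERIV_shift[THEN iffD1])
  next
    fix x assume x: "x \<in> {s..s + real m * h}"
    have in_I: "y \<in> {s..s + real (Suc m) * h}" if "y \<in> {x..x + h}" for y
      using x that assms(1) by (auto simp: algebra_simps)
    have "norm (F m (x + h) - F m x) \<le> A * norm (x + h - x)"
    proof (rule field_differentiable_bound[where S = "{x..x + h}" and f' = "F (Suc m)"])
      fix y assume y: "y \<in> {x..x + h}"
      show "(F m has_field_derivative F (Suc m) y) (at y within {x..x + h})"
        using Suc.prems(1)[OF _ in_I[OF y], of m] by (auto intro: has_field_derivative_at_within)
      show "norm (F (Suc m) y) \<le> A" using Suc.prems(2)[OF in_I[OF y]] by simp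
    qed (use assms(1) in auto)
    then show "\<bar>F m (x + h) - F m x\<bar> \<le> h * A" using assms(1) by (simp add: mult.commute)
  qed
  then show ?case unfolding fdiff_funpow_Suc by (simp add: fdiff_def mult.assoc mult.left_commute)
qed simp

definition fourier1 :: "(real \<Rightarrow> real) \<Rightarrow> real \<Rightarrow> complex" where
  "fourier1 f r = (LINT s|lborel. of_real (f s) * exp (- 2 * of_real pi * \<i> * of_real (r * s)))"

lemma integrable_fourier1:
  assumes "integrable lborel f"
  shows "integrable lborel (\<lambda>s. of_real (f s) * exp (- 2 * of_real pi * \<i> * of_real (r * s)) :: complex)"
proof (rule Bochner_Integration.integrable_bound[OF assms])
  have [measurable]: "f \<in> borel_measurable borel" using assms by auto
  show "(\<lambda>s. of_real (f s) * exp (- 2 * of_real pi * \<i> * of_real (r * s)) :: complex) \<in> borel_measurable lborel"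
    by measurable
qed (simp add: norm_mult)

text \<open>The step \<open>1 / (2 * r)\<close> is half a period of the exponential, so the
  translation reverses its sign and both terms of the difference contribute equally.\<close>

lemma fourier1_fdiff:
  assumes f: "integrable lborel f" and r: "r \<noteq> 0"
  shows "fourier1 (fdiff (1 / (2 * r)) f) r = - 2 * fourier1 f r"
proof -
  let ?h = "1 / (2 * r)"
  let ?e = "\<lambda>s. exp (- 2 * of_real pi * \<i> * of_real (r * s)) :: complex"
  have shift: "?e s = - ?e (?h + 1 * s)" for s
  proof -
    have "- 2 * of_real pi * \<i> * of_real (r * (?h + 1 * s)) =
        (- 2 * of_real pi * \<i> * of_real (r * s) :: complex) - of_real pi * \<i>"
      using r by (simp add: field_simps)
    then show ?thesis by (simp only: exp_diff) (simp add: exp_pi_i')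
  qed
  have fs: "integrable lborel (\<lambda>s. f (?h + 1 * s))" using f by (intro lborel_integrable_real_affine) auto
  have "(LINT s|lborel. of_real (f (?h + 1 * s)) * ?e s) = - (LINT s|lborel. of_real (f (?h + 1 * s)) * ?e (?h + 1 * s))"
    by (subst shift) simp
  also have "(LINT s|lborel. of_real (f (?h + 1 * s)) * ?e (?h + 1 * s)) = fourier1 f r"
    using lborel_integral_real_affine[of 1 "\<lambda>s. of_real (f s) * ?e s" ?h] by (simp add: fourier1_def)
  finally have 1: "(LINT s|lborel. of_real (f (?h + 1 * s)) * ?e s) = - fourier1 f r" .
  have "fourier1 (fdiff ?h f) r = (LINT s|lborel. of_real (f (?h + 1 * s)) * ?e s - of_real (f s) * ?e s)"
    unfolding fourier1_def fdiff_def by (simp add: left_diff_distrib add.commute)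
  also have "\<dots> = (LINT s|lborel. of_real (f (?h + 1 * s)) * ?e s) - fourier1 f r"
    unfolding fourier1_def by (intro Bochner_Integration.integral_diff integrable_fourier1 fs f)
  finally show ?thesis unfolding 1 by simp
qed

lemma norm_fourier1_le_fdiff:
  assumes f: "integrable lborel f" and r: "r \<noteq> 0"
  shows "2 ^ m * cmod (fourier1 f r) \<le> (LINT s|lborel. \<bar>(fdiff (1 / (2 * r)) ^^ m) f s\<bar>)"
proof -
  have "fourier1 ((fdiff (1 / (2 * r)) ^^ m) f) r = (- 2) ^ m * fourier1 f r"
  proof (induction m)
    case (Suc m)
    show ?case using fourier1_fdiff[OF integrable_fdiff_funpow[OF f, where h="1 / (2 * r)" and m=m] r] Suc by simp
  qed simp
  then have "2 ^ m * cmod (fourier1 f r) = cmod (fourier1 ((fdiff (1 / (2 * r)) ^^ m) f) r)"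
    by (simp add: norm_mult norm_power)
  also have "\<dots> \<le> (LINT s|lborel. \<bar>(fdiff (1 / (2 * r)) ^^ m) f s\<bar>)"
    unfolding fourier1_def using integrable_fdiff_funpow[OF f, where h="1 / (2 * r)" and m=m]
    by (intro norm_integral_le_integral integrable_fourier1) (auto simp: norm_mult)
  finally show ?thesis .
qed

section \<open>The one-dimensional profile and its derivatives\<close>

definition arch :: "real \<Rightarrow> real \<Rightarrow> real" where
  "arch \<nu> s = max 0 (1 - s\<^sup>2) powr \<nu>"

lemma arch_measurable [measurable]: "arch \<nu> \<in> borel_measurable borel"
  unfolding arch_def by measurable

lemma arch_nonneg: "0 \<le> arch \<nu> s" by (simp add: arch_def)

lemma arch_eq_0: "1 \<le> \<bar>s\<bar> \<Longrightarrow> arch \<nu> s = 0"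
proof -
  assume "1 \<le> \<bar>s\<bar>"
  then have "1 \<le> s\<^sup>2" using abs_le_square_iff[of 1 s] by simp
  then show ?thesis by (simp add: arch_def)
qed

lemma arch_le:
  assumes "0 \<le> \<nu>" "\<bar>s\<bar> \<ge> 1 - d" "0 \<le> d" shows "arch \<nu> s \<le> (2 * d) powr \<nu>"
proof (cases "1 \<le> \<bar>s\<bar>")
  case False
  have "1 - s\<^sup>2 = (1 - \<bar>s\<bar>) * (1 + \<bar>s\<bar>)" by (simp add: algebra_simps power2_eq_square)
  also have "\<dots> \<le> d * 2" using assms False by (intro mult_mono) auto
  finally show ?thesis unfolding arch_def using assms by (intro powr_mono2) auto
qed (simp add: arch_eq_0)

lemma integrable_arch:
  assumes "0 \<le> \<nu>" shows "integrable lborel (arch \<nu>)"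
proof (rule Bochner_Integration.integrable_bound)
  show "integrable lborel (\<lambda>s::real. indicator {-1..1} s :: real)"
    by (intro integrable_real_indicator) auto
  have "norm (arch \<nu> s) \<le> norm (indicator {-1..1} s :: real)" for s
  proof (cases "s \<in> {-1..1}")
    case True
    have "arch \<nu> s \<le> 1 powr \<nu>" unfolding arch_def using assms by (intro powr_mono2) auto
    then show ?thesis using True by (simp add: arch_nonneg)
  qed (auto simp: arch_eq_0)
  then show "AE s in lborel. norm (arch \<nu> s) \<le> norm (indicator {-1..1} s :: real)" by simp
qed simp

text \<open>On the open interval each derivative is a polynomial times a power of
  \<open>1 - x\<^sup>2\<close>, and the exponent drops by 1 at each step. In the recursion the
  factor \<open>[:1, 0, -1:]\<close>, which is \<open>1 - x\<^sup>2\<close>, brings both terms of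
  the product rule to the same lower exponent.\<close>

lemma arch_derivatives:
  obtains F K where "\<And>x. \<bar>x\<bar> < 1 \<Longrightarrow> F 0 x = arch \<nu> x"
    "\<And>j x. \<bar>x\<bar> < 1 \<Longrightarrow> (F j has_real_derivative F (Suc j) x) (at x)"
    "\<And>j x. \<bar>x\<bar> < 1 \<Longrightarrow> \<bar>F j x\<bar> \<le> K j * (1 - x\<^sup>2) powr (\<nu> - real j)" "\<And>j. (0::real) < K j"
proof -
  define p where "p = rec_nat (1 :: real poly)
    (\<lambda>j q. pderiv q * [:1, 0, -1:] - smult (2 * (\<nu> - real j)) ([:0, 1:] * q))"
  have p: "p 0 = 1" "p (Suc j) = pderiv (p j) * [:1, 0, -1:] - smult (2 * (\<nu> - real j)) ([:0, 1:] * p j)" for j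
    by (simp_all add: p_def)
  define F where "F j x = poly (p j) x * (1 - x\<^sup>2) powr (\<nu> - real j)" for j x
  have sq: "0 < 1 - x\<^sup>2" if "\<bar>x\<bar> < 1" for x :: real using that abs_square_less_1[of x] by simp
  have "\<exists>K>0. \<forall>x. \<bar>x\<bar> < 1 \<longrightarrow> \<bar>poly (p j) x\<bar> \<le> K" for j
  proof -
    have "bounded (poly (p j) ` {-1..1})"
      by (intro compact_imp_bounded compact_continuous_image continuous_intros) auto
    then obtain K where "0 < K" "\<forall>x\<in>poly (p j) ` {-1..1}. norm x \<le> K" using bounded_pos by blast
    then show ?thesis by (intro exI[of _ K]) (auto simp: abs_less_iff)
  qed
  then have "\<exists>K. \<forall>j. 0 < K j \<and> (\<forall>x. \<bar>x\<bar> < 1 \<longrightarrow> \<bar>poly (p j) x\<bar> \<le> K j)" by (intro choice) blast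
  then obtain K where K: "\<And>j. 0 < K j" "\<And>j x. \<bar>x\<bar> < 1 \<Longrightarrow> \<bar>poly (p j) x\<bar> \<le> K j" by blast
  show thesis
  proof
    fix x :: real assume x: "\<bar>x\<bar> < 1"
    show "F 0 x = arch \<nu> x" using sq[OF x] by (simp add: F_def p arch_def)
    fix j
    show "\<bar>F j x\<bar> \<le> K j * (1 - x\<^sup>2) powr (\<nu> - real j)"
      unfolding F_def abs_mult using K(2)[OF x, of j] by (intro mult_mono) auto
    have e: "(1 - x\<^sup>2) powr (\<nu> - real j) = (1 - x\<^sup>2) * (1 - x\<^sup>2) powr (\<nu> - real (Suc j))"
      using sq[OF x] powr_add[of "1 - x\<^sup>2" 1 "\<nu> - real (Suc j)"] by (simp add: algebra_simps)
    have "(F j has_real_derivative poly (pderiv (p j)) x * (1 - x\<^sup>2) powr (\<nu> - real j) +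
        poly (p j) x * ((\<nu> - real j) * (1 - x\<^sup>2) powr (\<nu> - real j - 1) * (- (2 * x)))) (at x)"
      unfolding F_def using sq[OF x]
      by (auto intro!: derivative_eq_intros poly_DERIV simp: algebra_simps)
    also have "poly (pderiv (p j)) x * (1 - x\<^sup>2) powr (\<nu> - real j) +
        poly (p j) x * ((\<nu> - real j) * (1 - x\<^sup>2) powr (\<nu> - real j - 1) * (- (2 * x))) = F (Suc j) x"
      unfolding e by (simp add: F_def p algebra_simps power2_eq_square diff_diff_eq)
    finally show "(F j has_real_derivative F (Suc j) x) (at x)" .
  qed (rule K(1))
qed

lemma nn_integral_powr_tail:
  assumes "1 < \<sigma>" "0 < h"
  shows "(\<integral>\<^sup>+y. ennreal (y powr -\<sigma>) * indicator {h..} y \<partial>lborel) = ennreal (h powr (1 - \<sigma>) / (\<sigma> - 1))"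
proof -
  have "(\<integral>\<^sup>+y. ennreal (y powr -\<sigma>) * indicator {h..} y \<partial>lborel) = ennreal (0 - (- (h powr (1 - \<sigma>) / (\<sigma> - 1))))"
  proof (rule nn_integral_FTC_atLeast)
    fix y assume "h \<le> y"
    then have "0 < y" using assms by simp
    then have "((\<lambda>y. - (y powr (1 - \<sigma>) / (\<sigma> - 1))) has_real_derivative - ((1 - \<sigma>) * y powr (1 - \<sigma> - 1) / (\<sigma> - 1))) (at y)"
      using assms by (auto intro!: derivative_eq_intros)
    moreover have "- ((1 - \<sigma>) * z / (\<sigma> - 1)) = z" for z
      using assms by (simp add: field_simps)
    ultimately show "((\<lambda>y. - (y powr (1 - \<sigma>) / (\<sigma> - 1))) has_real_derivative y powr -\<sigma>) (at y)"
      by simp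
  next
    have "((\<lambda>y::real. y powr (1 - \<sigma>)) \<longlongrightarrow> 0) at_top"
      using assms by (intro tendsto_neg_powr filterlim_ident) auto
    from tendsto_minus[OF tendsto_divide[OF this tendsto_const[of "\<sigma> - 1"]]]
    show "((\<lambda>y. - (y powr (1 - \<sigma>) / (\<sigma> - 1))) \<longlongrightarrow> 0) at_top" using assms by simp
  qed auto
  then show ?thesis by simp
qed

text \<open>Translating by half a period turns the Fourier integral into one of an iterated difference,
  whose \<open>L\<^sup>1\<close> norm has the order \<open>h powr (\<nu> + 1)\<close>: both endpoint regions have length of order \<open>h\<close>
  and values of order \<open>h powr \<nu>\<close>, and in between the \<open>m\<close>-th derivative is integrated.\<close>

lemma fourier1_arch_decay:
  assumes \<nu>: "0 \<le> \<nu>"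
  obtains C where "0 < C" "\<And>r. 0 < r \<Longrightarrow> cmod (fourier1 (arch \<nu>) r) \<le> C * r powr -(\<nu> + 1)"
proof -
  obtain F K where F: "\<And>x. \<bar>x\<bar> < 1 \<Longrightarrow> F 0 x = arch \<nu> x"
    "\<And>j x. \<bar>x\<bar> < 1 \<Longrightarrow> (F j has_real_derivative F (Suc j) x) (at x)"
    "\<And>j x. \<bar>x\<bar> < 1 \<Longrightarrow> \<bar>F j x\<bar> \<le> K j * (1 - x\<^sup>2) powr (\<nu> - real j)" "\<And>j. (0::real) < K j"
    by (rule arch_derivatives[of \<nu>]) blast
  \<comment> \<open>Large enough that \<open>\<sigma> = m - \<nu>\<close> exceeds 1, so that the
    bound on the m-th derivative has an integrable tail at distances from an endpoint larger than
    \<open>h\<close>.\<close>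
  define m where "m = nat \<lceil>\<nu>\<rceil> + 2"
  have m: "\<nu> + 1 < real m" unfolding m_def using real_nat_ceiling_ge[of \<nu>] by linarith
  define \<sigma> where "\<sigma> = real m - \<nu>"
  have \<sigma>: "1 < \<sigma>" using m by (simp add: \<sigma>_def)
  \<comment> \<open>An m-fold difference at \<open>s\<close> sees the window from \<open>s\<close>
    to \<open>s + m * h\<close>. With one more step \<open>h\<close> as a margin, each boundary
    layer has length \<open>M * h\<close>.\<close>
  define M where "M = real m + 1"
  have M: "1 < M" using m \<nu> by (simp add: M_def)
  define c1 where "c1 = 2 ^ m * (2 * M) powr \<nu>"
  have c1: "0 < c1" using M by (simp add: c1_def)
  \<comment> \<open>Two boundary layers of length \<open>M * h\<close> with values at most
    \<open>c1 * h powr \<nu>\<close>, and two tails in the interior.\<close>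
  define c where "c = 2 * c1 * M + 2 * K m / (\<sigma> - 1)"
  have c: "0 < c" using c1 M F(4)[of m] \<sigma> by (simp add: c_def add_pos_pos)
  have L1: "(LINT s|lborel. \<bar>(fdiff h ^^ m) (arch \<nu>) s\<bar>) \<le> c * h powr (\<nu> + 1)" if h: "0 < h" for h
  proof -
    let ?D = "(fdiff h ^^ m) (arch \<nu>)"
    have int: "integrable lborel ?D" by (intro integrable_fdiff_funpow integrable_arch \<nu>)
    define T where "T y = ennreal (y powr -\<sigma>) * indicator {h..} y" for y :: real
    have [measurable]: "T \<in> borel_measurable borel" unfolding T_def by measurable
    define A where "A = {-1 - real m * h..-1 + h}"
    define B where "B = {1 - M * h..1}"
    have c1h: "2 ^ m * (2 * (M * h)) powr \<nu> = c1 * h powr \<nu>"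
      using h M by (simp add: c1_def powr_mult)
    have pt: "ennreal \<bar>?D s\<bar> \<le> ennreal (c1 * h powr \<nu>) * indicator A s + ennreal (c1 * h powr \<nu>) * indicator B s +
       ennreal (K m * h ^ m) * T (1 + s) + ennreal (K m * h ^ m) * T ((1 - real m * h) - s)" for s
    proof -
      \<comment> \<open>The window misses the support, is near the left endpoint, is near the right
        endpoint, or stays inside at distance more than \<open>h\<close> from both.\<close>
      consider "s < -1 - real m * h \<or> 1 < s" | "s \<in> A" | "s \<in> B" | "-1 + h < s" "s < 1 - M * h"
        unfolding A_def B_def by fastforce
      then show ?thesis
      proof cases
        case 1
        have "\<bar>?D s\<bar> \<le> 2 ^ m * 0"
          using h 1 by (intro fdiff_funpow_bound) (auto simp: arch_eq_0)
        then show ?thesis by simp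
      next
        case 2
        have "\<bar>?D s\<bar> \<le> 2 ^ m * (2 * (M * h)) powr \<nu>"
        proof (rule fdiff_funpow_bound)
          fix x assume x: "x \<in> {s..s + real m * h}"
          then have "x \<le> -1 + M * h" using 2 by (auto simp: A_def M_def algebra_simps)
          then have "1 - M * h \<le> \<bar>x\<bar>" by linarith
          then show "\<bar>arch \<nu> x\<bar> \<le> (2 * (M * h)) powr \<nu>"
            using arch_le[OF \<nu>, of "M * h" x] arch_nonneg[of \<nu> x] M h by simp
        qed (use h in simp)
        then have "ennreal \<bar>?D s\<bar> \<le> ennreal (c1 * h powr \<nu>) * indicator A s" unfolding c1h using 2 by (simp add: ennreal_leI)
        then show ?thesis by (simp add: add_increasing2)
      next
        case 3
        have "\<bar>?D s\<bar> \<le> 2 ^ m * (2 * (M * h)) powr \<nu>"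
        proof (rule fdiff_funpow_bound)
          fix x assume x: "x \<in> {s..s + real m * h}"
          then have "1 - M * h \<le> \<bar>x\<bar>" using 3 by (auto simp: B_def)
          then show "\<bar>arch \<nu> x\<bar> \<le> (2 * (M * h)) powr \<nu>"
            using arch_le[OF \<nu>, of "M * h" x] arch_nonneg[of \<nu> x] M h by simp
        qed (use h in simp)
        then have "ennreal \<bar>?D s\<bar> \<le> ennreal (c1 * h powr \<nu>) * indicator B s" unfolding c1h using 3 by (simp add: ennreal_leI)
        then show ?thesis by (simp add: add_increasing add_increasing2)
      next
        case 4
        \<comment> \<open>The distances of the window from -1 and from 1; the smaller one is a lower
          bound for \<open>1 - x\<^sup>2\<close> on the window.\<close>
        let ?l = "1 + s" and ?u = "(1 - real m * h) - s"
        have lu: "h \<le> ?l" "h \<le> ?u" using 4 by (auto simp: M_def algebra_simps)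
        have inside: "\<bar>x\<bar> < 1" "min ?l ?u \<le> 1 - x\<^sup>2" if x: "x \<in> {s..s + real m * h}" for x
        proof -
          have le: "min ?l ?u \<le> 1 - \<bar>x\<bar>" using x by auto
          then show ax: "\<bar>x\<bar> < 1" using lu h by linarith
          have "\<bar>x\<bar> * \<bar>x\<bar> \<le> \<bar>x\<bar> * 1" using ax by (intro mult_left_mono) auto
          then have "x\<^sup>2 \<le> \<bar>x\<bar>" by (simp add: power2_eq_square)
          then show "min ?l ?u \<le> 1 - x\<^sup>2" using le by linarith
        qed
        \<comment> \<open>\<open>F 0\<close> agrees with \<open>arch \<nu>\<close> only on the open
          interval, so this uses that an iterated difference depends only on the values in the
          window.\<close>
        have Feq: "(fdiff h ^^ m) (F 0) s = ?D s"
        proof -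
          have "(\<And>x. x \<in> {s..s + real k * h} \<Longrightarrow> f x = g x) \<Longrightarrow> (fdiff h ^^ k) f s = (fdiff h ^^ k) g s" for k f g
          proof (induction k arbitrary: f g)
            case (Suc k)
            show ?case unfolding fdiff_funpow_Suc
            proof (rule Suc.IH)
              fix x assume "x \<in> {s..s + real k * h}"
              then show "fdiff h f x = fdiff h g x"
                using Suc.prems[of x] Suc.prems[of "x + h"] h by (auto simp: fdiff_def algebra_simps)
            qed
          qed simp
          then show ?thesis using F(1) inside(1) by blast
        qed
        have mn: "0 < min ?l ?u" using lu h by linarith
        have "\<bar>(fdiff h ^^ m) (F 0) s\<bar> \<le> h ^ m * (K m * (min ?l ?u) powr -\<sigma>)"
        proof (rule fdiff_funpow_derivative_bound)
          fix x assume x: "x \<in> {s..s + real m * h}"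
          have "\<bar>F m x\<bar> \<le> K m * (1 - x\<^sup>2) powr -\<sigma>" using F(3)[OF inside(1)[OF x], of m] by (simp add: \<sigma>_def)
          also have "\<dots> \<le> K m * (min ?l ?u) powr -\<sigma>"
            using inside(2)[OF x] mn \<sigma> F(4)[of m] by (intro mult_left_mono powr_mono2') auto
          finally show "\<bar>F m x\<bar> \<le> K m * (min ?l ?u) powr -\<sigma>" .
        qed (use h F(2) inside(1) in auto)
        also have "(min ?l ?u) powr -\<sigma> \<le> ?l powr -\<sigma> + ?u powr -\<sigma>" by (simp add: min_def)
        finally have "\<bar>?D s\<bar> \<le> h ^ m * (K m * (?l powr -\<sigma> + ?u powr -\<sigma>))"
          unfolding Feq using h F(4)[of m] by (simp add: mult_left_mono)
        then have "ennreal \<bar>?D s\<bar> \<le> ennreal (K m * h ^ m * ?l powr -\<sigma> + K m * h ^ m * ?u powr -\<sigma>)"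
          by (intro ennreal_leI) (simp add: algebra_simps)
        also have "\<dots> = ennreal (K m * h ^ m) * T (1 + s) + ennreal (K m * h ^ m) * T ((1 - real m * h) - s)"
          using lu h F(4)[of m] by (simp add: T_def ennreal_mult)
        finally show ?thesis by (simp add: add_increasing add.assoc)
      qed
    qed
    have T1: "(\<integral>\<^sup>+s. T (1 + s) \<partial>lborel) = (\<integral>\<^sup>+s. T s \<partial>lborel)"
      using nn_integral_real_affine[of T 1 1] by simp
    have T2: "(\<integral>\<^sup>+s. T ((1 - real m * h) - s) \<partial>lborel) = (\<integral>\<^sup>+s. T s \<partial>lborel)"
      using nn_integral_real_affine[of T "-1" "1 - real m * h"] by simp
    have T0: "(\<integral>\<^sup>+s. T s \<partial>lborel) = ennreal (h powr (1 - \<sigma>) / (\<sigma> - 1))"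
      unfolding T_def by (rule nn_integral_powr_tail[OF \<sigma> h])
    have mA: "emeasure lborel A = ennreal (M * h)" unfolding A_def
    proof (subst emeasure_lborel_Icc)
      have "0 \<le> real m * h" using h by simp
      then show "-1 - real m * h \<le> -1 + h" using h by linarith
    qed (simp add: M_def algebra_simps del: ennreal_plus)
    have mB: "emeasure lborel B = ennreal (M * h)" unfolding B_def using h M by simp
    have [measurable]: "A \<in> sets borel" "B \<in> sets borel" by (simp_all add: A_def B_def)
    have "ennreal (LINT s|lborel. \<bar>?D s\<bar>) = (\<integral>\<^sup>+s. ennreal \<bar>?D s\<bar> \<partial>lborel)"
      using int by (intro nn_integral_eq_integral[symmetric]) auto
    also have "\<dots> \<le> (\<integral>\<^sup>+s. ennreal (c1 * h powr \<nu>) * indicator A s + ennreal (c1 * h powr \<nu>) * indicator B s +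
       ennreal (K m * h ^ m) * T (1 + s) + ennreal (K m * h ^ m) * T ((1 - real m * h) - s) \<partial>lborel)"
      by (rule nn_integral_mono) (rule pt)
    also have "\<dots> = ennreal (c1 * h powr \<nu>) * ennreal (M * h) + ennreal (c1 * h powr \<nu>) * ennreal (M * h) +
       ennreal (K m * h ^ m) * ennreal (h powr (1 - \<sigma>) / (\<sigma> - 1)) + ennreal (K m * h ^ m) * ennreal (h powr (1 - \<sigma>) / (\<sigma> - 1))"
      by (simp add: nn_integral_add nn_integral_cmult T1 T2 T0 mA mB)
    also have "\<dots> = ennreal (c * h powr (\<nu> + 1))"
    proof -
      have 1: "h powr \<nu> * h = h powr (\<nu> + 1)" using h by (simp add: powr_add)
      \<comment> \<open>Interior and boundary contributions have the same order, because
        \<open>m + (1 - \<sigma>) = \<nu> + 1\<close>.\<close>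
      have 2: "h ^ m * h powr (1 - \<sigma>) = h powr (\<nu> + 1)"
        using h by (simp add: powr_realpow[symmetric] powr_add[symmetric] \<sigma>_def algebra_simps)
      have "c1 * h powr \<nu> * (M * h) = c1 * M * h powr (\<nu> + 1)" using 1 by (simp add: ac_simps)
      moreover have "K m * h ^ m * (h powr (1 - \<sigma>) / (\<sigma> - 1)) = K m / (\<sigma> - 1) * h powr (\<nu> + 1)"
        using 2 by (simp add: ac_simps)
      ultimately have "c1 * h powr \<nu> * (M * h) + c1 * h powr \<nu> * (M * h) + K m * h ^ m * (h powr (1 - \<sigma>) / (\<sigma> - 1))
          + K m * h ^ m * (h powr (1 - \<sigma>) / (\<sigma> - 1)) = c * h powr (\<nu> + 1)"
        by (simp only: c_def distrib_right) simp
      then show ?thesis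
        using h c1 M F(4)[of m] \<sigma> by (simp add: ennreal_mult[symmetric] ennreal_plus[symmetric] del: ennreal_plus)
    qed
    finally show ?thesis using c by (simp add: ennreal_le_iff)
  qed
  have "cmod (fourier1 (arch \<nu>) r) \<le> c * r powr -(\<nu> + 1)" if r: "0 < r" for r
  proof -
    have "cmod (fourier1 (arch \<nu>) r) \<le> 2 ^ m * cmod (fourier1 (arch \<nu>) r)"
      using mult_right_mono[of 1 "2 ^ m" "cmod (fourier1 (arch \<nu>) r)"] by simp
    also have "\<dots> \<le> (LINT s|lborel. \<bar>(fdiff (1 / (2 * r)) ^^ m) (arch \<nu>) s\<bar>)"
      using r by (intro norm_fourier1_le_fdiff integrable_arch \<nu>) auto
    also have "\<dots> \<le> c * (1 / (2 * r)) powr (\<nu> + 1)" using r by (intro L1) simp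
    also have "\<dots> \<le> c * (1 / r) powr (\<nu> + 1)"
      using r c \<nu> by (intro mult_left_mono powr_mono2) (auto simp: field_simps)
    also have "(1 / r) powr (\<nu> + 1) = r powr -(\<nu> + 1)"
      using r by (simp only: powr_minus powr_divide) (simp add: divide_inverse)
    finally show ?thesis .
  qed
  then show thesis using that c by blast
qed

section \<open>Decay of the Bochner-Riesz kernel\<close>

lemma orthogonal_transformation_borel_measurable:
  fixes T :: "'a::euclidean_space \<Rightarrow> 'a"
  assumes "orthogonal_transformation T" shows "T \<in> borel_measurable borel"
  using assms by (intro borel_measurable_continuous_onI linear_continuous_on)
    (simp add: orthogonal_transformation_linear linear_conv_bounded_linear[symmetric])

lemma orthogonal_transformation_vimage_ball:
  fixes T :: "'a::euclidean_space \<Rightarrow> 'a"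
  assumes T: "orthogonal_transformation T" shows "T -` ball x r = ball (inv T x) r"
proof -
  have "dist (inv T x) y = dist x (T y)" for y
  proof -
    have "dist x (T y) = norm (T (inv T x - y))"
      using orthogonal_transformation_linear[OF T] surj_f_inv_f[OF orthogonal_transformation_surj[OF T], of x]
      by (simp add: linear_diff dist_norm)
    then show ?thesis using orthogonal_transformation_norm[OF T] by (simp add: dist_norm)
  qed
  then show ?thesis by auto
qed

text \<open>An open set is filled by disjoint balls up to a null set, and an isometry preserves the volume
  of each ball. The change of variables theorems of the library need wellordered index types.\<close>

lemma emeasure_le_orthogonal_vimage:
  fixes T :: "'a::euclidean_space \<Rightarrow> 'a"
  assumes T: "orthogonal_transformation T" and U: "open U"
  shows "emeasure lborel U \<le> emeasure lborel (T -` U)"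
proof -
  note [measurable] = orthogonal_transformation_borel_measurable[OF T]
  define K where "K = {(x, r). 0 < r \<and> ball x r \<subseteq> U}"
  have "\<exists>i. i \<in> K \<and> x \<in> ball (fst i) (snd i) \<and> snd i < d" if x: "x \<in> U" "0 < d" for x d
  proof -
    obtain e where "0 < e" "ball x e \<subseteq> U" using U x(1) open_contains_ball by blast
    then show ?thesis using x(2) by (intro exI[of _ "(x, min e (d / 2))"]) (auto simp: K_def)
  qed
  then obtain C where C: "countable C" "C \<subseteq> K"
     "pairwise (\<lambda>i j. disjnt (ball (fst i) (snd i)) (ball (fst j) (snd j))) C"
     "negligible (U - (\<Union>i\<in>C. ball (fst i) (snd i)))"
    by (rule Vitali_covering_theorem_balls[of U K fst snd])
  let ?B = "\<lambda>i. ball (fst i) (snd i)"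
  have disj: "disjoint_family_on ?B C"
    using C(3) unfolding disjoint_family_on_def pairwise_def disjnt_def by blast
  have opn: "open (\<Union>i\<in>C. ?B i)" by auto
  have "emeasure lebesgue (U - (\<Union>i\<in>C. ?B i)) = 0"
    using C(4) by (simp add: negligible_iff_null_sets null_sets_def)
  then have zero: "emeasure lborel (U - (\<Union>i\<in>C. ?B i)) = 0"
    using U opn by (simp add: borel_open sets.Diff)
  have "emeasure lborel U \<le> emeasure lborel ((\<Union>i\<in>C. ?B i) \<union> (U - (\<Union>i\<in>C. ?B i)))"
    using U opn by (intro emeasure_mono) (auto intro!: borel_open sets.Un sets.Diff)
  also have "\<dots> \<le> emeasure lborel (\<Union>i\<in>C. ?B i) + emeasure lborel (U - (\<Union>i\<in>C. ?B i))"
    using U opn by (intro emeasure_subadditive) (auto intro!: borel_open sets.Diff)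
  also have "\<dots> = emeasure lborel (\<Union>i\<in>C. ?B i)" using zero by simp
  also have "\<dots> = (\<integral>\<^sup>+i. emeasure lborel (?B i) \<partial>count_space C)"
    using C(1) disj by (intro emeasure_UN_countable) auto
  also have "\<dots> = (\<integral>\<^sup>+i. emeasure lborel (T -` ?B i) \<partial>count_space C)"
  proof (intro nn_integral_cong)
    fix i assume "i \<in> space (count_space C)"
    then have "0 \<le> snd i" using C(2) by (auto simp: K_def)
    then show "emeasure lborel (?B i) = emeasure lborel (T -` ?B i)"
      unfolding orthogonal_transformation_vimage_ball[OF T] by (simp add: emeasure_ball)
  qed
  also have "\<dots> = emeasure lborel (\<Union>i\<in>C. T -` ?B i)"
  proof (rule emeasure_UN_countable[symmetric])
    show "disjoint_family_on (\<lambda>i. T -` ?B i) C"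
      using disj unfolding disjoint_family_on_def by blast
  qed (use C(1) in \<open>auto simp: orthogonal_transformation_vimage_ball[OF T]\<close>)
  also have "\<dots> \<le> emeasure lborel (T -` U)"
  proof (rule emeasure_mono)
    show "T -` U \<in> sets lborel" using measurable_sets[OF orthogonal_transformation_borel_measurable[OF T] borel_open[OF U]] by simp
    have "?B i \<subseteq> U" if "i \<in> C" for i
      using subsetD[OF C(2) that] by (simp add: K_def split_beta)
    then show "(\<Union>i\<in>C. T -` ?B i) \<subseteq> T -` U" by blast
  qed
  finally show ?thesis .
qed

text \<open>The one-sided inequality for open sets, applied to \<open>T\<close> and to its inverse,
  gives equality on boxes, and these determine the measure.\<close>

lemma lborel_distr_orthogonal_transformation:
  fixes T :: "'a::euclidean_space \<Rightarrow> 'a"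
  assumes T: "orthogonal_transformation T"
  shows "distr lborel borel T = lborel"
proof (rule lborel_eqI[symmetric])
  fix l u :: 'a assume lu: "\<And>b. b \<in> Basis \<Longrightarrow> l \<bullet> b \<le> u \<bullet> b"
  note T' = orthogonal_transformation_inv[OF T]
  have contT: "continuous_on UNIV T"
    using T by (intro linear_continuous_on) (simp add: orthogonal_transformation_linear linear_conv_bounded_linear[symmetric])
  have "open (T -` box l u)" using contT by (intro open_vimage) auto
  from emeasure_le_orthogonal_vimage[OF T' this]
  have "emeasure lborel (T -` box l u) \<le> emeasure lborel (box l u)"
    using orthogonal_transformation_surj[OF T] by (simp add: vimage_comp[symmetric] vimage_def surj_f_inv_f)
  moreover have "emeasure lborel (box l u) \<le> emeasure lborel (T -` box l u)"
    by (rule emeasure_le_orthogonal_vimage[OF T]) auto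
  ultimately have "emeasure lborel (T -` box l u) = emeasure lborel (box l u)" by simp
  then show "emeasure (distr lborel borel T) (box l u) = (\<Prod>b\<in>Basis. (u - l) \<bullet> b)"
    using orthogonal_transformation_borel_measurable[OF T] lu by (simp add: emeasure_distr inner_diff_left)
qed simp

lemma integral_lborel_orthogonal_transformation:
  fixes T :: "real ^ 'n::finite \<Rightarrow> real ^ 'n" and f :: "real ^ 'n \<Rightarrow> complex"
  assumes T: "orthogonal_transformation T" and f: "f \<in> borel_measurable borel"
  shows "(LINT x|lborel. f (T x)) = (LINT x|lborel. f x)"
proof -
  have "T \<in> lborel \<rightarrow>\<^sub>M borel" using orthogonal_transformation_borel_measurable[OF T] by simp
  from integral_distr[OF this f] show ?thesis
    unfolding lborel_distr_orthogonal_transformation[OF T] by simp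
qed

interpretation lborel_product: product_sigma_finite "\<lambda>_::'i. lborel :: real measure"
  by standard

section \<open>Marginals of the multiplier\<close>

lemma nn_integral_semicircle:
  assumes "0 \<le> \<delta>"
  obtains c where "0 \<le> c" "\<And>A. (\<integral>\<^sup>+y. ennreal (max 0 (A - y\<^sup>2) powr \<delta>) \<partial>lborel) = ennreal (c * max 0 A powr (\<delta> + 1 / 2))"
proof
  define c where "c = (LINT y|lborel. arch \<delta> y)"
  show "0 \<le> c" unfolding c_def by (intro Bochner_Integration.integral_nonneg) (simp add: arch_nonneg)
  fix A :: real
  show "(\<integral>\<^sup>+y. ennreal (max 0 (A - y\<^sup>2) powr \<delta>) \<partial>lborel) = ennreal (c * max 0 A powr (\<delta> + 1 / 2))"
  proof (cases "0 < A")
    case True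
    have "(\<integral>\<^sup>+y. ennreal (max 0 (A - y\<^sup>2) powr \<delta>) \<partial>lborel) =
        ennreal (sqrt A) * (\<integral>\<^sup>+y. ennreal (max 0 (A - (sqrt A * y)\<^sup>2) powr \<delta>) \<partial>lborel)"
      using nn_integral_real_affine[of "\<lambda>y. ennreal (max 0 (A - y\<^sup>2) powr \<delta>)" "sqrt A" 0] True by simp
    also have "(\<integral>\<^sup>+y. ennreal (max 0 (A - (sqrt A * y)\<^sup>2) powr \<delta>) \<partial>lborel) = (\<integral>\<^sup>+y. ennreal (A powr \<delta>) * ennreal (arch \<delta> y) \<partial>lborel)"
    proof (intro nn_integral_cong)
      fix y :: real
      have "max 0 (A - (sqrt A * y)\<^sup>2) = A * max 0 (1 - y\<^sup>2)"
        using True by (simp add: max_mult_distrib_left power_mult_distrib algebra_simps)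
      then show "ennreal (max 0 (A - (sqrt A * y)\<^sup>2) powr \<delta>) = ennreal (A powr \<delta>) * ennreal (arch \<delta> y)"
        using True by (simp add: arch_def powr_mult ennreal_mult)
    qed
    also have "\<dots> = ennreal (A powr \<delta>) * ennreal c"
      using integrable_arch[OF assms] unfolding c_def
      by (simp add: nn_integral_cmult nn_integral_eq_integral arch_nonneg)
    also have "ennreal (sqrt A) * \<dots> = ennreal (c * max 0 A powr (\<delta> + 1 / 2))"
      using True \<open>0 \<le> c\<close> by (simp add: ennreal_mult[symmetric] powr_add powr_half_sqrt ac_simps)
    finally show ?thesis .
  next
    case False
    have "A - y\<^sup>2 \<le> 0" for y using False zero_le_power2[of y] by linarith
    then have "max 0 (A - y\<^sup>2) = 0" for y by simp
    then show ?thesis using False by simp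
  qed
qed

text \<open>Each coordinate integrated out raises the exponent by 1/2, the gain coming from the
  Jacobian \<open>sqrt A\<close>. Leaving \<open>A\<close> general makes the induction work, as
  fixing the coordinate \<open>y\<close> replaces \<open>A\<close> by
  \<open>A - y\<^sup>2\<close>.\<close>

lemma nn_integral_PiM_ball:
  assumes "finite J" "0 \<le> \<delta>"
  shows "\<exists>c\<ge>0. \<forall>A. (\<integral>\<^sup>+x. ennreal (max 0 (A - (\<Sum>b\<in>J. (x b)\<^sup>2)) powr \<delta>) \<partial>(\<Pi>\<^sub>M b\<in>J. lborel)) =
    ennreal (c * max 0 A powr (\<delta> + real (card J) / 2))"
  using assms(1)
proof (induction J)
  case empty
  show ?case by (intro exI[of _ 1] conjI allI, simp, subst lborel_product.nn_integral_empty) auto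
next
  case (insert i J)
  then obtain c where c: "0 \<le> c" "\<And>A. (\<integral>\<^sup>+x. ennreal (max 0 (A - (\<Sum>b\<in>J. (x b)\<^sup>2)) powr \<delta>) \<partial>(\<Pi>\<^sub>M b\<in>J. lborel)) =
    ennreal (c * max 0 A powr (\<delta> + real (card J) / 2))" by blast
  have "0 \<le> \<delta> + real (card J) / 2" using assms(2) by simp
  then obtain c' where c': "0 \<le> c'" "\<And>A. (\<integral>\<^sup>+y. ennreal (max 0 (A - y\<^sup>2) powr (\<delta> + real (card J) / 2)) \<partial>lborel) =
     ennreal (c' * max 0 A powr (\<delta> + real (card J) / 2 + 1 / 2))"
    by (rule nn_integral_semicircle) blast
  have "(\<integral>\<^sup>+x. ennreal (max 0 (A - (\<Sum>b\<in>insert i J. (x b)\<^sup>2)) powr \<delta>) \<partial>(\<Pi>\<^sub>M b\<in>insert i J. lborel)) =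
    ennreal (c * c' * max 0 A powr (\<delta> + real (card (insert i J)) / 2))" for A
  proof -
    have "(\<integral>\<^sup>+x. ennreal (max 0 (A - (\<Sum>b\<in>insert i J. (x b)\<^sup>2)) powr \<delta>) \<partial>(\<Pi>\<^sub>M b\<in>insert i J. lborel)) =
      (\<integral>\<^sup>+y. (\<integral>\<^sup>+x. ennreal (max 0 (A - (\<Sum>b\<in>insert i J. ((x(i := y)) b)\<^sup>2)) powr \<delta>) \<partial>(\<Pi>\<^sub>M b\<in>J. lborel)) \<partial>lborel)"
      using insert.hyps by (intro lborel_product.product_nn_integral_insert_rev) auto
    also have "\<dots> = (\<integral>\<^sup>+y. (\<integral>\<^sup>+x. ennreal (max 0 ((A - y\<^sup>2) - (\<Sum>b\<in>J. (x b)\<^sup>2)) powr \<delta>) \<partial>(\<Pi>\<^sub>M b\<in>J. lborel)) \<partial>lborel)"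
    proof (intro nn_integral_cong)
      fix y :: real and x :: "'a \<Rightarrow> real"
      have "(\<Sum>b\<in>J. ((x(i := y)) b)\<^sup>2) = (\<Sum>b\<in>J. (x b)\<^sup>2)"
        using insert.hyps by (intro sum.cong) auto
      then show "ennreal (max 0 (A - (\<Sum>b\<in>insert i J. ((x(i := y)) b)\<^sup>2)) powr \<delta>) =
          ennreal (max 0 ((A - y\<^sup>2) - (\<Sum>b\<in>J. (x b)\<^sup>2)) powr \<delta>)"
        using insert.hyps by (simp add: diff_diff_eq)
    qed
    also have "\<dots> = (\<integral>\<^sup>+y. ennreal c * ennreal (max 0 (A - y\<^sup>2) powr (\<delta> + real (card J) / 2)) \<partial>lborel)"
      unfolding c(2) using c(1) by (simp add: ennreal_mult)
    also have "\<dots> = ennreal c * ennreal (c' * max 0 A powr (\<delta> + real (card J) / 2 + 1 / 2))"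
      by (simp add: nn_integral_cmult c'(2))
    also have "\<dots> = ennreal (c * c' * max 0 A powr (\<delta> + real (card (insert i J)) / 2))"
      using c(1) c'(1) insert.hyps by (simp add: ennreal_mult[symmetric] mult.assoc add_divide_distrib ac_simps)
    finally show ?thesis .
  qed
  then show ?case using c(1) c'(1) by (intro exI[of _ "c * c'"]) auto
qed

definition br_multiplier :: "real \<Rightarrow> real ^ 'n::finite \<Rightarrow> real" where
  "br_multiplier \<delta> \<xi> = max 0 (1 - (norm \<xi>)\<^sup>2) powr \<delta>"

lemma br_multiplier_measurable [measurable]: "br_multiplier \<delta> \<in> borel_measurable borel"
  unfolding br_multiplier_def by measurable

lemma br_multiplier_nonneg: "0 \<le> br_multiplier \<delta> \<xi>"
  by (simp add: br_multiplier_def)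

lemma br_multiplier_eq_0: "1 \<le> norm \<xi> \<Longrightarrow> br_multiplier \<delta> \<xi> = 0"
  using arch_eq_0[of "norm \<xi>" \<delta>] by (simp add: br_multiplier_def arch_def)

lemma integrable_br_multiplier:
  assumes "0 \<le> \<delta>" shows "integrable lborel (br_multiplier \<delta> :: real ^ 'n::finite \<Rightarrow> real)"
proof (rule Bochner_Integration.integrable_bound)
  show "integrable lborel (\<lambda>\<xi>::real ^ 'n. indicator (cball 0 1) \<xi> :: real)"
    using emeasure_lborel_cball_finite[of "0 :: real ^ 'n" 1] by (intro integrable_real_indicator) auto
  have "norm (br_multiplier \<delta> \<xi>) \<le> norm (indicator (cball 0 1) \<xi> :: real)" for \<xi> :: "real ^ 'n"
  proof (cases "norm \<xi> \<le> 1")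
    case True
    have "br_multiplier \<delta> \<xi> \<le> 1 powr \<delta>" unfolding br_multiplier_def using assms by (intro powr_mono2) auto
    then show ?thesis using True by (simp add: br_multiplier_nonneg)
  qed (simp add: br_multiplier_eq_0)
  then show "AE \<xi> in lborel. norm (br_multiplier \<delta> \<xi>) \<le> norm (indicator (cball 0 1) (\<xi> :: real ^ 'n) :: real)" by simp
qed simp

text \<open>This reduction to one dimension replaces the asymptotics of Bessel functions.\<close>

lemma nn_integral_br_multiplier_marginal:
  fixes i :: "'n::finite"
  assumes "0 \<le> \<delta>"
  obtains c where "0 \<le> c" "\<And>g. g \<in> borel_measurable borel \<Longrightarrow>
    (\<integral>\<^sup>+\<xi>. ennreal (br_multiplier \<delta> (\<xi> :: real ^ 'n)) * g (\<xi> $ i) \<partial>lborel) =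
    (\<integral>\<^sup>+s. ennreal (c * arch (\<delta> + (real CARD('n) - 1) / 2) s) * g s \<partial>lborel)"
proof -
  let ?b = "axis i 1 :: real ^ 'n"
  have b: "?b \<in> Basis" by (simp add: axis_in_Basis_iff)
  define J where "J = Basis - {?b}"
  have J: "finite J" "?b \<notin> J" "insert ?b J = Basis" using b by (auto simp: J_def)
  have cardJ: "real (card J) = real CARD('n) - 1"
    using b by (simp add: J_def card_Diff_singleton of_nat_diff Suc_leI)
  obtain c where c: "0 \<le> c" "\<And>A. (\<integral>\<^sup>+x. ennreal (max 0 (A - (\<Sum>b\<in>J. (x b)\<^sup>2)) powr \<delta>) \<partial>(\<Pi>\<^sub>M b\<in>J. lborel)) =
    ennreal (c * max 0 A powr (\<delta> + real (card J) / 2))"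
    using nn_integral_PiM_ball[OF J(1) assms] by blast
  have "(\<integral>\<^sup>+\<xi>. ennreal (br_multiplier \<delta> (\<xi> :: real ^ 'n)) * g (\<xi> $ i) \<partial>lborel) =
    (\<integral>\<^sup>+s. ennreal (c * arch (\<delta> + (real CARD('n) - 1) / 2) s) * g s \<partial>lborel)"
    if g[measurable]: "g \<in> borel_measurable borel" for g
  proof -
    let ?S = "\<lambda>f. \<Sum>b\<in>Basis. f b *\<^sub>R (b :: real ^ 'n)"
    have [measurable]: "(\<lambda>w :: real ^ 'n. w $ i) \<in> borel_measurable borel"
      by (intro borel_measurable_continuous_onI continuous_intros)
    have S_i: "?S f $ i = f ?b" for f :: "real ^ 'n \<Rightarrow> real"
    proof -
      have "?S f $ i = ?S f \<bullet> ?b" by (simp add: inner_axis)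
      then show ?thesis using b by (simp add: inner_sum_left_Basis)
    qed
    have S_n: "(norm (?S f))\<^sup>2 = (f ?b)\<^sup>2 + (\<Sum>b\<in>J. (f b)\<^sup>2)" for f :: "real ^ 'n \<Rightarrow> real"
    proof -
      have "(norm (?S f))\<^sup>2 = (\<Sum>b\<in>Basis. (?S f \<bullet> b)\<^sup>2)"
        unfolding power2_norm_eq_inner euclidean_inner[of "?S f" "?S f"] by (simp add: power2_eq_square)
      also have "\<dots> = (\<Sum>b\<in>Basis. (f b)\<^sup>2)" by (intro sum.cong) (auto simp: inner_sum_left_Basis)
      also have "\<dots> = (f ?b)\<^sup>2 + (\<Sum>b\<in>J. (f b)\<^sup>2)" using J(1,2) unfolding J(3)[symmetric] by simp
      finally show ?thesis .
    qed
    \<comment> \<open>Lebesgue measure is the image of the product measure indexed by the basis,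
      from which the direction of \<open>i\<close> is then split off.\<close>
    have "(\<integral>\<^sup>+\<xi>. ennreal (br_multiplier \<delta> (\<xi> :: real ^ 'n)) * g (\<xi> $ i) \<partial>lborel) =
      (\<integral>\<^sup>+\<xi>. ennreal (br_multiplier \<delta> \<xi>) * g (\<xi> $ i) \<partial>(distr (\<Pi>\<^sub>M b\<in>Basis. lborel) borel ?S))"
      by (simp only: lborel_eq[symmetric])
    also have "\<dots> = (\<integral>\<^sup>+f. ennreal (br_multiplier \<delta> (?S f)) * g (?S f $ i) \<partial>(\<Pi>\<^sub>M b\<in>Basis. lborel))"
      by (intro nn_integral_distr) measurable
    also have "\<dots> = (\<integral>\<^sup>+f. ennreal (max 0 (1 - ((f ?b)\<^sup>2 + (\<Sum>b\<in>J. (f b)\<^sup>2))) powr \<delta>) * g (f ?b) \<partial>(\<Pi>\<^sub>M b\<in>insert ?b J. lborel))"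
      unfolding J(3) S_i br_multiplier_def S_n ..
    also have "\<dots> = (\<integral>\<^sup>+y. (\<integral>\<^sup>+f. ennreal (max 0 (1 - (((f(?b := y)) ?b)\<^sup>2 + (\<Sum>b\<in>J. ((f(?b := y)) b)\<^sup>2))) powr \<delta>) * g ((f(?b := y)) ?b)
        \<partial>(\<Pi>\<^sub>M b\<in>J. lborel)) \<partial>lborel)"
      using J(1,2) by (intro lborel_product.product_nn_integral_insert_rev) auto
    also have "\<dots> = (\<integral>\<^sup>+y. (\<integral>\<^sup>+f. ennreal (max 0 ((1 - y\<^sup>2) - (\<Sum>b\<in>J. (f b)\<^sup>2)) powr \<delta>) * g y \<partial>(\<Pi>\<^sub>M b\<in>J. lborel)) \<partial>lborel)"
    proof (intro nn_integral_cong)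
      fix y :: real and f :: "real ^ 'n \<Rightarrow> real"
      have "(\<Sum>b\<in>J. ((f(?b := y)) b)\<^sup>2) = (\<Sum>b\<in>J. (f b)\<^sup>2)" using J(2) by (intro sum.cong) auto
      then show "ennreal (max 0 (1 - (((f(?b := y)) ?b)\<^sup>2 + (\<Sum>b\<in>J. ((f(?b := y)) b)\<^sup>2))) powr \<delta>) * g ((f(?b := y)) ?b) =
        ennreal (max 0 ((1 - y\<^sup>2) - (\<Sum>b\<in>J. (f b)\<^sup>2)) powr \<delta>) * g y"
        by (simp add: diff_diff_eq)
    qed
    also have "\<dots> = (\<integral>\<^sup>+y. ennreal (c * max 0 (1 - y\<^sup>2) powr (\<delta> + real (card J) / 2)) * g y \<partial>lborel)"
      by (intro nn_integral_cong) (subst nn_integral_multc, measurable, simp add: c(2))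
    finally show ?thesis unfolding arch_def cardJ .
  qed
  then show thesis using that c(1) by blast
qed

text \<open>The identity for nonnegative integrands says that two measures on the line coincide, and
  so it carries over to complex integrands.\<close>

lemma integral_br_multiplier_marginal:
  fixes i :: "'n::finite"
  assumes "0 \<le> \<delta>"
  obtains c where "0 \<le> c" "\<And>G :: real \<Rightarrow> complex. G \<in> borel_measurable borel \<Longrightarrow>
    (LINT \<xi>|lborel. of_real (br_multiplier \<delta> (\<xi> :: real ^ 'n)) * G (\<xi> $ i)) =
    of_real c * (LINT s|lborel. of_real (arch (\<delta> + (real CARD('n) - 1) / 2) s) * G s)"
proof -
  let ?\<nu> = "\<delta> + (real CARD('n) - 1) / 2"
  obtain c where c: "0 \<le> c" "\<And>g. g \<in> borel_measurable borel \<Longrightarrow>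
    (\<integral>\<^sup>+\<xi>. ennreal (br_multiplier \<delta> (\<xi> :: real ^ 'n)) * g (\<xi> $ i) \<partial>lborel) =
    (\<integral>\<^sup>+s. ennreal (c * arch ?\<nu> s) * g s \<partial>lborel)"
    by (rule nn_integral_br_multiplier_marginal[OF assms, of i]) blast
  have [measurable]: "(\<lambda>w :: real ^ 'n. w $ i) \<in> borel_measurable borel"
    by (intro borel_measurable_continuous_onI continuous_intros)
  let ?\<mu> = "distr (density lborel (\<lambda>\<xi>. ennreal (br_multiplier \<delta> (\<xi> :: real ^ 'n)))) borel (\<lambda>\<xi>. \<xi> $ i)"
  let ?\<mu>' = "density lborel (\<lambda>s. ennreal (c * arch ?\<nu> s))"
  have eq: "?\<mu> = ?\<mu>'"
  proof (rule measure_eqI)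
    fix A assume "A \<in> sets ?\<mu>"
    then have A[measurable]: "A \<in> sets borel" by simp
    have "emeasure ?\<mu> A = (\<integral>\<^sup>+\<xi>. ennreal (br_multiplier \<delta> (\<xi> :: real ^ 'n)) * indicator A (\<xi> $ i) \<partial>lborel)"
      by (subst emeasure_distr, measurable, subst emeasure_density, measurable)
        (auto intro!: nn_integral_cong simp: indicator_def)
    also have "\<dots> = emeasure ?\<mu>' A"
      by (subst c(2), measurable, subst emeasure_density, measurable)
    finally show "emeasure ?\<mu> A = emeasure ?\<mu>' A" .
  qed simp
  have "(LINT \<xi>|lborel. of_real (br_multiplier \<delta> (\<xi> :: real ^ 'n)) * G (\<xi> $ i)) =
    of_real c * (LINT s|lborel. of_real (arch ?\<nu> s) * G s)" if [measurable]: "G \<in> borel_measurable borel"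
    for G :: "real \<Rightarrow> complex"
  proof -
    have "(LINT \<xi>|lborel. of_real (br_multiplier \<delta> (\<xi> :: real ^ 'n)) * G (\<xi> $ i)) =
      (LINT \<xi>|density lborel (\<lambda>\<xi>. ennreal (br_multiplier \<delta> (\<xi> :: real ^ 'n))). G (\<xi> $ i))"
      by (subst integral_density) (auto simp: br_multiplier_nonneg scaleR_conv_of_real)
    also have "\<dots> = (LINT s|?\<mu>. G s)"
      by (subst integral_distr) auto
    also have "\<dots> = (LINT s|lborel. (c * arch ?\<nu> s) *\<^sub>R G s)"
      unfolding eq using c(1) by (subst integral_density) (auto simp: arch_nonneg)
    also have "\<dots> = (LINT s|lborel. of_real c * (of_real (arch ?\<nu> s) * G s))"
      by (simp add: scaleR_conv_of_real mult.assoc)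
    also have "\<dots> = of_real c * (LINT s|lborel. of_real (arch ?\<nu> s) * G s)"
      by (rule integral_mult_right_zero)
    finally show ?thesis .
  qed
  then show thesis using that c(1) by blast
qed

section \<open>Size of the kernel\<close>

lemma bochner_riesz_kernel_eq:
  "bochner_riesz_kernel \<delta> x = (LINT \<xi>|lborel. of_real (br_multiplier \<delta> (\<xi> :: real ^ 'n::finite)) *
     exp (- 2 * of_real pi * \<i> * of_real (\<xi> \<bullet> x)))"
  unfolding bochner_riesz_kernel_def fourier_def br_multiplier_def[symmetric]
  by (rule integral_completion) measurable

lemma integrable_br_multiplier_exp:
  assumes "0 \<le> \<delta>"
  shows "integrable lborel (\<lambda>\<xi> :: real ^ 'n::finite. of_real (br_multiplier \<delta> \<xi>) *
     exp (- 2 * of_real pi * \<i> * of_real (\<xi> \<bullet> x)) :: complex)"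
proof (rule Bochner_Integration.integrable_bound[OF integrable_br_multiplier[OF assms]])
  show "(\<lambda>\<xi> :: real ^ 'n. of_real (br_multiplier \<delta> \<xi>) *
     exp (- 2 * of_real pi * \<i> * of_real (\<xi> \<bullet> x)) :: complex) \<in> borel_measurable lborel" by measurable
qed (simp add: norm_mult)

text \<open>A rotation aligns \<open>x\<close> with a coordinate axis, so the kernel at
  \<open>x\<close> is a multiple of the one-dimensional transform of the marginal profile at
  \<open>norm x\<close>. The profile has exponent \<open>\<delta> + (n - 1) / 2\<close>, and its
  transform decays at one order more.\<close>

lemma bochner_riesz_kernel_decay:
  assumes "0 \<le> \<delta>"
  obtains C where "0 < C" "\<And>x :: real ^ 'n::finite.
    cmod (bochner_riesz_kernel \<delta> x) \<le> C * (1 + norm x) powr -(\<delta> + (real CARD('n) + 1) / 2)"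
proof -
  fix i :: 'n
  let ?\<nu> = "\<delta> + (real CARD('n) - 1) / 2"
  define K where "K = \<delta> + (real CARD('n) + 1) / 2"
  have K: "?\<nu> + 1 = K" by (simp add: K_def field_simps)
  have "1 \<le> real CARD('n)" by (simp add: Suc_leI)
  then have \<nu>: "0 \<le> ?\<nu>" using assms by simp
  have K0: "0 \<le> K" using assms by (simp add: K_def add_nonneg_nonneg)
  obtain c where c: "0 \<le> c" "\<And>G :: real \<Rightarrow> complex. G \<in> borel_measurable borel \<Longrightarrow>
    (LINT \<xi>|lborel. of_real (br_multiplier \<delta> (\<xi> :: real ^ 'n)) * G (\<xi> $ i)) =
    of_real c * (LINT s|lborel. of_real (arch ?\<nu> s) * G s)"
    by (rule integral_br_multiplier_marginal[OF assms, of i]) blast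
  obtain C1 where C1: "0 < C1" "\<And>r. 0 < r \<Longrightarrow> cmod (fourier1 (arch ?\<nu>) r) \<le> C1 * r powr -(?\<nu> + 1)"
    by (rule fourier1_arch_decay[OF \<nu>]) blast
  have far: "cmod (bochner_riesz_kernel \<delta> x) \<le> c * C1 * norm x powr - K" if "x \<noteq> 0" for x :: "real ^ 'n"
  proof -
    have "norm (axis i 1 :: real ^ 'n) = 1" by simp
    moreover have "norm (x /\<^sub>R norm x) = 1" using that by simp
    ultimately obtain T :: "real ^ 'n \<Rightarrow> real ^ 'n" where T: "orthogonal_transformation T" "T (axis i 1) = x /\<^sub>R norm x"
      using orthogonal_transformation_exists_1[of "axis i 1 :: real ^ 'n" "x /\<^sub>R norm x"] by blast
    let ?f = "\<lambda>\<xi> :: real ^ 'n. of_real (br_multiplier \<delta> \<xi>) * exp (- 2 * of_real pi * \<i> * of_real (\<xi> \<bullet> x)) :: complex"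
    have Tx: "T \<xi> \<bullet> x = norm x * \<xi> $ i" for \<xi>
    proof -
      have "T \<xi> \<bullet> x = norm x * (T \<xi> \<bullet> (x /\<^sub>R norm x))" using that by simp
      also have "\<dots> = norm x * (\<xi> \<bullet> axis i 1)" using T unfolding T(2)[symmetric] by (simp add: orthogonal_transformation_def)
      finally show ?thesis by (simp add: inner_axis)
    qed
    have "bochner_riesz_kernel \<delta> x = (LINT \<xi>|lborel. ?f (T \<xi>))"
      unfolding bochner_riesz_kernel_eq
      by (rule integral_lborel_orthogonal_transformation[OF T(1), symmetric]) measurable
    also have "\<dots> = (LINT \<xi>|lborel. of_real (br_multiplier \<delta> \<xi>) * exp (- 2 * of_real pi * \<i> * of_real (norm x * \<xi> $ i)))"
      using orthogonal_transformation_norm[OF T(1)] by (simp add: Tx br_multiplier_def)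
    also have "\<dots> = of_real c * fourier1 (arch ?\<nu>) (norm x)"
      unfolding fourier1_def by (rule c(2)) measurable
    finally have "cmod (bochner_riesz_kernel \<delta> x) = c * cmod (fourier1 (arch ?\<nu>) (norm x))"
      using c(1) by (simp add: norm_mult)
    also have "\<dots> \<le> c * (C1 * norm x powr -(?\<nu> + 1))"
      using that c(1) by (intro mult_left_mono C1(2)) auto
    finally show ?thesis unfolding K by (simp add: mult.assoc)
  qed
  define I where "I = (LINT \<xi>|lborel. br_multiplier \<delta> (\<xi> :: real ^ 'n))"
  have I: "0 \<le> I" unfolding I_def by (intro Bochner_Integration.integral_nonneg) (simp add: br_multiplier_nonneg)
  have near: "cmod (bochner_riesz_kernel \<delta> x) \<le> I" for x :: "real ^ 'n"
    unfolding bochner_riesz_kernel_eq I_def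
    by (intro norm_integral_le_integral integrable_br_multiplier_exp integrable_br_multiplier assms)
      (simp add: norm_mult br_multiplier_nonneg)
  \<comment> \<open>The factor \<open>2 powr K\<close> pays for comparing \<open>1 + norm x\<close>
    with \<open>max 1 (norm x)\<close>; the summand 1 makes the constant positive.\<close>
  define C where "C = 2 powr K * (I + c * C1 + 1)"
  have C: "0 < C" using I c(1) C1(1) by (simp add: C_def add_nonneg_pos)
  have "cmod (bochner_riesz_kernel \<delta> x) \<le> C * (1 + norm x) powr - K" for x :: "real ^ 'n"
  proof -
    have main: "cmod (bochner_riesz_kernel \<delta> x) \<le> (I + c * C1 + 1) * max 1 (norm x) powr - K"
    proof (cases "1 \<le> norm x")
      case True
      then have "cmod (bochner_riesz_kernel \<delta> x) \<le> c * C1 * norm x powr - K" by (intro far) auto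
      also have "\<dots> \<le> (I + c * C1 + 1) * norm x powr - K" using I by (intro mult_right_mono) auto
      finally show ?thesis using True by (simp add: max_def)
    next
      case False
      have "I \<le> I + c * C1 + 1" using c(1) C1(1) by simp
      then show ?thesis using near[of x] False by (simp add: max_def)
    qed
    have "(2 * max 1 (norm x)) powr - K \<le> (1 + norm x) powr - K"
      using K0 norm_ge_zero[of x] by (intro powr_mono2') linarith+
    then have le: "2 powr K * (2 * max 1 (norm x)) powr - K \<le> 2 powr K * (1 + norm x) powr - K"
      by (rule mult_left_mono) simp
    have eq: "2 powr K * (2 * max 1 (norm x)) powr - K = max 1 (norm x) powr - K"
    proof -
      have "(2 * max 1 (norm x)) powr - K = 2 powr - K * max 1 (norm x) powr - K"
        by (subst powr_mult) auto
      moreover have "2 powr K * 2 powr - K = (1 :: real)" by (simp add: powr_add[symmetric])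
      ultimately show ?thesis by (simp only: mult.assoc[symmetric] mult_1)
    qed
    from le[unfolded eq] have "(I + c * C1 + 1) * max 1 (norm x) powr - K \<le> (I + c * C1 + 1) * (2 powr K * (1 + norm x) powr - K)"
      using I c(1) C1(1) by (intro mult_left_mono) auto
    then show ?thesis using main by (simp add: C_def ac_simps)
  qed
  then show thesis using that C unfolding K_def by blast
qed

section \<open>Bochner-Riesz means\<close>

lemma bochner_riesz_kernel_measurable [measurable]: "bochner_riesz_kernel \<delta> \<in> borel_measurable borel"
proof -
  have "(\<lambda>x. LINT \<xi>|lborel. of_real (br_multiplier \<delta> (\<xi> :: real ^ 'n::finite)) *
     exp (- 2 * of_real pi * \<i> * of_real (\<xi> \<bullet> x)) :: complex) \<in> borel_measurable borel"
    by measurable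
  then show ?thesis by (simp add: bochner_riesz_kernel_eq[abs_def])
qed

lemma schwartz_integrable:
  fixes f :: "real ^ 'n::finite \<Rightarrow> complex"
  assumes "f \<in> schwartz" shows "integrable lborel f"
  using integrable_conv[OF assms, of "\<lambda>_. 1" 1 0] integrable_lborel_reflect[of f 0] by simp

lemma fourier_schwartz_eq:
  fixes f :: "real ^ 'n::finite \<Rightarrow> complex"
  assumes "f \<in> schwartz"
  shows "fourier f \<xi> = (LINT x|lborel. f x * exp (- 2 * of_real pi * \<i> * of_real (x \<bullet> \<xi>)))"
proof -
  note [measurable] = schwartz_measurable[OF assms]
  show ?thesis unfolding fourier_def by (rule integral_completion) measurable
qed

text \<open>By Fubini the inner integral is an exponential times
  \<open>fourier \<psi> (- \<xi>)\<close>, and this transform is 1 wherever the multiplier is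
  nonzero. The minus sign appears because the kernel is a Fourier transform and not an inverse one;
  the unit ball being symmetric, it does no harm.\<close>

lemma conv_bochner_riesz_kernel:
  fixes \<psi> :: "real ^ 'n::finite \<Rightarrow> complex"
  assumes \<delta>: "0 \<le> \<delta>" and \<psi>: "\<psi> \<in> schwartz" and one: "\<And>\<xi>. norm \<xi> \<le> 1 \<Longrightarrow> fourier \<psi> \<xi> = 1"
  shows "conv (bochner_riesz_kernel \<delta>) \<psi> = bochner_riesz_kernel \<delta>"
proof
  fix x :: "real ^ 'n"
  note [measurable] = schwartz_measurable[OF \<psi>]
  let ?e = "\<lambda>y. exp (- 2 * of_real pi * \<i> * of_real y) :: complex"
  have e_norm: "cmod (?e y) = 1" for y :: real by simp
  let ?f = "\<lambda>w \<xi>. of_real (br_multiplier \<delta> \<xi>) * ?e (\<xi> \<bullet> w) * \<psi> (x - w) :: complex"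
  have int_psi: "integrable lborel (\<lambda>w. \<psi> (x - w))"
    using schwartz_integrable[OF \<psi>] integrable_lborel_reflect[of \<psi> x] by simp
  have int: "integrable (lborel \<Otimes>\<^sub>M lborel) (case_prod ?f)"
  proof (rule lborel_pair.Fubini_integrable)
    show "case_prod ?f \<in> borel_measurable (lborel \<Otimes>\<^sub>M lborel)" by measurable
    have "(LINT \<xi>|lborel. norm (case_prod ?f (w, \<xi>))) = (LINT \<xi>|lborel. br_multiplier \<delta> (\<xi> :: real ^ 'n)) * cmod (\<psi> (x - w))" for w
      by (simp add: norm_mult br_multiplier_nonneg)
    then show "integrable lborel (\<lambda>w. LINT \<xi>|lborel. norm (case_prod ?f (w, \<xi>)))"
      using int_psi by simp
    show "AE w in lborel. integrable lborel (\<lambda>\<xi>. case_prod ?f (w, \<xi>))"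
      by (intro AE_I2, simp only: prod.case, intro integrable_mult_left integrable_br_multiplier_exp \<delta>)
  qed
  have inner: "(LINT w|lborel. ?f w \<xi>) = of_real (br_multiplier \<delta> \<xi>) * ?e (\<xi> \<bullet> x)" for \<xi>
  proof (cases "norm \<xi> \<le> 1")
    case True
    have "(LINT w|lborel. ?e (\<xi> \<bullet> w) * \<psi> (x - w)) = (LINT y|lborel. ?e (\<xi> \<bullet> (x - y)) * \<psi> (x - (x - y)))"
      by (rule integral_lborel_reflect[symmetric])
    also have "\<dots> = (LINT y|lborel. ?e (\<xi> \<bullet> x) * (\<psi> y * ?e (y \<bullet> (- \<xi>))))"
    proof (intro Bochner_Integration.integral_cong refl)
      fix y
      have "?e (\<xi> \<bullet> (x - y)) = ?e (\<xi> \<bullet> x) * ?e (y \<bullet> (- \<xi>))"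
        by (simp add: exp_add[symmetric] inner_diff_right inner_commute algebra_simps)
      then show "?e (\<xi> \<bullet> (x - y)) * \<psi> (x - (x - y)) = ?e (\<xi> \<bullet> x) * (\<psi> y * ?e (y \<bullet> (- \<xi>)))"
        by (simp only: diff_diff_eq2 add_diff_cancel_left' ac_simps)
    qed
    also have "\<dots> = ?e (\<xi> \<bullet> x) * fourier \<psi> (- \<xi>)"
      unfolding fourier_schwartz_eq[OF \<psi>] by (rule integral_mult_right_zero)
    also have "\<dots> = ?e (\<xi> \<bullet> x)" using one[of "- \<xi>"] True by simp
    finally show ?thesis by (simp only: mult.assoc integral_mult_right_zero)
  qed (simp add: br_multiplier_eq_0)
  have "conv (bochner_riesz_kernel \<delta>) \<psi> x = (LINT w|lborel. (LINT \<xi>|lborel. ?f w \<xi>))"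
    unfolding conv_def bochner_riesz_kernel_eq by (simp only: integral_mult_left_zero)
  also have "\<dots> = (LINT \<xi>|lborel. (LINT w|lborel. ?f w \<xi>))"
    by (rule lborel_pair.Fubini_integral[OF int, symmetric])
  also have "\<dots> = bochner_riesz_kernel \<delta> x" unfolding inner bochner_riesz_kernel_eq ..
  finally show "conv (bochner_riesz_kernel \<delta>) \<psi> x = bochner_riesz_kernel \<delta> x" .
qed

text \<open>A value above \<open>B * s\<close> at \<open>x\<close> would force \<open>H > s\<close>
  almost everywhere on the unit ball about \<open>x\<close>. The weak bound excludes this once
  \<open>s\<close> is so large that the superlevel set has at most half the volume of that
  ball.\<close>

lemma distr_convolution_bounded:
  fixes u :: "(real ^ 'n::finite \<Rightarrow> complex) \<Rightarrow> complex"
  assumes u: "tempered_functional u" and f: "f \<in> schwartz" and p: "0 < p"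
    and H [measurable]: "H \<in> borel_measurable lebesgue" and GH: "AE z in lebesgue. grand_maximal N u z = ennreal (H z)"
    and A: "0 \<le> A" and HA: "\<And>s. 0 < s \<Longrightarrow> emeasure lebesgue {x. s < H x} \<le> ennreal ((A / s) powr p)"
  shows "bounded (range (distr_convolution f u))"
proof -
  obtain B where B: "0 < B" "\<And>\<alpha> x. length \<alpha> \<le> N + 1 \<Longrightarrow>
      cmod (iterated_deriv \<alpha> f x) \<le> B * (1 + norm x) powr -real (N + CARD('n) + 1)"
    by (rule schwartz_decay[OF f]) blast
  define w where "w = unit_ball_vol (real CARD('n))"
  have w: "0 < w" by (simp add: w_def)
  \<comment> \<open>Ensures \<open>(A / s) powr p \<le> w / 2\<close>; the summand 1 keeps
    \<open>s\<close> positive when \<open>A = 0\<close>.\<close>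
  define s where "s = A / (w / 2) powr (1 / p) + 1"
  have s: "0 < s" unfolding s_def using A by (intro add_nonneg_pos) auto
  have wp: "0 < (w / 2) powr (1 / p)" using w by simp
  have "A = A / (w / 2) powr (1 / p) * (w / 2) powr (1 / p)" using wp by simp
  also have "\<dots> \<le> s * (w / 2) powr (1 / p)" using wp by (intro mult_right_mono) (auto simp: s_def)
  finally have "A / s \<le> (w / 2) powr (1 / p)" using s by (simp add: divide_le_eq mult.commute)
  then have "(A / s) powr p \<le> ((w / 2) powr (1 / p)) powr p" using A s p by (intro powr_mono2) auto
  then have small: "(A / s) powr p \<le> w / 2" using w p by (simp add: powr_powr)
  have meas: "{x. s < H x} \<in> sets lebesgue"
    using measurable_sets[OF H, of "{s<..}"] by (simp add: vimage_def)
  have "cmod (distr_convolution f u x) \<le> B * s" for x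
  proof (rule ccontr)
    assume "\<not> cmod (distr_convolution f u x) \<le> B * s"
    then have big: "B * s < cmod (u (\<lambda>y. dilate 1 f (x - y)))"
      by (simp add: distr_convolution_def dilate_def)
    have "AE z in lebesgue. z \<in> ball x 1 \<longrightarrow> z \<in> {x. s < H x}"
      using GH
    proof eventually_elim
      case (elim z)
      show ?case
      proof
        assume "z \<in> ball x 1"
        then have "norm (x - 1 *\<^sub>R 0 - z) < 1" by (simp add: dist_norm)
        then have "ennreal (cmod (u (\<lambda>y. dilate 1 f (x - y)))) \<le> ennreal B * grand_maximal N u z"
          using B by (intro localized_le_grand_maximal[OF u f B(1), where k=0]) auto
        also have "\<dots> = ennreal B * ennreal (H z)" using elim by simp
        finally have le: "ennreal (cmod (u (\<lambda>y. dilate 1 f (x - y)))) \<le> ennreal B * ennreal (H z)" .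
        have "0 < H z"
        proof (rule ccontr)
          assume "\<not> 0 < H z"
          then have "ennreal (H z) = 0" by (simp add: ennreal_neg)
          then show False using le big B(1) s mult_pos_pos[OF B(1) s] by simp
        qed
        then have "cmod (u (\<lambda>y. dilate 1 f (x - y))) \<le> B * H z"
          using le B(1) by (simp add: ennreal_mult[symmetric] ennreal_le_iff)
        then have "B * s < B * H z" using big by simp
        then show "z \<in> {x. s < H x}" using B(1) by simp
      qed
    qed
    then have "emeasure lebesgue (ball x 1) \<le> emeasure lebesgue {x. s < H x}"
      using meas by (rule emeasure_mono_AE)
    also have "\<dots> \<le> ennreal (w / 2)" using HA[OF s] small by (meson ennreal_leI order_trans)
    finally have "ennreal w \<le> ennreal (w / 2)"
      using emeasure_ball[of 1 x] by (simp add: w_def)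
    then show False using w by (simp add: ennreal_le_iff)
  qed
  then show ?thesis unfolding bounded_iff by blast
qed

lemma continuous_distr_convolution:
  assumes u: "tempered_functional u" and f: "f \<in> schwartz"
  shows "continuous_on UNIV (distr_convolution f u)"
proof -
  have "continuous_on UNIV (\<lambda>w. u (\<lambda>z. (\<lambda>y. f (- 1 *\<^sub>R y + 0)) (z - w)))"
    using f by (intro continuous_tempered_functional_translate[OF u] schwartz_affine) auto
  then show ?thesis by (simp add: distr_convolution_def[abs_def])
qed

lemma bochner_riesz_eq:
  fixes u :: "(real ^ 'n::finite \<Rightarrow> complex) \<Rightarrow> complex"
  assumes u: "tempered_functional u" and f: "f \<in> schwartz" and R: "0 < R"
  shows "bochner_riesz \<delta> R f u x =
    (LINT w|lborel. bochner_riesz_kernel \<delta> w * distr_convolution f u (x - (1 / R) *\<^sub>R w))"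
proof -
  let ?F = "distr_convolution f u" and ?\<phi> = "bochner_riesz_kernel \<delta> :: real ^ 'n \<Rightarrow> complex"
  have [measurable]: "?F \<in> borel_measurable borel"
    by (rule borel_measurable_continuous_onI[OF continuous_distr_convolution[OF u f]])
  have [measurable]: "dilate (1 / R) ?\<phi> \<in> borel_measurable borel" unfolding dilate_def by measurable
  have "bochner_riesz \<delta> R f u x = (LINT y|lborel. dilate (1 / R) ?\<phi> (x - y) * ?F y)"
    unfolding bochner_riesz_def convolution_def by (rule integral_completion) measurable
  also have "\<dots> = (\<bar>- (1 / R)\<bar> ^ CARD('n)) *\<^sub>R
      (LINT w|lborel. dilate (1 / R) ?\<phi> (x - (x + (- (1 / R)) *\<^sub>R w)) * ?F (x + (- (1 / R)) *\<^sub>R w))"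
    using R integral_lborel_affine[of "- (1 / R)" "\<lambda>y. dilate (1 / R) ?\<phi> (x - y) * ?F y" x] by simp
  also have "\<dots> = (LINT w|lborel. (\<bar>- (1 / R)\<bar> ^ CARD('n)) *\<^sub>R
      (dilate (1 / R) ?\<phi> (x - (x + (- (1 / R)) *\<^sub>R w)) * ?F (x + (- (1 / R)) *\<^sub>R w)))"
    by (rule integral_scaleR_right[symmetric])
  also have "\<dots> = (LINT w|lborel. ?\<phi> w * ?F (x - (1 / R) *\<^sub>R w))"
    using R by (intro Bochner_Integration.integral_cong refl) (simp add: dilate_def power_one_over)
  finally show ?thesis .
qed

lemma integrable_bochner_riesz_kernel:
  assumes "(real CARD('n) - 1) / 2 < \<delta>" "0 \<le> \<delta>"
  shows "integrable lborel (bochner_riesz_kernel \<delta> :: real ^ 'n::finite \<Rightarrow> complex)"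
proof -
  obtain C where C: "0 < C" "\<And>x :: real ^ 'n.
    cmod (bochner_riesz_kernel \<delta> x) \<le> C * (1 + norm x) powr -(\<delta> + (real CARD('n) + 1) / 2)"
    by (rule bochner_riesz_kernel_decay[OF assms(2)]) blast
  show ?thesis
  proof (rule Bochner_Integration.integrable_bound)
    have "real DIM(real ^ 'n) < \<delta> + (real CARD('n) + 1) / 2" using assms(1) by (simp add: field_simps)
    then show "integrable lborel (\<lambda>x :: real ^ 'n. C * (1 + norm x) powr -(\<delta> + (real CARD('n) + 1) / 2))"
      by (intro integrable_mult_right integrable_norm_powr)
  qed (use C order_trans[OF C(2) abs_ge_self] in auto)
qed

text \<open>Dominated convergence, the majorant being the integrable kernel times a bound for the
  convolution. The result serves to make superlevel sets of the maximal operator open.\<close>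

lemma continuous_bochner_riesz:
  fixes u :: "(real ^ 'n::finite \<Rightarrow> complex) \<Rightarrow> complex"
  assumes u: "tempered_functional u" and f: "f \<in> schwartz" and R: "0 < R"
    and \<phi>: "integrable lborel (bochner_riesz_kernel \<delta> :: real ^ 'n \<Rightarrow> complex)"
    and bdd: "bounded (range (distr_convolution f u))"
  shows "continuous_on UNIV (bochner_riesz \<delta> R f u)"
proof (intro continuous_at_imp_continuous_on ballI continuous_at_sequentiallyI)
  let ?F = "distr_convolution f u" and ?\<phi> = "bochner_riesz_kernel \<delta> :: real ^ 'n \<Rightarrow> complex"
  obtain D where D: "\<And>x. cmod (?F x) \<le> D" using bdd unfolding bounded_iff by blast
  note contF = continuous_distr_convolution[OF u f]
  have [measurable]: "?F \<in> borel_measurable borel" by (rule borel_measurable_continuous_onI[OF contF])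
  fix x and X :: "nat \<Rightarrow> real ^ 'n" assume X: "X \<longlonglongrightarrow> x"
  show "(\<lambda>k. bochner_riesz \<delta> R f u (X k)) \<longlonglongrightarrow> bochner_riesz \<delta> R f u x"
    unfolding bochner_riesz_eq[OF u f R]
  proof (rule integral_dominated_convergence[where w="\<lambda>w. cmod (?\<phi> w) * D"])
    show "integrable lborel (\<lambda>w. cmod (?\<phi> w) * D)" using \<phi> by simp
    have "(\<lambda>k. ?\<phi> w * ?F (X k - (1 / R) *\<^sub>R w)) \<longlonglongrightarrow> ?\<phi> w * ?F (x - (1 / R) *\<^sub>R w)" for w
      using contF by (intro tendsto_mult tendsto_const continuous_on_tendsto_compose[OF contF] tendsto_diff X) auto
    then show "AE w in lborel. (\<lambda>k. ?\<phi> w * ?F (X k - (1 / R) *\<^sub>R w)) \<longlonglongrightarrow> ?\<phi> w * ?F (x - (1 / R) *\<^sub>R w)"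
      by simp
    show "AE w in lborel. norm (?\<phi> w * ?F (X k - (1 / R) *\<^sub>R w)) \<le> cmod (?\<phi> w) * D" for k
      using D by (simp add: norm_mult mult_left_mono)
  qed measurable
qed

text \<open>\<open>C\<close> does not depend on \<open>\<psi>\<close>: constants attached to the
  rescaled cutoff \<open>\<psi>'\<close> enter only through a remainder that vanishes as
  \<open>M\<close> grows, so the functions \<open>g M\<close> with large \<open>M\<close> share the
  bound \<open>B\<close>.\<close>

lemma bochner_riesz_le_hl_maximal:
  fixes \<beta> :: "real ^ 'n::finite \<Rightarrow> complex"
  assumes \<delta>: "0 \<le> \<delta>" and \<beta>: "\<beta> \<in> schwartz" and \<beta>1: "\<And>\<xi>. norm \<xi> \<le> 1 \<Longrightarrow> fourier \<beta> \<xi> = 1"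
    and q: "0 < q" "q \<le> 1" and \<kappa>q: "real CARD('n) < \<kappa> * q" and \<kappa>: "\<kappa> < \<delta> + (real CARD('n) + 1) / 2"
    and n\<kappa>: "real CARD('n) \<le> \<kappa>"
  obtains C where "0 < C" "\<And>(u :: (real ^ 'n \<Rightarrow> complex) \<Rightarrow> complex) H R \<psi> x. tempered_functional u \<Longrightarrow>
    H \<in> borel_measurable lebesgue \<Longrightarrow> \<forall>z. 0 \<le> H z \<Longrightarrow>
    AE z in lebesgue. grand_maximal N u z = ennreal (H z) \<Longrightarrow> 0 < R \<Longrightarrow> \<psi> \<in> frequency_cutoffs R \<Longrightarrow>
    bounded (range (distr_convolution \<psi> u)) \<Longrightarrow>
    ennreal (cmod (bochner_riesz \<delta> R \<psi> u x) powr q) \<le> ennreal C * hl_maximal (\<lambda>z. ennreal (H z powr q)) x"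
proof -
  define K where "K = \<delta> + (real CARD('n) + 1) / 2"
  let ?\<phi> = "bochner_riesz_kernel \<delta> :: real ^ 'n \<Rightarrow> complex"
  have \<kappa>0: "0 \<le> \<kappa>" using n\<kappa> by (rule order_trans[rotated]) simp
  have \<kappa>K: "\<kappa> < K" using \<kappa> by (simp add: K_def)
  obtain C\<phi> where C\<phi>: "0 < C\<phi>" "\<And>x :: real ^ 'n. cmod (?\<phi> x) \<le> C\<phi> * (1 + norm x) powr -K"
    unfolding K_def by (rule bochner_riesz_kernel_decay[OF \<delta>]) blast
  have \<phi>b: "cmod (?\<phi> x) \<le> C\<phi>" for x
  proof -
    have "(1 + norm x) powr -K \<le> 1" using \<kappa>K \<kappa>0 by (simp add: powr_minus inverse_le_1_iff ge_one_powr_ge_zero)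
    then have "C\<phi> * (1 + norm x) powr -K \<le> C\<phi> * 1" using C\<phi>(1) by (intro mult_left_mono) auto
    then show ?thesis using C\<phi>(2)[of x] by simp
  qed
  have \<phi>\<kappa>: "cmod (?\<phi> w) \<le> C\<phi> * (1 + norm (w - 0)) powr -\<kappa>" for w
  proof -
    have "(1 + norm w) powr -K \<le> (1 + norm w) powr -\<kappa>" using \<kappa>K by (intro powr_mono) auto
    then have "C\<phi> * (1 + norm w) powr -K \<le> C\<phi> * (1 + norm w) powr -\<kappa>" using C\<phi>(1) by (intro mult_left_mono) auto
    then show ?thesis using C\<phi>(2)[of w] by simp
  qed
  have \<phi>int: "integrable lborel ?\<phi>"
  proof (rule integrable_bochner_riesz_kernel[OF _ \<delta>])
    show "(real CARD('n) - 1) / 2 < \<delta>" using n\<kappa> \<kappa> by (simp add: field_simps)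
  qed
  obtain C0 where C0: "0 < C0" "\<And>h A D a \<alpha> x. h \<in> borel_measurable borel \<Longrightarrow>
    (\<And>w. cmod (h w) \<le> D) \<Longrightarrow> (\<And>w. cmod (h w) \<le> A * (1 + norm (w - a)) powr -\<kappa>) \<Longrightarrow> length \<alpha> \<le> N + 1 \<Longrightarrow>
    cmod (iterated_deriv \<alpha> (conv h \<beta>) x) \<le> A * C0 * (1 + norm (x - a)) powr -\<kappa>"
    by (rule conv_decay[OF \<beta>, where m="N + 1" and s=\<kappa>]) blast
  \<comment> \<open>\<open>C\<phi> * C0\<close> bounds the kernel and its derivatives, and 1 is the
    allowance for the truncation remainder.\<close>
  define B where "B = C\<phi> * C0 + 1"
  have B: "0 < B" using C\<phi>(1) C0(1) by (simp add: B_def add_pos_pos)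
  have \<phi>deriv: "cmod (iterated_deriv \<alpha> ?\<phi> x) \<le> C\<phi> * C0 * (1 + norm x) powr -\<kappa>" if "length \<alpha> \<le> N + 1" for \<alpha> x
    using C0(2)[OF bochner_riesz_kernel_measurable \<phi>b \<phi>\<kappa> that, of x] conv_bochner_riesz_kernel[OF \<delta> \<beta> \<beta>1] by simp
  have one: "(LINT w|lborel. \<beta> w) = 1"
    using \<beta>1[of 0] by (simp add: fourier_schwartz_eq[OF \<beta>])
  obtain C1 where C1: "0 < C1" "\<And>(u :: (real ^ 'n \<Rightarrow> complex) \<Rightarrow> complex) H g B x t. tempered_functional u \<Longrightarrow>
    H \<in> borel_measurable lebesgue \<Longrightarrow> \<forall>z. 0 \<le> H z \<Longrightarrow>
    AE z in lebesgue. grand_maximal N u z = ennreal (H z) \<Longrightarrow> g \<in> schwartz \<Longrightarrow> 0 < B \<Longrightarrow>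
    \<forall>\<alpha> x. length \<alpha> \<le> N + 1 \<longrightarrow> cmod (iterated_deriv \<alpha> g x) \<le> B * (1 + norm x) powr -\<kappa> \<Longrightarrow> 0 < t \<Longrightarrow>
    ennreal (cmod (u (\<lambda>y. dilate t g (x - y))) powr q) \<le>
      ennreal (C1 * B powr q) * hl_maximal (\<lambda>z. ennreal (H z powr q)) x"
    by (rule tempered_functional_le_hl_maximal[OF \<beta> one q \<kappa>q, where N=N]) blast
  have "ennreal (cmod (bochner_riesz \<delta> R \<psi> u x) powr q) \<le> ennreal (C1 * B powr q) * hl_maximal (\<lambda>z. ennreal (H z powr q)) x"
    if u: "tempered_functional u" and H: "H \<in> borel_measurable lebesgue" "\<forall>z. 0 \<le> H z"
      "AE z in lebesgue. grand_maximal N u z = ennreal (H z)" and R: "0 < R" and \<psi>R: "\<psi> \<in> frequency_cutoffs R"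
      and bdd: "bounded (range (distr_convolution \<psi> u))"
    for u :: "(real ^ 'n \<Rightarrow> complex) \<Rightarrow> complex" and H R \<psi> x
  proof -
    obtain D where D: "\<forall>y. cmod (distr_convolution \<psi> u y) \<le> D" using bdd unfolding bounded_iff by blast
    define t where "t = 1 / R"
    have t: "0 < t" using R by (simp add: t_def)
    have \<psi>: "\<psi> \<in> schwartz" using \<psi>R by (simp add: frequency_cutoffs_def)
    \<comment> \<open>The cutoff at unit frequency scale. Its transform at \<open>\<xi>\<close> is
      that of \<open>\<psi>\<close> at \<open>R *\<^sub>R \<xi>\<close>, so it reproduces the
      kernel; its translates, tested by \<open>v\<close>, give the values of
      \<open>distr_convolution \<psi> u\<close>.\<close>
    define \<psi>' where "\<psi>' v = of_real (t ^ CARD('n)) * \<psi> (t *\<^sub>R v + 0)" for v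
    have \<psi>': "\<psi>' \<in> schwartz" unfolding \<psi>'_def using t by (intro schwartz_cmult schwartz_affine \<psi>) auto
    have \<psi>'1: "fourier \<psi>' \<xi> = 1" if "norm \<xi> \<le> 1" for \<xi>
    proof -
      have "norm (R *\<^sub>R \<xi>) \<le> R" using that R mult_left_mono[of "norm \<xi>" 1 R] by simp
      then have "R *\<^sub>R \<xi> \<in> cball 0 R" by simp
      then have "fourier \<psi> (R *\<^sub>R \<xi>) = 1" using \<psi>R unfolding frequency_cutoffs_def by blast
      then have "1 = (LINT x|lborel. \<psi> x * exp (- 2 * of_real pi * \<i> * of_real (x \<bullet> (R *\<^sub>R \<xi>))))"
        by (simp add: fourier_schwartz_eq[OF \<psi>])
      also have "\<dots> = (\<bar>t\<bar> ^ CARD('n)) *\<^sub>R (LINT v|lborel. \<psi> (0 + t *\<^sub>R v) *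
          exp (- 2 * of_real pi * \<i> * of_real ((0 + t *\<^sub>R v) \<bullet> (R *\<^sub>R \<xi>))))"
        using t integral_lborel_affine[of t "\<lambda>x. \<psi> x * exp (- 2 * of_real pi * \<i> * of_real (x \<bullet> (R *\<^sub>R \<xi>)))" 0] by simp
      also have "\<dots> = (LINT v|lborel. (\<bar>t\<bar> ^ CARD('n)) *\<^sub>R (\<psi> (0 + t *\<^sub>R v) *
          exp (- 2 * of_real pi * \<i> * of_real ((0 + t *\<^sub>R v) \<bullet> (R *\<^sub>R \<xi>)))))"
        by (rule integral_scaleR_right[symmetric])
      also have "\<dots> = fourier \<psi>' \<xi>"
        unfolding fourier_schwartz_eq[OF \<psi>'] \<psi>'_def
        using t R by (intro Bochner_Integration.integral_cong refl) (simp add: t_def scaleR_conv_of_real[where 'a=complex] mult.assoc)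
      finally show ?thesis by simp
    qed
    obtain v where v: "tempered_functional v" "\<And>f. f \<in> schwartz \<Longrightarrow> u (\<lambda>y. dilate t f (x - y)) = v f"
      by (rule tempered_functional_dilate_reflect[OF u t, of x]) blast
    let ?F = "distr_convolution \<psi> u"
    have vF: "v (\<lambda>z. \<psi>' (z - w)) = ?F (x - t *\<^sub>R w)" for w
    proof -
      have s: "(\<lambda>z. \<psi>' (z - w)) \<in> schwartz" using schwartz_affine[OF \<psi>', of 1 "- w"] by simp
      have "dilate t (\<lambda>z. \<psi>' (z - w)) (x - y) = \<psi> (x - t *\<^sub>R w - y)" for y
        using t by (simp add: dilate_def \<psi>'_def scaleR_conv_of_real[where 'a=complex] scaleR_diff_right algebra_simps)
      then show ?thesis using v(2)[OF s] by (simp add: distr_convolution_def)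
    qed
    have [measurable]: "?F \<in> borel_measurable borel"
      by (rule borel_measurable_continuous_onI[OF continuous_distr_convolution[OF u \<psi>]])
    \<comment> \<open>The truncation has bounded support, so \<open>conv (h M) \<psi>'\<close> is a
      Schwartz function and the functional can be exchanged with the integral.\<close>
    define h where "h M w = ?\<phi> w * indicator (cball 0 (real M)) w" for M :: nat and w
    have hm[measurable]: "h M \<in> borel_measurable borel" for M
      unfolding h_def by (intro borel_measurable_times borel_measurable_indicator bochner_riesz_kernel_measurable) auto
    have hb: "cmod (h M w) \<le> C\<phi>" for M w
      using \<phi>b[of w] C\<phi>(1) by (auto simp: h_def indicator_def)
    define g where "g M = conv (h M) \<psi>'" for M
    have gs: "g M \<in> schwartz" for M
      unfolding g_def by (rule schwartz_conv[OF \<psi>' hm hb, where R="real M"]) (simp add: h_def indicator_def)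
    have vg: "v (g M) = (LINT w|lborel. h M w * ?F (x - t *\<^sub>R w))" for M
    proof -
      have "(LINT w|lborel. h M w * v (\<lambda>z. \<psi>' (z - w))) = v (conv (h M) \<psi>')"
        by (rule tempered_functional_conv[OF v(1) \<psi>' hm hb, where R="real M"]) (simp add: h_def indicator_def)
      then show ?thesis by (simp add: g_def vF)
    qed
    have lim: "(\<lambda>M. v (g M)) \<longlonglongrightarrow> bochner_riesz \<delta> R \<psi> u x"
      unfolding vg bochner_riesz_eq[OF u \<psi> R] t_def[symmetric]
    proof (rule integral_dominated_convergence[where w="\<lambda>w. cmod (?\<phi> w) * D"])
      show "integrable lborel (\<lambda>w. cmod (?\<phi> w) * D)" using \<phi>int by simp
      have "(\<lambda>M. h M w * ?F (x - t *\<^sub>R w)) \<longlonglongrightarrow> ?\<phi> w * ?F (x - t *\<^sub>R w)" for w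
      proof (rule tendsto_eventually)
        obtain M0 :: nat where "norm w \<le> real M0" using real_arch_simple by blast
        then have "h M w = ?\<phi> w" if "M0 \<le> M" for M using that by (simp add: h_def indicator_def)
        then show "\<forall>\<^sub>F M in sequentially. h M w * ?F (x - t *\<^sub>R w) = ?\<phi> w * ?F (x - t *\<^sub>R w)"
          unfolding eventually_sequentially by (intro exI[of _ M0]) auto
      qed
      then show "AE w in lborel. (\<lambda>M. h M w * ?F (x - t *\<^sub>R w)) \<longlonglongrightarrow> ?\<phi> w * ?F (x - t *\<^sub>R w)" by simp
      have "cmod (h M w) \<le> cmod (?\<phi> w)" for M w by (simp add: h_def indicator_def)
      then show "AE w in lborel. norm (h M w * ?F (x - t *\<^sub>R w)) \<le> cmod (?\<phi> w) * D" for M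
        using D by (intro always_eventually allI) (auto simp: norm_mult intro!: mult_mono)
    qed measurable
    obtain C' where C': "0 < C'" "\<And>h A D a \<alpha> x. h \<in> borel_measurable borel \<Longrightarrow>
      (\<And>w. cmod (h w) \<le> D) \<Longrightarrow> (\<And>w. cmod (h w) \<le> A * (1 + norm (w - a)) powr -\<kappa>) \<Longrightarrow> length \<alpha> \<le> N + 1 \<Longrightarrow>
      cmod (iterated_deriv \<alpha> (conv h \<psi>') x) \<le> A * C' * (1 + norm (x - a)) powr -\<kappa>"
      by (rule conv_decay[OF \<psi>', where m="N + 1" and s=\<kappa>]) blast
    define r where "r M w = ?\<phi> w * indicator (- cball 0 (real M)) w" for M :: nat and w
    have rm[measurable]: "r M \<in> borel_measurable borel" for M
      unfolding r_def by (intro borel_measurable_times borel_measurable_indicator bochner_riesz_kernel_measurable) auto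
    have rb: "cmod (r M w) \<le> C\<phi>" for M w
      using \<phi>b[of w] C\<phi>(1) by (auto simp: r_def indicator_def)
    \<comment> \<open>Beyond radius \<open>M\<close> the surplus decay \<open>K - \<kappa>\<close>
      turns into a factor that is small for large \<open>M\<close>.\<close>
    have r\<kappa>: "cmod (r M w) \<le> (C\<phi> * (1 + real M) powr -(K - \<kappa>)) * (1 + norm (w - 0)) powr -\<kappa>" for M w
    proof (cases "norm w \<le> real M")
      case False
      have "cmod (r M w) \<le> C\<phi> * (1 + norm w) powr -K" using C\<phi>(2)[of w] False by (simp add: r_def)
      also have "(1 + norm w) powr -K = (1 + norm w) powr -(K - \<kappa>) * (1 + norm w) powr -\<kappa>"
        by (simp add: powr_add[symmetric])
      also have "C\<phi> * \<dots> \<le> C\<phi> * ((1 + real M) powr -(K - \<kappa>) * (1 + norm w) powr -\<kappa>)"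
        using False \<kappa>K C\<phi>(1) by (intro mult_left_mono mult_right_mono powr_mono2') auto
      finally show ?thesis by (simp add: mult.assoc)
    qed (use C\<phi>(1) in \<open>simp add: r_def indicator_def\<close>)
    have g_eq: "g M = (\<lambda>x. ?\<phi> x - conv (r M) \<psi>' x)" for M
    proof
      fix x
      have "?\<phi> x = conv ?\<phi> \<psi>' x" using conv_bochner_riesz_kernel[OF \<delta> \<psi>' \<psi>'1] by simp
      also have "\<dots> = (LINT w|lborel. h M w * \<psi>' (x - w) + r M w * \<psi>' (x - w))"
        unfolding conv_def h_def r_def by (intro Bochner_Integration.integral_cong refl) (auto simp: indicator_def)
      also have "\<dots> = g M x + conv (r M) \<psi>' x"
        unfolding g_def conv_def
        by (intro Bochner_Integration.integral_add integrable_conv[OF \<psi>' hm hb] integrable_conv[OF \<psi>' rm rb])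
      finally show "g M x = ?\<phi> x - conv (r M) \<psi>' x" by simp
    qed
    have sm\<phi>: "smooth ?\<phi>"
      using smooth_conv[OF \<psi>' bochner_riesz_kernel_measurable \<phi>b] conv_bochner_riesz_kernel[OF \<delta> \<psi>' \<psi>'1] by simp
    have g_bound: "cmod (iterated_deriv \<alpha> (g M) y) \<le> B * (1 + norm y) powr -\<kappa>"
      if M: "C\<phi> * (1 + real M) powr -(K - \<kappa>) * C' \<le> 1" and \<alpha>: "length \<alpha> \<le> N + 1" for M \<alpha> y
    proof -
      have "cmod (iterated_deriv \<alpha> (g M) y) \<le> cmod (iterated_deriv \<alpha> ?\<phi> y) + cmod (iterated_deriv \<alpha> (conv (r M) \<psi>') y)"
        unfolding g_eq iterated_deriv_diff[OF sm\<phi> smooth_conv[OF \<psi>' rm rb]] by (rule norm_triangle_ineq4)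
      also have "\<dots> \<le> C\<phi> * C0 * (1 + norm y) powr -\<kappa> + 1 * (1 + norm y) powr -\<kappa>"
      proof (rule add_mono[OF \<phi>deriv[OF \<alpha>]])
        have "cmod (iterated_deriv \<alpha> (conv (r M) \<psi>') y) \<le> (C\<phi> * (1 + real M) powr -(K - \<kappa>)) * C' * (1 + norm y) powr -\<kappa>"
          using C'(2)[where x=y, OF rm rb r\<kappa> \<alpha>] by (simp only: diff_zero)
        also have "\<dots> \<le> 1 * (1 + norm y) powr -\<kappa>" by (rule mult_right_mono[OF M]) simp
        finally show "cmod (iterated_deriv \<alpha> (conv (r M) \<psi>') y) \<le> 1 * (1 + norm y) powr -\<kappa>" .
      qed
      finally show ?thesis by (simp add: B_def distrib_right)
    qed
    have "(\<lambda>M. C\<phi> * (1 + real M) powr -(K - \<kappa>) * C') \<longlonglongrightarrow> C\<phi> * 0 * C'"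
      using \<kappa>K by (intro tendsto_mult tendsto_const tendsto_neg_powr
          filterlim_tendsto_add_at_top[OF tendsto_const filterlim_real_sequentially]) auto
    then have "\<forall>\<^sub>F M in sequentially. C\<phi> * (1 + real M) powr -(K - \<kappa>) * C' < 1"
      by (rule order_tendstoD(2)) simp
    \<comment> \<open>Only large \<open>M\<close> are covered; an eventual bound is enough for the
      limit.\<close>
    then have ev: "\<forall>\<^sub>F M in sequentially. ennreal (cmod (v (g M)) powr q) \<le>
      ennreal (C1 * B powr q) * hl_maximal (\<lambda>z. ennreal (H z powr q)) x"
    proof eventually_elim
      case (elim M)
      then have "\<forall>\<alpha> y. length \<alpha> \<le> N + 1 \<longrightarrow> cmod (iterated_deriv \<alpha> (g M) y) \<le> B * (1 + norm y) powr -\<kappa>"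
        using g_bound[of M] by simp
      from C1(2)[OF u H gs B this t, of x] show ?case by (simp add: v(2)[OF gs])
    qed
    have "(\<lambda>M. ennreal (cmod (v (g M)) powr q)) \<longlonglongrightarrow> ennreal (cmod (bochner_riesz \<delta> R \<psi> u x) powr q)"
      using q(1) by (intro tendsto_ennrealI tendsto_powr2 tendsto_norm lim tendsto_const) auto
    then show ?thesis by (rule tendsto_upperbound[OF _ ev]) simp
  qed
  moreover have "0 < C1 * B powr q" using C1(1) B by simp
  ultimately show thesis using that by blast
qed

section \<open>Weak Lebesgue bounds and the conclusion\<close>

lemma weak_Lp_norm_imp_emeasure_le:
  fixes g :: "real ^ 'n::finite \<Rightarrow> ennreal"
  assumes norm: "weak_Lp_norm p g = ennreal A" and p: "0 < p" and A: "0 \<le> A" and s: "0 < s"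
  shows "emeasure lebesgue {x. ennreal s < g x} \<le> ennreal ((A / s) powr p)"
proof -
  let ?E = "emeasure lebesgue {x. ennreal s < g x}"
  have "ennreal s * ennreal_powr ?E (1 / p) \<le> ennreal A"
    unfolding norm[symmetric] weak_Lp_norm_def using s by (intro SUP_upper) auto
  \<comment> \<open>An infinite measure would make the product infinite, so passing to
    \<open>enn2real\<close> loses nothing.\<close>
  moreover from this have "?E \<noteq> \<infinity>"
    using s by (auto simp: ennreal_powr_def ennreal_mult_top top_unique)
  ultimately have "ennreal (s * enn2real ?E powr (1 / p)) \<le> ennreal A"
    using s by (simp add: ennreal_powr_def ennreal_mult)
  then have "s * enn2real ?E powr (1 / p) \<le> A" using A by (simp add: ennreal_le_iff)
  then have "enn2real ?E powr (1 / p) \<le> A / s" using s by (simp add: field_simps)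
  then have "(enn2real ?E powr (1 / p)) powr p \<le> (A / s) powr p" using p by (intro powr_mono2) auto
  then have "enn2real ?E \<le> (A / s) powr p" using p by (simp add: powr_powr)
  then have "ennreal (enn2real ?E) \<le> ennreal ((A / s) powr p)" by (rule ennreal_leI)
  moreover have "ennreal (enn2real ?E) = ?E" using \<open>?E \<noteq> \<infinity>\<close> by (simp add: less_top)
  ultimately show ?thesis by simp
qed

text \<open>The set where \<open>g\<close> is infinite lies in every superlevel set, and the bounds
  for these tend to 0.\<close>

lemma weak_Lp_AE_finite:
  fixes g :: "real ^ 'n::finite \<Rightarrow> ennreal"
  assumes g: "g \<in> borel_measurable lebesgue" and p: "0 < p" and A: "0 \<le> A"
    and E: "\<And>s. 0 < s \<Longrightarrow> emeasure lebesgue {x. ennreal s < g x} \<le> ennreal ((A / s) powr p)"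
  shows "AE x in lebesgue. g x = ennreal (enn2real (g x))"
proof -
  let ?T = "{x. g x = \<infinity>}"
  have T: "?T \<in> sets lebesgue" using measurable_sets[OF g, of "{\<infinity>}"] by (simp add: vimage_def)
  have le: "emeasure lebesgue ?T \<le> ennreal ((A / s) powr p)" if "0 < s" for s
  proof -
    have "{x. ennreal s < g x} \<in> sets lebesgue" using measurable_sets[OF g, of "{ennreal s<..}"] by (simp add: vimage_def)
    then have "emeasure lebesgue ?T \<le> emeasure lebesgue {x. ennreal s < g x}"
      by (intro emeasure_mono) auto
    then show ?thesis using E[OF that] by simp
  qed
  have "(\<lambda>k. ennreal ((A / real (Suc k)) powr p)) \<longlonglongrightarrow> ennreal (0 powr p)"
    using p by (intro tendsto_ennrealI tendsto_powr2 tendsto_const LIMSEQ_Suc[OF lim_const_over_n]) (auto simp: A)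
  then have "emeasure lebesgue ?T \<le> ennreal (0 powr p)"
    by (rule LIMSEQ_le_const) (use le in auto)
  then have "?T \<in> null_sets lebesgue" using T by (auto simp: null_sets_def)
  then show ?thesis
  proof (rule AE_I')
    have "g x = \<infinity>" if "g x \<noteq> ennreal (enn2real (g x))" for x
      using that by (cases "g x") auto
    then show "{x \<in> space lebesgue. g x \<noteq> ennreal (enn2real (g x))} \<subseteq> ?T" by blast
  qed
qed

theorem corollary1p3:
  fixes p \<delta> :: real and N :: nat
  assumes "0 < p" and "p \<le> 1"
    and "int N \<ge> \<lfloor>real CARD('n::finite) * (1 / p - 1)\<rfloor>"
    and "\<delta> > real CARD('n) / p - (real CARD('n) + 1) / 2"
  shows "\<exists>C>0. \<forall>f \<in> (weak_Hardy N p :: ((real ^ 'n \<Rightarrow> complex) \<Rightarrow> complex) set).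
           \<forall>\<Psi>. (\<forall>R>0. \<Psi> R \<in> frequency_cutoffs R) \<longrightarrow>
             bochner_riesz_maximal \<delta> \<Psi> f \<in> weak_Lp p \<and>
             weak_Lp_norm p (bochner_riesz_maximal \<delta> \<Psi> f) \<le> ennreal C * weak_Hardy_norm N p f"
proof (cases "frequency_cutoffs 1 = ({} :: (real ^ 'n \<Rightarrow> complex) set)")
  case True
  \<comment> \<open>Assuming a cutoff \<open>\<beta>\<close> below avoids constructing one: without any, the claim is vacuous.\<close>
  then show ?thesis by (intro exI[of _ 1]) (auto dest: spec[of _ 1])
next
  case False
  then obtain \<beta> :: "real ^ 'n \<Rightarrow> complex" where "\<beta> \<in> frequency_cutoffs 1" by blast
  then have \<beta>: "\<beta> \<in> schwartz" "\<And>\<xi>. norm \<xi> \<le> 1 \<Longrightarrow> fourier \<beta> \<xi> = 1"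
    by (auto simp: frequency_cutoffs_def)
  define n where "n = real CARD('n)"
  define K where "K = \<delta> + (n + 1) / 2"
  have n: "1 \<le> n" by (simp add: n_def Suc_leI)
  define P where "P = n / p"
  have nP: "n \<le> P" using assms(1,2) n by (simp add: P_def le_divide_eq mult_left_le)
  have K: "P < K" using assms(4) by (simp add: K_def n_def P_def)
  \<comment> \<open>The midpoint leaves room on both sides: above \<open>n / p\<close> for the
    choice of \<open>q\<close>, and below \<open>K\<close> for the truncation.\<close>
  define \<kappa> where "\<kappa> = (P + K) / 2"
  have \<kappa>: "P < \<kappa>" "\<kappa> < K" using K by (auto simp: \<kappa>_def)
  have \<kappa>n: "n \<le> \<kappa>" using nP \<kappa> by simp
  have \<kappa>0: "0 < \<kappa>" using \<kappa>n n by linarith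
  \<comment> \<open>The condition \<open>q > Q\<close> is exactly \<open>n < \<kappa> * q\<close>,
    and \<open>Q < p\<close> holds because \<open>\<kappa> > n / p\<close>. Any \<open>q\<close>
    strictly between \<open>Q\<close> and \<open>p\<close> would do.\<close>
  define Q where "Q = n / \<kappa>"
  have "n < \<kappa> * p" using \<kappa>(1) assms(1) by (simp add: P_def divide_less_eq)
  then have Qp: "Q < p" using \<kappa>0 by (simp add: Q_def divide_less_eq mult.commute)
  define q where "q = (Q + p) / 2"
  have q: "Q < q" "q < p" using Qp by (auto simp: q_def)
  have "0 \<le> Q" using n \<kappa>0 by (simp add: Q_def)
  then have q0: "0 < q" using q(1) by linarith
  have q1: "q \<le> 1" using q(2) assms(2) by linarith
  have nq: "n < \<kappa> * q" using q(1) \<kappa>0 by (simp add: Q_def divide_less_eq mult.commute)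
  \<comment> \<open>As \<open>n \<le> n / p\<close>, the order \<delta> exceeds the critical index
    (n - 1) / 2, above which the kernel is integrable.\<close>
  have n\<delta>: "(n - 1) / 2 < \<delta>" using nP K unfolding K_def by (simp add: field_simps)
  have "0 \<le> (n - 1) / 2" using n by simp
  then have \<delta>0: "0 \<le> \<delta>" using n\<delta> by (rule order.strict_implies_order[OF order.strict_trans1])
  note \<delta>1 = n\<delta>[unfolded n_def]
  obtain C1 where C1: "0 < C1" "\<And>(u :: (real ^ 'n \<Rightarrow> complex) \<Rightarrow> complex) H R \<psi> x. tempered_functional u \<Longrightarrow>
    H \<in> borel_measurable lebesgue \<Longrightarrow> \<forall>z. 0 \<le> H z \<Longrightarrow>
    AE z in lebesgue. grand_maximal N u z = ennreal (H z) \<Longrightarrow> 0 < R \<Longrightarrow> \<psi> \<in> frequency_cutoffs R \<Longrightarrow>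
    bounded (range (distr_convolution \<psi> u)) \<Longrightarrow>
    ennreal (cmod (bochner_riesz \<delta> R \<psi> u x) powr q) \<le> ennreal C1 * hl_maximal (\<lambda>z. ennreal (H z powr q)) x"
    by (rule bochner_riesz_le_hl_maximal[OF \<delta>0 \<beta> q0 q1 nq[unfolded n_def] \<kappa>(2)[unfolded K_def n_def] \<kappa>n[unfolded n_def], where N=N]) blast+
  obtain C2 where C2: "0 < C2" "\<And>(H :: real ^ 'n \<Rightarrow> real) A s E. H \<in> borel_measurable lebesgue \<Longrightarrow>
    (\<And>x. 0 \<le> H x) \<Longrightarrow> 0 \<le> A \<Longrightarrow>
    (\<And>s. 0 < s \<Longrightarrow> emeasure lebesgue {x. s < H x} \<le> ennreal ((A / s) powr p)) \<Longrightarrow>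
    0 < s \<Longrightarrow> E \<in> sets lebesgue \<Longrightarrow>
    (\<And>x. x \<in> E \<Longrightarrow> ennreal (s powr q) < hl_maximal (\<lambda>z. ennreal (H z powr q)) x) \<Longrightarrow>
    emeasure lebesgue E \<le> ennreal (C2 * (A / s) powr p)"
    by (rule hl_maximal_powr_weak_type[OF q0 q(2), where 'a="real ^ 'n"]) blast
  \<comment> \<open>Moves the factor \<open>C1\<close> into the level: where the maximal operator
    exceeds \<open>s\<close>, the Hardy-Littlewood function of \<open>H powr q\<close> exceeds
    \<open>(s / b) powr q\<close>.\<close>
  define b where "b = C1 powr (1 / q)"
  have b: "0 < b" "b powr q = C1" using C1(1) q0 by (auto simp: b_def powr_powr)
  define C where "C = C2 powr (1 / p) * b"
  have "0 < C" using C2(1) b by (simp add: C_def)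
  have main: "bochner_riesz_maximal \<delta> \<Psi> f \<in> weak_Lp p \<and>
      weak_Lp_norm p (bochner_riesz_maximal \<delta> \<Psi> f) \<le> ennreal C * weak_Hardy_norm N p f"
    if f: "f \<in> weak_Hardy N p" and \<Psi>: "\<forall>R>0. \<Psi> R \<in> frequency_cutoffs R"
    for f :: "(real ^ 'n \<Rightarrow> complex) \<Rightarrow> complex" and \<Psi>
  proof -
    let ?G = "grand_maximal N f"
    have u: "tempered_functional f" using f by (simp add: weak_Hardy_def tempered_distribution_functional)
    have G: "?G \<in> borel_measurable lebesgue" "weak_Lp_norm p ?G < \<infinity>"
      using f by (auto simp: weak_Hardy_def weak_Lp_def)
    then obtain A where A: "weak_Lp_norm p ?G = ennreal A" "0 \<le> A"
      by (cases "weak_Lp_norm p ?G") auto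
    note GA = weak_Lp_norm_imp_emeasure_le[OF A(1) assms(1) A(2)]
    \<comment> \<open>\<open>enn2real\<close> sends infinity to 0, which changes the grand maximal
      function only on a null set.\<close>
    define H where "H x = enn2real (?G x)" for x
    have H: "H \<in> borel_measurable lebesgue" unfolding H_def using G(1) by measurable
    have H0: "\<forall>x. 0 \<le> H x" by (simp add: H_def)
    have GH: "AE x in lebesgue. ?G x = ennreal (H x)"
      unfolding H_def by (rule weak_Lp_AE_finite[OF G(1) assms(1) A(2) GA])
    have HA: "emeasure lebesgue {x. s < H x} \<le> ennreal ((A / s) powr p)" if s: "0 < s" for s
    proof -
      have "{x. ennreal s < ?G x} \<in> sets lebesgue"
        using measurable_sets[OF G(1), of "{ennreal s<..}"] by (simp add: vimage_def)
      moreover have "{x. s < H x} \<subseteq> {x. ennreal s < ?G x}"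
      proof safe
        fix x assume "s < H x"
        then show "ennreal s < ?G x" using s by (cases "?G x") (auto simp: H_def ennreal_less_iff)
      qed
      ultimately have "emeasure lebesgue {x. s < H x} \<le> emeasure lebesgue {x. ennreal s < ?G x}"
        by (intro emeasure_mono)
      then show ?thesis using GA[OF s] by (rule order_trans)
    qed
    let ?T = "bochner_riesz_maximal \<delta> \<Psi> f"
    have T_less: "a < ?T x \<longleftrightarrow> (\<exists>R>0. a < ennreal (cmod (bochner_riesz \<delta> R (\<Psi> R) f x)))" for a x
      by (auto simp: bochner_riesz_maximal_def less_SUP_iff)
    have \<Psi>s: "\<Psi> R \<in> schwartz" if "0 < R" for R
      using \<Psi> that by (auto simp: frequency_cutoffs_def)
    note bdd = distr_convolution_bounded[OF u \<Psi>s assms(1) H GH A(2) HA]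
    \<comment> \<open>The supremum runs over uncountably many \<open>R\<close>, so measurability is
      obtained from a union of open sets.\<close>
    have opn: "open {x. a < ?T x}" for a
    proof -
      have "open {x. a < ennreal (cmod (bochner_riesz \<delta> R (\<Psi> R) f x))}" if R: "0 < R" for R
      proof -
        have "continuous_on UNIV (bochner_riesz \<delta> R (\<Psi> R) f)"
          by (rule continuous_bochner_riesz[OF u \<Psi>s[OF R] R integrable_bochner_riesz_kernel[OF \<delta>1 \<delta>0] bdd[OF R]])
        then have "continuous_on UNIV (\<lambda>x. ennreal (cmod (bochner_riesz \<delta> R (\<Psi> R) f x)))"
          by (intro continuous_on_ennreal continuous_on_norm)
        then show ?thesis by (intro open_Collect_less continuous_on_const)
      qed
      then have "open (\<Union>R\<in>{0<..}. {x. a < ennreal (cmod (bochner_riesz \<delta> R (\<Psi> R) f x))})" by auto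
      also have "(\<Union>R\<in>{0<..}. {x. a < ennreal (cmod (bochner_riesz \<delta> R (\<Psi> R) f x))}) = {x. a < ?T x}"
        by (auto simp: T_less)
      finally show ?thesis .
    qed
    have T_sets: "{x. a < ?T x} \<in> sets lebesgue" for a
      using borel_open[OF opn[of a]] by simp
    have T_meas: "?T \<in> borel_measurable lebesgue"
      using T_sets by (intro borel_measurableI_greater) simp
    have weak: "emeasure lebesgue {x. ennreal s < ?T x} \<le> ennreal (C2 * (A / (s / b)) powr p)" if s: "0 < s" for s
    proof (rule C2(2)[OF H])
      show "0 < s / b" using s b by simp
      show "{x. ennreal s < ?T x} \<in> sets lebesgue" by (rule T_sets)
      fix x assume "x \<in> {x. ennreal s < ?T x}"
      then obtain R where R: "0 < R" "ennreal s < ennreal (cmod (bochner_riesz \<delta> R (\<Psi> R) f x))"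
        by (auto simp: T_less)
      have "s < cmod (bochner_riesz \<delta> R (\<Psi> R) f x)" using R(2) s by (simp add: ennreal_less_iff)
      then have "s powr q < cmod (bochner_riesz \<delta> R (\<Psi> R) f x) powr q"
        using s q0 by (intro powr_less_mono2) auto
      then have "ennreal (s powr q) < ennreal (cmod (bochner_riesz \<delta> R (\<Psi> R) f x) powr q)"
        by (simp add: ennreal_less_iff)
      also have "\<dots> \<le> ennreal C1 * hl_maximal (\<lambda>z. ennreal (H z powr q)) x"
        using \<Psi> R(1) by (intro C1(2)[OF u H H0 GH R(1) _ bdd[OF R(1)]]) blast
      finally have *: "ennreal (s powr q) < ennreal C1 * hl_maximal (\<lambda>z. ennreal (H z powr q)) x" .
      show "ennreal ((s / b) powr q) < hl_maximal (\<lambda>z. ennreal (H z powr q)) x"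
      proof (rule ccontr)
        assume "\<not> ennreal ((s / b) powr q) < hl_maximal (\<lambda>z. ennreal (H z powr q)) x"
        then have "ennreal C1 * hl_maximal (\<lambda>z. ennreal (H z powr q)) x \<le> ennreal C1 * ennreal ((s / b) powr q)"
          by (intro mult_left_mono) (auto simp: not_less)
        also have "\<dots> = ennreal (s powr q)"
          using s b C1(1) by (simp add: ennreal_mult[symmetric] powr_divide)
        finally show False using * by simp
      qed
    qed (use H0 A(2) HA in auto)
    have norm_le: "weak_Lp_norm p ?T \<le> ennreal C * weak_Hardy_norm N p f"
      unfolding weak_Lp_norm_def[of p ?T]
    proof (rule SUP_least)
      fix s :: real assume "s \<in> {0<..}"
      then have s: "0 < s" by simp
      let ?E = "emeasure lebesgue {x. ennreal s < ?T x}"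
      have fin: "?E \<noteq> \<infinity>" using weak[OF s] by (auto simp: top_unique)
      have "enn2real ?E \<le> C2 * (A / (s / b)) powr p"
        using weak[OF s] C2(1) by (intro enn2real_leI) auto
      then have "enn2real ?E powr (1 / p) \<le> (C2 * (A / (s / b)) powr p) powr (1 / p)"
        using assms(1) by (intro powr_mono2) auto
      also have "\<dots> = C2 powr (1 / p) * (A / (s / b))"
        using assms(1) C2(1) A(2) s b by (simp add: powr_mult powr_powr)
      finally have "s * enn2real ?E powr (1 / p) \<le> s * (C2 powr (1 / p) * (A / (s / b)))"
        using s by (intro mult_left_mono) auto
      also have "\<dots> = C * A" using s by (simp add: C_def)
      finally have "ennreal (s * enn2real ?E powr (1 / p)) \<le> ennreal (C * A)" by (rule ennreal_leI)
      then show "ennreal s * ennreal_powr ?E (1 / p) \<le> ennreal C * weak_Hardy_norm N p f"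
        using fin s \<open>0 < C\<close> A by (simp add: ennreal_powr_def ennreal_mult weak_Hardy_norm_def)
    qed
    have "weak_Hardy_norm N p f < \<infinity>" using G(2) by (simp add: weak_Hardy_norm_def)
    then have "ennreal C * weak_Hardy_norm N p f < \<infinity>" by (simp add: ennreal_mult_less_top)
    then have "weak_Lp_norm p ?T < \<infinity>" using norm_le by (rule le_less_trans[rotated])
    then show ?thesis using T_meas norm_le by (simp add: weak_Lp_def)
  qed
  then show ?thesis using \<open>0 < C\<close> by (intro exI[of _ C]) blast
qed

end
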